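(* The constrained ranking maximization problem (LU) in which every item has at most one property (i.e. $\Delta=\max_{i\in[m]}|T_i|=1$) can be solved in $\widetilde{O}(n^2 m)$ time when the values $W$ are monotone and satisfy the Monge property.
   Context: An instance consists of $m$ items, $n\le m$ ranking positions, a value matrix $W\in\mathbb{R}^{m\times n}$ ($W_{ij}$ is the value of placing item $i$ at position $j$), properties $P_1,\dots,P_p\subseteq[m]$, and integer bounds $L_{k\ell},U_{k\ell}\in\mathbb{Z}_{\ge 0}$ for $k\in[n]$, $\ell\in[p]$. A ranking is a matrix $x\in\{0,1\}^{m\times n}$ with $\sum_{i=1}^m x_{ij}=1$ for every $j\in[n]$ and $\sum_{j=1}^n x_{ij}\le 1$ for every $i\in[m]$. The constrained ranking maximization problem (LU) asks for a ranking maximizing $\sum_{i,j}W_{ij}x_{ij}$ subject to $L_{k\ell}\le\sum_{j=1}^k\sum_{i\in P_\ell}x_{ij}\le U_{k\ell}$ for all $\ell\in[p]$, $k\in[n]$. The type of item $i$ is $T_i=\{\ell\in[p]: i\in P_\ell\}$. $W$ is monotone and satisfies the Monge property if for all $1\le i_1<i_2\le m$ and $1\le j_1<j_2\le n$: $W_{i_1j_1}\ge W_{i_2j_1}$, $W_{i_1j_1}\ge W_{i_1j_2}$, and $W_{i_1j_1}+W_{i_2j_2}\ge W_{i_1j_2}+W_{i_2j_1}$. $\widetilde{O}$ hides polylogarithmic factors.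
   Formalization: The time bound is stated for p ≤ nm (automatic if all properties are nonempty) and n ≥ 1: with many empty properties all np lower bounds must be read, so no algorithm meets the bound; correctness and termination hold for every p. Properties are input as sorted lists. *)

theory Defs
  imports Complex_Main
begin

section \<open>The constrained ranking maximization problem\<close>

text \<open>Items, positions and properties are indexed from 1.\<close>

record lu_instance =
  num_items :: nat
  num_positions :: nat
  num_props :: nat
  val :: "nat \<Rightarrow> nat \<Rightarrow> real"
  property :: "nat \<Rightarrow> nat set"
  lower :: "nat \<Rightarrow> nat \<Rightarrow> nat"
  upper :: "nat \<Rightarrow> nat \<Rightarrow> nat"

definition valid_instance :: "lu_instance \<Rightarrow> bool" where
  "valid_instance I \<longleftrightarrow>
     1 \<le> num_positions I \<and> num_positions I \<le> num_items I \<and>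
     (\<forall>l\<in>{1..num_props I}. property I l \<subseteq> {1..num_items I})"

definition is_ranking :: "lu_instance \<Rightarrow> (nat \<Rightarrow> nat \<Rightarrow> nat) \<Rightarrow> bool" where
  "is_ranking I x \<longleftrightarrow>
     (\<forall>i\<in>{1..num_items I}. \<forall>j\<in>{1..num_positions I}. x i j \<in> {0, 1}) \<and>
     (\<forall>j\<in>{1..num_positions I}. (\<Sum>i = 1..num_items I. x i j) = 1) \<and>
     (\<forall>i\<in>{1..num_items I}. (\<Sum>j = 1..num_positions I. x i j) \<le> 1)"

definition lu_feasible :: "lu_instance \<Rightarrow> (nat \<Rightarrow> nat \<Rightarrow> nat) \<Rightarrow> bool" where
  "lu_feasible I x \<longleftrightarrow> is_ranking I x \<and>
     (\<forall>l\<in>{1..num_props I}. \<forall>k\<in>{1..num_positions I}.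
        lower I k l \<le> (\<Sum>j = 1..k. \<Sum>i\<in>property I l. x i j) \<and>
        (\<Sum>j = 1..k. \<Sum>i\<in>property I l. x i j) \<le> upper I k l)"

definition ranking_value :: "lu_instance \<Rightarrow> (nat \<Rightarrow> nat \<Rightarrow> nat) \<Rightarrow> real" where
  "ranking_value I x =
     (\<Sum>i = 1..num_items I. \<Sum>j = 1..num_positions I. val I i j * real (x i j))"

definition lu_optimal :: "lu_instance \<Rightarrow> (nat \<Rightarrow> nat \<Rightarrow> nat) \<Rightarrow> bool" where
  "lu_optimal I x \<longleftrightarrow> lu_feasible I x \<and>
     (\<forall>y. lu_feasible I y \<longrightarrow> ranking_value I y \<le> ranking_value I x)"

definition item_type :: "lu_instance \<Rightarrow> nat \<Rightarrow> nat set" where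
  "item_type I i = {l \<in> {1..num_props I}. i \<in> property I l}"

definition Delta :: "lu_instance \<Rightarrow> nat" where
  "Delta I = Max ((\<lambda>i. card (item_type I i)) ` {1..num_items I})"

definition monotone_Monge :: "lu_instance \<Rightarrow> bool" where
  "monotone_Monge I \<longleftrightarrow>
     (\<forall>i\<^sub>1 i\<^sub>2 j\<^sub>1 j\<^sub>2.
        1 \<le> i\<^sub>1 \<and> i\<^sub>1 < i\<^sub>2 \<and> i\<^sub>2 \<le> num_items I \<and>
        1 \<le> j\<^sub>1 \<and> j\<^sub>1 < j\<^sub>2 \<and> j\<^sub>2 \<le> num_positions I \<longrightarrow>
        val I i\<^sub>1 j\<^sub>1 \<ge> val I i\<^sub>2 j\<^sub>1 \<and>
        val I i\<^sub>1 j\<^sub>1 \<ge> val I i\<^sub>1 j\<^sub>2 \<and>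
        val I i\<^sub>1 j\<^sub>1 + val I i\<^sub>2 j\<^sub>2 \<ge> val I i\<^sub>1 j\<^sub>2 + val I i\<^sub>2 j\<^sub>1)"


section \<open>A real RAM\<close>

text \<open>
  The machine is a unit-cost real RAM, programmed in a structured language. Memory consists of
  named arrays of naturals and named arrays of reals, with indirect addressing; a scalar is
  cell 0 of an array. A program mentions finitely many names, so the arrays of each sort could
  be interleaved into one linear memory. The arithmetic consists of addition, subtraction
  (truncated on naturals) and comparison only, with natural constants: there is no
  multiplication, rounding or arbitrary real constant through which unit cost could be abused.
\<close>

type_synonym vname = string

record store =
  nmem :: "vname \<Rightarrow> nat \<Rightarrow> nat"
  rmem :: "vname \<Rightarrow> nat \<Rightarrow> real"

datatype nexp =
    NConst nat
  | NGet vname nexp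
  | NAdd nexp nexp
  | NSub nexp nexp

datatype rexp =
    RConst nat
  | RGet vname nexp
  | RAdd rexp rexp
  | RSub rexp rexp

datatype bexp =
    NLess nexp nexp
  | RLess rexp rexp
  | BNot bexp
  | BAnd bexp bexp

datatype com =
    Skip
  | NSet vname nexp nexp
  | RSet vname nexp rexp
  | Seq com com
  | Cond bexp com com
  | While bexp com

fun nval :: "nexp \<Rightarrow> store \<Rightarrow> nat" where
  "nval (NConst c) s = c"
| "nval (NGet a e) s = nmem s a (nval e s)"
| "nval (NAdd e f) s = nval e s + nval f s"
| "nval (NSub e f) s = nval e s - nval f s"

fun rval :: "rexp \<Rightarrow> store \<Rightarrow> real" where
  "rval (RConst c) s = real c"
| "rval (RGet a e) s = rmem s a (nval e s)"
| "rval (RAdd e f) s = rval e s + rval f s"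
| "rval (RSub e f) s = rval e s - rval f s"

fun bval :: "bexp \<Rightarrow> store \<Rightarrow> bool" where
  "bval (NLess e f) s \<longleftrightarrow> nval e s < nval f s"
| "bval (RLess e f) s \<longleftrightarrow> rval e s < rval f s"
| "bval (BNot b) s \<longleftrightarrow> \<not> bval b s"
| "bval (BAnd b c) s \<longleftrightarrow> bval b s \<and> bval c s"

fun ncost :: "nexp \<Rightarrow> nat" where
  "ncost (NConst c) = 1"
| "ncost (NGet a e) = 1 + ncost e"
| "ncost (NAdd e f) = 1 + ncost e + ncost f"
| "ncost (NSub e f) = 1 + ncost e + ncost f"

fun rcost :: "rexp \<Rightarrow> nat" where
  "rcost (RConst c) = 1"
| "rcost (RGet a e) = 1 + ncost e"
| "rcost (RAdd e f) = 1 + rcost e + rcost f"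
| "rcost (RSub e f) = 1 + rcost e + rcost f"

fun bcost :: "bexp \<Rightarrow> nat" where
  "bcost (NLess e f) = 1 + ncost e + ncost f"
| "bcost (RLess e f) = 1 + rcost e + rcost f"
| "bcost (BNot b) = 1 + bcost b"
| "bcost (BAnd b c) = 1 + bcost b + bcost c"

definition nupd :: "vname \<Rightarrow> nat \<Rightarrow> nat \<Rightarrow> store \<Rightarrow> store" where
  "nupd a i v s = s\<lparr>nmem := (nmem s)(a := (nmem s a)(i := v))\<rparr>"

definition rupd :: "vname \<Rightarrow> nat \<Rightarrow> real \<Rightarrow> store \<Rightarrow> store" where
  "rupd a i v s = s\<lparr>rmem := (rmem s)(a := (rmem s a)(i := v))\<rparr>"

text \<open>\<open>exec c s t s'\<close>: started in \<open>s\<close>, the program \<open>c\<close> halts in \<open>s'\<close> after \<open>t\<close> steps.\<close>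

inductive exec :: "com \<Rightarrow> store \<Rightarrow> nat \<Rightarrow> store \<Rightarrow> bool" where
  Skip: "exec Skip s 1 s"
| NSet: "exec (NSet a e f) s (1 + ncost e + ncost f) (nupd a (nval e s) (nval f s) s)"
| RSet: "exec (RSet a e f) s (1 + ncost e + rcost f) (rupd a (nval e s) (rval f s) s)"
| Seq: "exec c s t s' \<Longrightarrow> exec d s' u s'' \<Longrightarrow> exec (Seq c d) s (t + u) s''"
| CondTrue: "bval b s \<Longrightarrow> exec c s t s' \<Longrightarrow> exec (Cond b c d) s (1 + bcost b + t) s'"
| CondFalse: "\<not> bval b s \<Longrightarrow> exec d s t s' \<Longrightarrow> exec (Cond b c d) s (1 + bcost b + t) s'"
| WhileFalse: "\<not> bval b s \<Longrightarrow> exec (While b c) s (1 + bcost b) s"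
| WhileTrue: "bval b s \<Longrightarrow> exec c s t s' \<Longrightarrow> exec (While b c) s' u s'' \<Longrightarrow>
    exec (While b c) s (1 + bcost b + t + u) s''"

inductive_cases exec_SkipE: "exec Skip s t s'"
inductive_cases exec_NSetE: "exec (NSet a e f) s t s'"
inductive_cases exec_RSetE: "exec (RSet a e f) s t s'"
inductive_cases exec_SeqE: "exec (Seq c d) s t s'"
inductive_cases exec_CondE: "exec (Cond b c d) s t s'"
inductive_cases exec_WhileE: "exec (While b c) s t s'"

lemma exec_deterministic:
  "exec c s t s' \<Longrightarrow> exec c s u s'' \<Longrightarrow> t = u \<and> s' = s''"
proof (induction arbitrary: u s'' rule: exec.induct)
  case (Skip s) then show ?case by (auto elim: exec_SkipE)
next
  case (NSet a e f s) then show ?case by (auto elim: exec_NSetE)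
next
  case (RSet a e f s) then show ?case by (auto elim: exec_RSetE)
next
  case (Seq c s t s' d v r)
  from Seq.prems show ?case
  proof (rule exec_SeqE)
    fix t1 s1 t2
    assume *: "u = t1 + t2" "exec c s t1 s1" "exec d s1 t2 s''"
    from Seq.IH(1)[OF *(2)] have "t = t1" "s' = s1" by auto
    with Seq.IH(2) * show ?thesis by metis
  qed
next
  case (CondTrue b s c t s' d)
  from CondTrue.prems show ?case
    by (rule exec_CondE) (use CondTrue.hyps(1) CondTrue.IH in fastforce)+
next
  case (CondFalse b s d t s' c)
  from CondFalse.prems show ?case
    by (rule exec_CondE) (use CondFalse.hyps(1) CondFalse.IH in fastforce)+
next
  case (WhileFalse b s c)
  from WhileFalse.prems show ?case
    by (rule exec_WhileE) (use WhileFalse.hyps in simp_all)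
next
  case (WhileTrue b s c t s' v r)
  from WhileTrue.prems show ?case
  proof (rule exec_WhileE)
    assume "\<not> bval b s"
    with WhileTrue.hyps(1) show ?thesis by simp
  next
    fix t1 s1 t2
    assume *: "u = Suc (bcost b + t1 + t2)" "exec c s t1 s1" "exec (While b c) s1 t2 s''"
    from WhileTrue.IH(1)[OF *(2)] have "t = t1" "s' = s1" by auto
    with WhileTrue.IH(2) * show ?thesis by auto
  qed
qed


section \<open>Input and output\<close>

text \<open>
  Matrices are stored row by row: with 1-based indices, entry \<open>(i, j)\<close> of a matrix with \<open>n\<close>
  columns is in cell \<open>i * n + j\<close>. The properties are given by the concatenation \<open>''pitems''\<close>
  of the increasing lists of their elements; the list of property \<open>l\<close> starts at cell
  \<open>pstart I l\<close> and ends before cell \<open>pstart I (l + 1)\<close>. Cells of the input arrays outside the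
  stated ranges are arbitrary, all other memory is initially zero.
\<close>

definition pstart :: "lu_instance \<Rightarrow> nat \<Rightarrow> nat" where
  "pstart I l = (\<Sum>l' = 1..<l. card (property I l'))"

definition encodes :: "store \<Rightarrow> lu_instance \<Rightarrow> bool" where
  "encodes s I \<longleftrightarrow>
     nmem s ''m'' 0 = num_items I \<and>
     nmem s ''n'' 0 = num_positions I \<and>
     nmem s ''p'' 0 = num_props I \<and>
     (\<forall>i\<in>{1..num_items I}. \<forall>j\<in>{1..num_positions I}.
        rmem s ''W'' (i * num_positions I + j) = val I i j) \<and>
     (\<forall>k\<in>{1..num_positions I}. \<forall>l\<in>{1..num_props I}.
        nmem s ''L'' (k * num_props I + l) = lower I k l \<and>
        nmem s ''U'' (k * num_props I + l) = upper I k l) \<and>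
     (\<forall>l\<in>{1..num_props I + 1}. nmem s ''pstart'' l = pstart I l) \<and>
     (\<forall>l\<in>{1..num_props I}. \<forall>r<card (property I l).
        nmem s ''pitems'' (pstart I l + r) = sorted_list_of_set (property I l) ! r) \<and>
     (\<forall>a. a \<notin> {''m'', ''n'', ''p'', ''L'', ''U'', ''pstart'', ''pitems''} \<longrightarrow>
        nmem s a = (\<lambda>_. 0)) \<and>
     (\<forall>a. a \<noteq> ''W'' \<longrightarrow> rmem s a = (\<lambda>_. 0))"

definition output_ranking :: "store \<Rightarrow> lu_instance \<Rightarrow> nat \<Rightarrow> nat \<Rightarrow> nat" where
  "output_ranking s I i j = nmem s ''x'' (i * num_positions I + j)"

definition correct_output :: "store \<Rightarrow> lu_instance \<Rightarrow> bool" where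
  "correct_output s I \<longleftrightarrow>
     (if \<exists>y. lu_feasible I y
      then nmem s ''feasible'' 0 = 1 \<and> lu_optimal I (output_ranking s I)
      else nmem s ''feasible'' 0 = 0)"

text \<open>The bound \<open>C * g * log\<^sup>d g\<close>; the shift by 2 keeps the logarithm at least 1.
  The \<open>2 * n * p\<close> bounds \<open>L\<close>, \<open>U\<close> fit into \<open>O(n\<^sup>2 * m)\<close> cells only if \<open>p\<close> is \<open>O(n * m)\<close>. Beyond
  that, which needs empty properties, no algorithm runs in time \<open>n\<^sup>2 * m\<close> up to logarithms: each
  lower bound of an empty property has to be inspected, as a positive one makes the instance
  infeasible.\<close>

definition soft_O_bound :: "real \<Rightarrow> nat \<Rightarrow> real \<Rightarrow> real" where
  "soft_O_bound C d g = C * g * log 2 (2 + g) ^ d"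

end

theory Submission
  imports Defs
begin

text \<open>
  Since the classes are disjoint, the Monge property allows the items of a class to be exchanged
  until they appear in increasing order. The \<open>r\<close>-th item of class \<open>l\<close> is then among the first \<open>k\<close>
  positions iff the class occupies at least \<open>r\<close> of them, so the bounds \<open>L\<close> and \<open>U\<close> become
  constraints on single items: an interval of allowed positions, and the obligation to be ranked at
  all if some \<open>L\<close> is at least \<open>r\<close>. This is an assignment problem. A large penalty for forbidden
  positions and a small one for optional items put the constraints into the costs, and the
  Hungarian method solves the problem in \<open>O(n\<^sup>2 * m)\<close> steps, one phase of \<open>n\<close> scans of the
  \<open>m\<close> items per position. If the resulting ranking violates a bound, the instance is infeasible.
\<close>

section \<open>Program logic\<close>

text \<open>Monotonicity compares two items only in columns that have a later column, so an exchange
  that involves position \<open>n\<close> may lose value. The assignment is therefore solved for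
  \<open>adj_val\<close>, which dominates \<open>W\<close>, and one final exchange inside a class
  turns the solution into a ranking worth at least its adjusted value. Every matching ranks exactly
  \<open>n\<close> items, so all penalties may be shifted by a common amount. The shift makes them
  1, 2 and 3: costs become nonnegative, as the Hungarian method needs, and the penalties of a
  matching add up to a constant plus a nonnegative integer that vanishes iff no constraint on an
  item is violated. As \<open>N\<close> exceeds every difference of two total values, a cheapest
  matching violates nothing if that is possible at all. Conversely, such a matching obeys the bounds
  in whatever order its classes appear, provided that no lower bound exceeds the size of its class;
  the exchange argument is applied to the competitors only. A class that is too small leaves no
  trace in the penalties, so the bounds are counted once more at the end.\<close>

definition run :: "com \<Rightarrow> store \<Rightarrow> nat \<Rightarrow> (store \<Rightarrow> bool) \<Rightarrow> bool" where
  "run c s T Q \<longleftrightarrow> (\<exists>t s'. exec c s t s' \<and> t \<le> T \<and> Q s')"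

fun nwrites :: "com \<Rightarrow> vname set" where
  "nwrites Skip = {}"
| "nwrites (NSet a e f) = {a}"
| "nwrites (RSet a e f) = {}"
| "nwrites (Seq c d) = nwrites c \<union> nwrites d"
| "nwrites (Cond b c d) = nwrites c \<union> nwrites d"
| "nwrites (While b c) = nwrites c"

fun rwrites :: "com \<Rightarrow> vname set" where
  "rwrites Skip = {}"
| "rwrites (NSet a e f) = {}"
| "rwrites (RSet a e f) = {a}"
| "rwrites (Seq c d) = rwrites c \<union> rwrites d"
| "rwrites (Cond b c d) = rwrites c \<union> rwrites d"
| "rwrites (While b c) = rwrites c"

text \<open>The frame condition is tracked per array and read off the syntax, so a specification
  describes only the arrays that a program writes.\<close>

definition agree :: "com \<Rightarrow> store \<Rightarrow> store \<Rightarrow> bool" where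
  "agree c s s' \<longleftrightarrow>
     (\<forall>a. a \<notin> nwrites c \<longrightarrow> nmem s' a = nmem s a) \<and>
     (\<forall>a. a \<notin> rwrites c \<longrightarrow> rmem s' a = rmem s a)"

lemma agree_nmem: "agree c s s' \<Longrightarrow> a \<notin> nwrites c \<Longrightarrow> nmem s' a = nmem s a"
  and agree_rmem: "agree c s s' \<Longrightarrow> a \<notin> rwrites c \<Longrightarrow> rmem s' a = rmem s a"
  by (auto simp: agree_def)

lemma agree_trans: "agree c s s' \<Longrightarrow> agree c s' s'' \<Longrightarrow> agree c s s''"
  by (simp add: agree_def)

lemma nmem_nupd [simp]:
  "nmem (nupd a i v s) b = (if b = a then (nmem s a)(i := v) else nmem s b)"
  by (simp add: nupd_def)

lemma rmem_rupd [simp]: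
  "rmem (rupd a i v s) b = (if b = a then (rmem s a)(i := v) else rmem s b)"
  by (simp add: rupd_def)

lemma rmem_nupd [simp]: "rmem (nupd a i v s) = rmem s"
  and nmem_rupd [simp]: "nmem (rupd a i w s) = nmem s"
  by (simp_all add: nupd_def rupd_def)

lemma exec_agree: "exec c s t s' \<Longrightarrow> agree c s s'"
  by (induction rule: exec.induct) (auto simp: agree_def)

lemma runE:
  assumes "run c s T Q"
  obtains t s' where "exec c s t s'" "t \<le> T" "Q s'" "agree c s s'"
  using assms exec_agree unfolding run_def by blast

text \<open>The consequence rule hands over \<open>agree\<close> as well, so postconditions need not
  carry the frame.\<close>

lemma run_mono:
  "run c s T Q \<Longrightarrow> T \<le> T' \<Longrightarrow> (\<And>s'. Q s' \<Longrightarrow> agree c s s' \<Longrightarrow> Q' s') \<Longrightarrow> run c s T' Q'"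
  unfolding run_def using exec_agree le_trans by blast

lemma run_Seq:
  assumes "run c s T Q" and "\<And>s'. Q s' \<Longrightarrow> agree c s s' \<Longrightarrow> run d s' T' Q'"
  shows "run (Seq c d) s (T + T') Q'"
proof -
  obtain t s' where c: "exec c s t s'" "t \<le> T" "Q s'"
    using assms(1) by (auto simp: run_def)
  moreover obtain t' s'' where "exec d s' t' s''" "t' \<le> T'" "Q' s''"
    using assms(2)[OF c(3) exec_agree[OF c(1)]] by (auto simp: run_def)
  ultimately show ?thesis
    unfolding run_def by (meson add_mono exec.Seq)
qed

lemma run_Cond:
  assumes "bval b s \<Longrightarrow> run c s T Q" and "\<not> bval b s \<Longrightarrow> run d s T Q"
  shows "run (Cond b c d) s (1 + bcost b + T) Q"
proof (cases "bval b s")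
  case True
  with assms(1) obtain t s' where "exec c s t s'" "t \<le> T" "Q s'" by (auto simp: run_def)
  then show ?thesis
    unfolding run_def using True exec.CondTrue[of b s c t s' d] by (metis nat_add_left_cancel_le)
next
  case False
  with assms(2) obtain t s' where "exec d s t s'" "t \<le> T" "Q s'" by (auto simp: run_def)
  then show ?thesis
    unfolding run_def using False exec.CondFalse[of b s d t s' c] by (metis nat_add_left_cancel_le)
qed

section \<open>Straight-line code by symbolic evaluation\<close>

fun loop_free :: "com \<Rightarrow> bool" where
  "loop_free (Seq c d) \<longleftrightarrow> loop_free c \<and> loop_free d"
| "loop_free (Cond b c d) \<longleftrightarrow> loop_free c \<and> loop_free d"
| "loop_free (While b c) \<longleftrightarrow> False"
| "loop_free _ \<longleftrightarrow> True"

fun result :: "com \<Rightarrow> store \<Rightarrow> store" where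
  "result (NSet a e f) s = nupd a (nval e s) (nval f s) s"
| "result (RSet a e f) s = rupd a (nval e s) (rval f s) s"
| "result (Seq c d) s = result d (result c s)"
| "result (Cond b c d) s = (if bval b s then result c s else result d s)"
| "result _ s = s"

text \<open>Both branches of a conditional are charged. The overestimate is harmless and leaves a
  number that \<open>simp\<close> computes; the constants given to \<open>run_loop_free\<close> and
  \<open>run_For_body\<close> below need only dominate it.\<close>

fun max_cost :: "com \<Rightarrow> nat" where
  "max_cost (NSet a e f) = 1 + ncost e + ncost f"
| "max_cost (RSet a e f) = 1 + ncost e + rcost f"
| "max_cost (Seq c d) = max_cost c + max_cost d"
| "max_cost (Cond b c d) = 1 + bcost b + (max_cost c + max_cost d)"
| "max_cost _ = 1"

lemma run_loop_free_result: "loop_free c \<Longrightarrow> run c s (max_cost c) (\<lambda>s'. s' = result c s)"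
proof (induction c arbitrary: s)
  case Skip
  then show ?case by (auto simp: run_def intro: exec.Skip)
next
  case (NSet a e f)
  then show ?case by (fastforce simp: run_def intro: exec.NSet[simplified])
next
  case (RSet a e f)
  then show ?case by (fastforce simp: run_def intro: exec.RSet[simplified])
next
  case (Seq c d)
  then show ?case by (auto intro!: run_Seq)
next
  case (Cond b c d)
  have "run c s (max_cost c + max_cost d) (\<lambda>s'. s' = result c s)"
       "run d s (max_cost c + max_cost d) (\<lambda>s'. s' = result d s)"
    using Cond by (auto intro!: run_mono[OF Cond.IH(1)] run_mono[OF Cond.IH(2)])
  then show ?case
    unfolding max_cost.simps by (intro run_Cond) (auto elim: run_mono)
qed auto

lemma run_loop_free:
  "loop_free c \<Longrightarrow> max_cost c \<le> T \<Longrightarrow> Q (result c s) \<Longrightarrow> run c s T Q"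
  by (rule run_mono[OF run_loop_free_result]) auto

section \<open>Counting loops and their cost\<close>

abbreviation Var :: "vname \<Rightarrow> nexp" where
  "Var x \<equiv> NGet x (NConst 0)"

abbreviation RVar :: "vname \<Rightarrow> rexp" where
  "RVar x \<equiv> RGet x (NConst 0)"

definition For :: "vname \<Rightarrow> vname \<Rightarrow> com \<Rightarrow> com" where
  "For x y c = Seq (NSet x (NConst 0) (NConst 1))
     (While (NLess (Var x) (NAdd (Var y) (NConst 1)))
        (Seq c (NSet x (NConst 0) (NAdd (Var x) (NConst 1)))))"

lemma nwrites_For [simp]: "nwrites (For x y c) = insert x (nwrites c)"
  and rwrites_For [simp]: "rwrites (For x y c) = rwrites c"
  by (auto simp: For_def)

text \<open>Each round has an overhead of 14 steps, 8 for the successful test and 6 for the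
  increment; the other 11 are 3 for the initialization and 8 for the failing last test. The cost
  \<open>T k\<close> may depend on the round, so that the lengths of all property lists can be added
  up instead of being multiplied by their maximum.\<close>

lemma run_For_sum:
  assumes N: "nmem s y 0 = N" and xy: "x \<noteq> y" "x \<notin> nwrites c" "y \<notin> nwrites c"
    and init: "Inv 1 (nupd x 0 1 s)"
    and step: "\<And>k s'. \<lbrakk>1 \<le> k; k \<le> N; nmem s' x 0 = k; agree (For x y c) s s'; Inv k s'\<rbrakk>
      \<Longrightarrow> run c s' (T k) (\<lambda>s''. Inv (Suc k) (nupd x 0 (Suc k) s''))"
  shows "run (For x y c) s (11 + (\<Sum>k = 1..N. T k + 14)) (Inv (Suc N))"
proof -
  let ?b = "NLess (Var x) (NAdd (Var y) (NConst 1))"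
  let ?c = "Seq c (NSet x (NConst 0) (NAdd (Var x) (NConst 1)))"
  have loop: "run (While ?b ?c) s' (8 + (\<Sum>k = k..N. T k + 14)) (Inv (Suc N))"
    if "k \<le> Suc N" "1 \<le> k" "nmem s' x 0 = k" "agree (For x y c) s s'" "Inv k s'" for k s'
    using that
  \<comment> \<open>Downward induction from the exit value \<open>Suc N\<close>: the hypothesis
    covers the rounds still to come.\<close>
  proof (induction k arbitrary: s' rule: inc_induct)
    case base
    have "nmem s' y 0 = N"
      using agree_nmem[OF base(3), of y] N xy by simp
    then have "\<not> bval ?b s'"
      using base by simp
    from exec.WhileFalse[OF this, of ?c] show ?case
      using base unfolding run_def by (intro exI[of _ "1 + bcost ?b"] exI[of _ s']) auto
  next
    case (step k)
    have y: "nmem s' y 0 = N"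
      using agree_nmem[OF step(6), of y] N xy by simp
    then have b: "bval ?b s'"
      using step by simp
    have "run c s' (T k) (\<lambda>s''. Inv (Suc k) (nupd x 0 (Suc k) s''))"
      using step by (intro assms(6)) auto
    then obtain t s1 where 1: "exec c s' t s1" "t \<le> T k" "Inv (Suc k) (nupd x 0 (Suc k) s1)"
      by (auto simp: run_def)
    let ?s2 = "nupd x 0 (Suc k) s1"
    have "nmem s1 x = nmem s' x"
      using exec_agree[OF 1(1)] xy by (simp add: agree_nmem)
    then have 2: "exec ?c s' (t + 6) ?s2"
      using exec.Seq[OF 1(1) exec.NSet[of x "NConst 0" "NAdd (Var x) (NConst 1)"]] step.prems
      by (simp add: numeral_eq_Suc)
    have "agree (For x y c) s' ?s2"
      using exec_agree[OF 1(1)] by (auto simp: agree_def)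
    with step.prems have "agree (For x y c) s ?s2"
      by (blast intro: agree_trans)
    with step.IH[of ?s2] 1(3) obtain t' s3 where
      3: "exec (While ?b ?c) ?s2 t' s3" "t' \<le> 8 + (\<Sum>k = Suc k..N. T k + 14)" "Inv (Suc N) s3"
      by (auto simp: run_def)
    have "exec (While ?b ?c) s' (1 + bcost ?b + (t + 6) + t') s3"
      by (rule exec.WhileTrue[OF b 2 3(1)])
    moreover have "1 + bcost ?b + (t + 6) + t' \<le> 8 + (\<Sum>k = k..N. T k + 14)"
      using 1(2) 3(2) step.hyps by (subst sum.atLeast_Suc_atMost) (auto simp: add.commute)
    ultimately show ?case
      using 3(3) unfolding run_def by blast
  qed
  have "run (For x y c) s (3 + (8 + (\<Sum>k = 1..N. T k + 14))) (Inv (Suc N))"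
    unfolding For_def
  proof (rule run_Seq)
    show "run (NSet x (NConst 0) (NConst 1)) s 3 (\<lambda>s'. s' = nupd x 0 1 s)"
      by (rule run_loop_free) auto
  next
    fix s' assume "s' = nupd x 0 1 s"
    then show "run (While ?b ?c) s' (8 + (\<Sum>k = 1..N. T k + 14)) (Inv (Suc N))"
      using init by (intro loop) (auto simp: agree_def)
  qed
  then show ?thesis by simp
qed

lemma run_For:
  assumes "nmem s y 0 = N" "x \<noteq> y" "x \<notin> nwrites c" "y \<notin> nwrites c"
    and "Inv 1 (nupd x 0 1 s)"
    and "\<And>k s'. \<lbrakk>1 \<le> k; k \<le> N; nmem s' x 0 = k; agree (For x y c) s s'; Inv k s'\<rbrakk>
      \<Longrightarrow> run c s' T (\<lambda>s''. Inv (Suc k) (nupd x 0 (Suc k) s''))"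
  shows "run (For x y c) s (11 + N * (T + 14)) (Inv (Suc N))"
  using run_For_sum[of s y N x c Inv "\<lambda>_. T"] assms by simp

text \<open>With a loop-free body, execution disappears from the obligation: only the computed store
  \<open>result c s'\<close> has to satisfy the invariant.\<close>

lemma run_For_body:
  assumes "nmem s y 0 = N" "x \<noteq> y" "x \<notin> nwrites c" "y \<notin> nwrites c"
    and "loop_free c" "max_cost c \<le> T"
    and "Inv 1 (nupd x 0 1 s)"
    and "\<And>k s'. \<lbrakk>1 \<le> k; k \<le> N; nmem s' x 0 = k; agree (For x y c) s s'; Inv k s'\<rbrakk>
      \<Longrightarrow> Inv (Suc k) (nupd x 0 (Suc k) (result c s'))"
  shows "run (For x y c) s (11 + N * (T + 14)) (Inv (Suc N))"
  using assms(1-4,7) by (rule run_For) (rule run_loop_free[OF assms(5,6)], rule assms(8))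

section \<open>The Hungarian method\<close>

definition matching :: "nat \<Rightarrow> nat \<Rightarrow> (nat \<Rightarrow> nat) \<Rightarrow> bool" where
  "matching n m q \<longleftrightarrow> (\<forall>c\<in>{1..m}. q c \<le> n) \<and> (\<forall>r\<in>{1..n}. \<exists>!c. c \<in> {1..m} \<and> q c = r)"

text \<open>Columns are going to be items and rows positions. A matching \<open>q\<close> leads from
  columns to rows, with 0 for an unmatched column, and \<open>f\<close> takes the row first.\<close>

definition assign_sum :: "(nat \<Rightarrow> nat \<Rightarrow> real) \<Rightarrow> nat \<Rightarrow> (nat \<Rightarrow> nat) \<Rightarrow> real" where
  "assign_sum f m q = (\<Sum>c | c \<in> {1..m} \<and> q c \<noteq> 0. f (q c) c)"

lemma assign_sum_if: "assign_sum f m' q = (\<Sum>c = 1..m'. if q c = 0 then 0 else f (q c) c)"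
proof -
  have "(\<Sum>c = 1..m'. if q c = 0 then 0 else f (q c) c)
      = (\<Sum>c = 1..m'. if q c \<noteq> 0 then f (q c) c else 0)"
    by (intro sum.cong) auto
  then show ?thesis
    unfolding assign_sum_def using sum.inter_filter[of "{1..m'}" "\<lambda>c. f (q c) c" "\<lambda>c. q c \<noteq> 0"]
    by (simp only: finite_atLeastAtMost)
qed

text \<open>In this form a sum over the used columns can be reindexed as a sum over all
  rows.\<close>

lemma matching_iff_bij: "matching n m q \<longleftrightarrow> bij_betw q {c. c \<in> {1..m} \<and> q c \<noteq> 0} {1..n}"
    (is "_ \<longleftrightarrow> bij_betw q ?M _")
proof
  assume M: "matching n m q"
  show "bij_betw q ?M {1..n}"
  proof (rule bij_betw_imageI)
    show "inj_on q ?M"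
    proof (rule inj_onI)
      fix x y assume xy: "x \<in> ?M" "y \<in> ?M" "q x = q y"
      moreover have "q x \<le> n" using M xy unfolding matching_def by blast
      ultimately have "q x \<in> {1..n}" by simp
      then have "\<exists>!c. c \<in> {1..m} \<and> q c = q x" using M unfolding matching_def by blast
      then obtain z where "\<And>c. c \<in> {1..m} \<Longrightarrow> q c = q x \<Longrightarrow> c = z" by blast
      from this[of x] this[of y] xy show "x = y" by simp
    qed
    show "q ` ?M = {1..n}"
    proof (intro equalityI subsetI)
      fix r assume "r \<in> q ` ?M"
      then obtain c where "c \<in> {1..m}" "q c \<noteq> 0" "r = q c" by blast
      moreover from this have "q c \<le> n" using M unfolding matching_def by blast
      ultimately show "r \<in> {1..n}" by simp
    next
      fix r assume r: "r \<in> {1..n}"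
      then obtain c where "c \<in> {1..m}" "q c = r" using M unfolding matching_def by blast
      with r show "r \<in> q ` ?M" by (intro image_eqI[of _ _ c]) auto
    qed
  qed
next
  assume B: "bij_betw q ?M {1..n}"
  show "matching n m q"
    unfolding matching_def
  proof (intro conjI ballI)
    fix c assume "c \<in> {1..m}"
    then show "q c \<le> n"
      using bij_betw_apply[OF B, of c] by (cases "q c = 0") auto
  next
    fix r assume r: "r \<in> {1..n}"
    then have "r \<in> q ` ?M"
      using bij_betw_imp_surj_on[OF B] by simp
    then obtain c where c: "c \<in> {1..m}" "q c = r" by auto
    show "\<exists>!c. c \<in> {1..m} \<and> q c = r"
    proof (rule ex1I[of _ c])
      fix c' assume "c' \<in> {1..m} \<and> q c' = r"
      with c r show "c' = c"
        by - (rule inj_onD[OF bij_betw_imp_inj_on[OF B]], auto)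
    qed (use c in simp)
  qed
qed

lemmas matching_bij = matching_iff_bij[THEN iffD1] and matchingI = matching_iff_bij[THEN iffD2]

lemma matching_swap:
  assumes q: "matching n m q" and ab: "a \<in> {1..m}" "b \<in> {1..m}"
  shows "matching n m (q(a := q b, b := q a))"
  unfolding matching_def
proof (intro conjI ballI)
  fix c assume "c \<in> {1..m}"
  then show "(q(a := q b, b := q a)) c \<le> n"
    using q ab unfolding matching_def by simp
next
  fix j assume j: "j \<in> {1..n}"
  then obtain c where c: "c \<in> {1..m}" "q c = j" and u: "\<And>c'. c' \<in> {1..m} \<Longrightarrow> q c' = j \<Longrightarrow> c' = c"
    using q unfolding matching_def by blast
  let ?d = "if c = a then b else if c = b then a else c"
  show "\<exists>!c. c \<in> {1..m} \<and> (q(a := q b, b := q a)) c = j"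
  proof (rule ex1I[of _ ?d])
    show "?d \<in> {1..m} \<and> (q(a := q b, b := q a)) ?d = j"
      using c ab by auto
    fix c' assume c': "c' \<in> {1..m} \<and> (q(a := q b, b := q a)) c' = j"
    then show "c' = ?d"
      using u[of c'] u[OF ab(1)] u[OF ab(2)] by (auto split: if_splits)
  qed
qed

section \<open>Potentials and weak duality\<close>

definition dual_inv ::
  "(nat \<Rightarrow> nat \<Rightarrow> real) \<Rightarrow> nat \<Rightarrow> nat \<Rightarrow> (nat \<Rightarrow> real) \<Rightarrow> (nat \<Rightarrow> real) \<Rightarrow> (nat \<Rightarrow> nat) \<Rightarrow> bool" where
  "dual_inv a m i u v q \<longleftrightarrow>
     (\<forall>r\<in>{1..i}. \<forall>c\<in>{1..m}. u r + v c \<le> a r c) \<and> (\<forall>r>i. u r = 0) \<and>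
     (\<forall>c\<in>{1..m}. v c \<le> 0 \<and> q c \<le> i \<and> (q c = 0 \<longrightarrow> v c = 0) \<and>
        (q c \<noteq> 0 \<longrightarrow> u (q c) + v c = a (q c) c)) \<and>
     inj_on q {c\<in>{1..m}. q c \<noteq> 0} \<and> {1..i} \<subseteq> q ` {1..m}"

lemma dual_inv_matching: "dual_inv a m n u v q \<Longrightarrow> matching n m q"
  unfolding dual_inv_def by (intro matchingI) (force simp: bij_betw_def)

text \<open>Weak duality for a rectangular problem. Every matching uses each row once, so the row
  potentials contribute equally to all. Columns may stay free: \<open>v \<le> 0\<close> bounds the
  sum of \<open>v\<close> over the columns used by \<open>q'\<close> from below by the sum over all
  columns, and \<open>v = 0\<close> on the free columns of \<open>q\<close> makes this an equality
  for \<open>q\<close>, whose edges are tight.\<close>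

lemma dual_inv_optimal:
  assumes "dual_inv a m n u v q" "matching n m q'"
  shows "assign_sum a m q \<le> assign_sum a m q'"
proof -
  have rows: "(\<Sum>c | c \<in> {1..m} \<and> p c \<noteq> 0. u (p c)) = (\<Sum>r = 1..n. u r)"
    if "matching n m p" for p
    by (rule sum.reindex_bij_betw[OF matching_bij[OF that]])
  have "assign_sum a m q = (\<Sum>c | c \<in> {1..m} \<and> q c \<noteq> 0. u (q c) + v c)"
    unfolding assign_sum_def using assms(1) by (intro sum.cong) (auto simp: dual_inv_def)
  also have "\<dots> = (\<Sum>r = 1..n. u r) + (\<Sum>c | c \<in> {1..m} \<and> q c \<noteq> 0. v c)"
    using rows[OF dual_inv_matching[OF assms(1)]] by (simp add: sum.distrib)
  also have "(\<Sum>c | c \<in> {1..m} \<and> q c \<noteq> 0. v c) = (\<Sum>c = 1..m. v c)"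
    using assms(1) by (intro sum.mono_neutral_left) (auto simp: dual_inv_def)
  also have "\<dots> \<le> (\<Sum>c | c \<in> {1..m} \<and> q' c \<noteq> 0. v c)"
  proof -
    have "(\<Sum>c = 1..m. - v c) \<ge> (\<Sum>c | c \<in> {1..m} \<and> q' c \<noteq> 0. - v c)"
      using assms(1) by (intro sum_mono2) (auto simp: dual_inv_def)
    then show ?thesis by (simp add: sum_negf)
  qed
  also have "(\<Sum>r = 1..n. u r) + (\<Sum>c | c \<in> {1..m} \<and> q' c \<noteq> 0. v c)
      = (\<Sum>c | c \<in> {1..m} \<and> q' c \<noteq> 0. u (q' c) + v c)"
    using rows[OF assms(2)] by (simp add: sum.distrib)
  also have "\<dots> \<le> assign_sum a m q'"
    unfolding assign_sum_def using assms by (intro sum_mono) (auto simp: dual_inv_def matching_def)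
  finally show ?thesis by simp
qed

section \<open>Growing the alternating tree of a phase\<close>

text \<open>
  A phase inserts row \<open>i\<close>. It grows an alternating tree whose root is a virtual column 0
  matched to row \<open>i\<close>. The stamp \<open>us c\<close> is 0 for the columns outside the tree and otherwise the
  time of insertion; \<open>wy c\<close> is the parent column, \<open>ru\<close> marks the rows of the tree and \<open>mv c\<close> is
  the least reduced cost of a tree row in column \<open>c\<close>.
\<close>

definition tree_inv ::
  "(nat \<Rightarrow> nat \<Rightarrow> real) \<Rightarrow> nat \<Rightarrow> nat \<Rightarrow> nat \<Rightarrow> (nat \<Rightarrow> real) \<Rightarrow> (nat \<Rightarrow> real) \<Rightarrow> (nat \<Rightarrow> nat) \<Rightarrow>
   (nat \<Rightarrow> nat) \<Rightarrow> (nat \<Rightarrow> nat) \<Rightarrow> (nat \<Rightarrow> real) \<Rightarrow> (nat \<Rightarrow> nat) \<Rightarrow> bool" where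
  "tree_inv a m i k u v q us wy mv ru \<longleftrightarrow>
     1 \<le> i \<and> i \<le> m \<and> q 0 = i \<and> us 0 = 1 \<and>
     (\<forall>r\<in>{1..i}. \<forall>c\<in>{1..m}. u r + v c \<le> a r c) \<and> (\<forall>r>i. u r = 0) \<and>
     (\<forall>c\<in>{1..m}. v c \<le> 0 \<and> q c < i \<and> (q c = 0 \<longrightarrow> v c = 0) \<and>
        (q c \<noteq> 0 \<longrightarrow> u (q c) + v c = a (q c) c)) \<and>
     inj_on q {c\<in>{1..m}. q c \<noteq> 0} \<and> {1..<i} \<subseteq> q ` {1..m} \<and>
     (\<forall>c\<in>{1..m}. us c \<noteq> 0 \<longrightarrow> q c \<noteq> 0 \<and> 2 \<le> us c \<and> us c \<le> k \<and> wy c \<le> m \<and>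
        us (wy c) \<noteq> 0 \<and> us (wy c) < us c \<and> u (q (wy c)) + v c = a (q (wy c)) c) \<and>
     (\<forall>c\<in>{1..m}. us c = 0 \<longrightarrow> wy c \<le> m \<and> us (wy c) \<noteq> 0 \<and>
        mv c = a (q (wy c)) c - u (q (wy c)) - v c \<and>
        (\<forall>r\<in>{1..i}. ru r \<noteq> 0 \<longrightarrow> mv c \<le> a r c - u r - v c)) \<and>
     (\<forall>r\<in>{1..i}. ru r \<noteq> 0 \<longleftrightarrow> (\<exists>c\<in>{0..m}. us c \<noteq> 0 \<and> q c = r)) \<and> (\<forall>r>i. ru r = 0) \<and>
     card {c\<in>{1..m}. us c \<noteq> 0} = k - 1 \<and> 1 \<le> k"

lemma tree_invD:
  assumes "tree_inv a m i k u v q us wy mv ru"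
  shows "1 \<le> i" "i \<le> m" "q 0 = i" "us 0 = 1" "1 \<le> k"
    and "\<And>r c. r \<in> {1..i} \<Longrightarrow> c \<in> {1..m} \<Longrightarrow> u r + v c \<le> a r c" and "\<And>r. i < r \<Longrightarrow> u r = 0"
    and "\<And>c. c \<in> {1..m} \<Longrightarrow> v c \<le> 0 \<and> q c < i \<and> (q c = 0 \<longrightarrow> v c = 0) \<and>
        (q c \<noteq> 0 \<longrightarrow> u (q c) + v c = a (q c) c)"
    and "inj_on q {c\<in>{1..m}. q c \<noteq> 0}" and "{1..<i} \<subseteq> q ` {1..m}"
    and "\<And>c. c \<in> {1..m} \<Longrightarrow> us c \<noteq> 0 \<Longrightarrow> q c \<noteq> 0 \<and> 2 \<le> us c \<and> us c \<le> k \<and> wy c \<le> m \<and>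
        us (wy c) \<noteq> 0 \<and> us (wy c) < us c \<and> u (q (wy c)) + v c = a (q (wy c)) c"
    and "\<And>c. c \<in> {1..m} \<Longrightarrow> us c = 0 \<Longrightarrow> wy c \<le> m \<and> us (wy c) \<noteq> 0 \<and>
        mv c = a (q (wy c)) c - u (q (wy c)) - v c"
    and "\<And>c r. c \<in> {1..m} \<Longrightarrow> us c = 0 \<Longrightarrow> r \<in> {1..i} \<Longrightarrow> ru r \<noteq> 0 \<Longrightarrow> mv c \<le> a r c - u r - v c"
    and "\<And>r. r \<in> {1..i} \<Longrightarrow> ru r \<noteq> 0 \<longleftrightarrow> (\<exists>c\<in>{0..m}. us c \<noteq> 0 \<and> q c = r)"
    and "\<And>r. i < r \<Longrightarrow> ru r = 0"
    and "card {c\<in>{1..m}. us c \<noteq> 0} = k - 1"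
  using assms unfolding tree_inv_def by blast+

text \<open>Row \<open>i\<close> enters with potential 0, which the clause on rows above
  \<open>i - 1\<close> provides. This is dual feasible because its costs are nonnegative and
  \<open>v \<le> 0\<close>; hence the demand for nonnegative costs. The first tree consists of the
  virtual column alone, and \<open>mv\<close> is the reduced cost of row \<open>i\<close>.\<close>

lemma tree_inv_init:
  assumes "dual_inv a m (i - 1) u v q" "1 \<le> i" "i \<le> m" "\<And>c. c \<in> {1..m} \<Longrightarrow> 0 \<le> a i c"
    and "q' 0 = i" "\<And>c. c \<in> {1..m} \<Longrightarrow> q' c = q c" "us 0 = 1"
    and "\<And>c. c \<in> {1..m} \<Longrightarrow> us c = 0 \<and> wy c = 0 \<and> mv c = a i c - v c"
    and "ru i \<noteq> 0" "\<And>r. 1 \<le> r \<Longrightarrow> r \<noteq> i \<Longrightarrow> ru r = 0"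
  shows "tree_inv a m i 1 u v q' us wy mv ru"
proof -
  note D = assms(1)[unfolded dual_inv_def]
  have Dc: "v c \<le> 0" "q c \<le> i - 1" "q c = 0 \<Longrightarrow> v c = 0" "q c \<noteq> 0 \<Longrightarrow> u (q c) + v c = a (q c) c"
    if "c \<in> {1..m}" for c
    using D that by blast+
  have ui: "u i = 0" "\<forall>r>i. u r = 0"
    using D assms(2) by auto
  have im: "q' ` {1..m} = q ` {1..m}"
    using assms(6) by (intro image_cong) auto
  have col: "{c\<in>{1..m}. q' c \<noteq> 0} = {c\<in>{1..m}. q c \<noteq> 0}"
    using assms(6) by auto
  have inj: "inj_on q' {c\<in>{1..m}. q' c \<noteq> 0}"
    unfolding col using D assms(6) by (subst inj_on_cong[of _ _ q]) auto
  have "\<forall>r\<in>{1..i}. \<forall>c\<in>{1..m}. u r + v c \<le> a r c"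
  proof (intro ballI)
    fix r c assume rc: "r \<in> {1..i}" "c \<in> {1..m}"
    show "u r + v c \<le> a r c"
    proof (cases "r = i")
      case True
      then show ?thesis using assms(4)[OF rc(2)] ui Dc(1)[OF rc(2)] by simp
    next
      case False
      then have "r \<in> {1..i - 1}" using rc by auto
      then show ?thesis using D rc by blast
    qed
  qed
  moreover have "\<forall>c\<in>{1..m}. v c \<le> 0 \<and> q' c < i \<and> (q' c = 0 \<longrightarrow> v c = 0) \<and>
        (q' c \<noteq> 0 \<longrightarrow> u (q' c) + v c = a (q' c) c)"
  proof
    fix c assume c: "c \<in> {1..m}"
    show "v c \<le> 0 \<and> q' c < i \<and> (q' c = 0 \<longrightarrow> v c = 0) \<and> (q' c \<noteq> 0 \<longrightarrow> u (q' c) + v c = a (q' c) c)"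
      using Dc[OF c] assms(2) assms(6)[OF c] by simp
  qed
  moreover have "{1..<i} \<subseteq> q' ` {1..m}"
  proof -
    have "{1..<i} = {1..i - 1}" by auto
    with D show ?thesis unfolding im by simp
  qed
  moreover have "\<forall>r\<in>{1..i}. ru r \<noteq> 0 \<longleftrightarrow> (\<exists>c\<in>{0..m}. us c \<noteq> 0 \<and> q' c = r)"
  proof (intro ballI iffI)
    fix r assume r: "r \<in> {1..i}" "ru r \<noteq> 0"
    then have "r = i" using assms(10)[of r] by auto
    then show "\<exists>c\<in>{0..m}. us c \<noteq> 0 \<and> q' c = r"
      using assms(5,7) by (intro bexI[of _ 0]) auto
  next
    fix r assume r: "r \<in> {1..i}" "\<exists>c\<in>{0..m}. us c \<noteq> 0 \<and> q' c = r"
    then obtain c where c: "c \<le> m" "us c \<noteq> 0" "q' c = r" by auto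
    then have "c = 0" using assms(8)[of c] by (cases c) auto
    with c assms(5,9) show "ru r \<noteq> 0" by simp
  qed
  moreover have "\<forall>c\<in>{1..m}. us c = 0 \<longrightarrow> wy c \<le> m \<and> us (wy c) \<noteq> 0 \<and>
        mv c = a (q' (wy c)) c - u (q' (wy c)) - v c \<and>
        (\<forall>r\<in>{1..i}. ru r \<noteq> 0 \<longrightarrow> mv c \<le> a r c - u r - v c)"
  proof (intro ballI impI conjI)
    fix c r assume cr: "c \<in> {1..m}" "r \<in> {1..i}" "ru r \<noteq> 0"
    then have "r = i" using assms(10)[of r] by auto
    with cr assms(8)[of c] ui show "mv c \<le> a r c - u r - v c" by simp
  qed (use assms(5,7,8) ui in auto)
  moreover have "{c\<in>{1..m}. us c \<noteq> 0} = {}"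
    using assms(8) by auto
  moreover have "\<forall>r>i. ru r = 0" using assms(2,10) by auto
  moreover have "\<forall>c\<in>{1..m}. us c = 0" using assms(8) by auto
  ultimately show ?thesis
    unfolding tree_inv_def using assms(2,3,5,7) ui inj
    by (intro conjI) (assumption | blast | simp)+
qed

text \<open>The real columns of the tree are matched injectively to rows below \<open>i\<close>, so
  there are at most \<open>i - 1\<close> of them. Hence one of the \<open>m \<ge> i\<close> columns
  can still be selected, and a phase has at most \<open>i\<close> rounds.\<close>

lemma tree_inv_unused:
  assumes "tree_inv a m i k u v q us wy mv ru"
  shows "k \<le> i" "\<exists>c\<in>{1..m}. us c = 0"
proof -
  note T = tree_invD[OF assms]
  let ?S = "{c\<in>{1..m}. us c \<noteq> 0}" and ?M = "{c\<in>{1..m}. q c \<noteq> 0}"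
  have "?S \<subseteq> ?M" using T(11) by blast
  moreover have "card ?M \<le> card {1..<i}"
    using T(9) by (rule card_inj_on_le) (use T(8) in auto)
  ultimately have S: "card ?S \<le> i - 1"
    using card_mono[of ?M ?S] by auto
  then show k: "k \<le> i" using T(1,5,16) by linarith
  have "card ?S < card {1..m}"
    using S T(1,2) by auto
  then have "?S \<noteq> {1..m}" by auto
  then show "\<exists>c\<in>{1..m}. us c = 0" by (auto simp: set_eq_iff)
qed

lemma tree_inv_parent:
  assumes "tree_inv a m i k u v q us wy mv ru" "c \<in> {1..m}"
  shows "wy c \<le> m" "us (wy c) \<noteq> 0" "q (wy c) \<in> {1..i}" "ru (q (wy c)) \<noteq> 0"
proof -
  note T = tree_invD[OF assms(1)]
  show w: "wy c \<le> m" "us (wy c) \<noteq> 0"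
    using T(11,12)[OF assms(2)] by blast+
  show q: "q (wy c) \<in> {1..i}"
  proof (cases "wy c = 0")
    case True
    then show ?thesis using T(1,3) by simp
  next
    case False
    then have "wy c \<in> {1..m}" using w by auto
    then show ?thesis using T(8)[of "wy c"] T(11)[of "wy c"] w by simp
  qed
  show "ru (q (wy c)) \<noteq> 0"
    using T(14)[OF q] w by auto
qed

lemma tree_inv_stamp_le:
  assumes "tree_inv a m i k u v q us wy mv ru" "c \<le> m"
  shows "us c \<le> k"
  using tree_invD(4,5)[OF assms(1)] tree_invD(11)[OF assms(1), of c] assms(2)
  by (cases "c = 0"; cases "us c = 0") auto

text \<open>The dual adjustment by the least slack \<open>mv j\<close>. Slack shrinks only between
  tree rows and columns outside the tree, where at least \<open>mv j\<close> is available. Inside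
  the tree the two changes cancel, and the edge that attains the minimum becomes tight, which is
  \<open>mv' j = 0\<close>.\<close>

lemma tree_inv_dual_step:
  assumes TI: "tree_inv a m i k u v q us wy mv ru"
    and j: "j \<in> {1..m}" "us j = 0" "\<And>c. c \<in> {1..m} \<Longrightarrow> us c = 0 \<Longrightarrow> mv j \<le> mv c"
    and u': "\<And>r. 1 \<le> r \<Longrightarrow> u' r = (if ru r \<noteq> 0 then u r + mv j else u r)"
    and v': "\<And>c. c \<in> {1..m} \<Longrightarrow> v' c = (if us c \<noteq> 0 then v c - mv j else v c)"
    and mv': "\<And>c. c \<in> {1..m} \<Longrightarrow> us c = 0 \<Longrightarrow> mv' c = mv c - mv j"
  shows "tree_inv a m i k u' v' q us wy mv' ru \<and> mv' j = 0"
proof -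
  note T = tree_invD[OF TI] and wyr = tree_inv_parent[OF TI]
  have d: "0 \<le> mv j"
    using T(12)[OF j(1,2)] T(6)[OF wyr(3)[OF j(1)] j(1)] by simp
  have red: "mv j \<le> a r c - u r - v c"
    if "r \<in> {1..i}" "ru r \<noteq> 0" "c \<in> {1..m}" "us c = 0" for r c
    using T(13)[OF that(3,4,1,2)] j(3)[OF that(3,4)] by simp
  \<comment> \<open>A matched column belongs to the tree iff its row does. So a matched edge is
    changed at both ends or at neither, and stays tight.\<close>
  have ruq: "ru (q c) \<noteq> 0 \<longleftrightarrow> us c \<noteq> 0" if c: "c \<in> {1..m}" "q c \<noteq> 0" for c
  proof -
    have qi: "q c \<in> {1..i}" "q c < i" using T(8)[OF c(1)] c(2) by auto
    have "us c \<noteq> 0" if c': "c' \<in> {0..m}" "us c' \<noteq> 0" "q c' = q c" for c'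
    proof -
      have "c' \<noteq> 0" using T(3) c'(3) qi(2) by (cases "c' = 0") auto
      then have "c' = c"
        using c c' by - (rule inj_onD[OF T(9)], auto)
      with c' show ?thesis by simp
    qed
    then show ?thesis
      unfolding T(14)[OF qi(1)] using c by (intro iffI) (blast, intro bexI[of _ c], auto)
  qed
  have "\<forall>r\<in>{1..i}. \<forall>c\<in>{1..m}. u' r + v' c \<le> a r c"
  proof (intro ballI)
    fix r c assume rc: "r \<in> {1..i}" "c \<in> {1..m}"
    then show "u' r + v' c \<le> a r c"
      using T(6)[OF rc] red[of r c] d u'[of r] v'[of c] by auto
  qed
  moreover have "\<forall>r>i. u' r = 0"
    using T(1,7,15) u' by auto
  moreover have "\<forall>c\<in>{1..m}. v' c \<le> 0 \<and> q c < i \<and> (q c = 0 \<longrightarrow> v' c = 0) \<and>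
        (q c \<noteq> 0 \<longrightarrow> u' (q c) + v' c = a (q c) c)"
  proof
    fix c assume c: "c \<in> {1..m}"
    show "v' c \<le> 0 \<and> q c < i \<and> (q c = 0 \<longrightarrow> v' c = 0) \<and> (q c \<noteq> 0 \<longrightarrow> u' (q c) + v' c = a (q c) c)"
      using T(8)[OF c] T(11)[OF c] d v'[OF c] u'[of "q c"] ruq[OF c] by auto
  qed
  moreover have "\<forall>c\<in>{1..m}. us c \<noteq> 0 \<longrightarrow> q c \<noteq> 0 \<and> 2 \<le> us c \<and> us c \<le> k \<and> wy c \<le> m \<and>
        us (wy c) \<noteq> 0 \<and> us (wy c) < us c \<and> u' (q (wy c)) + v' c = a (q (wy c)) c"
  proof (intro ballI impI)
    fix c assume c: "c \<in> {1..m}" "us c \<noteq> 0"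
    show "q c \<noteq> 0 \<and> 2 \<le> us c \<and> us c \<le> k \<and> wy c \<le> m \<and> us (wy c) \<noteq> 0 \<and> us (wy c) < us c \<and>
        u' (q (wy c)) + v' c = a (q (wy c)) c"
      using T(11)[OF c] wyr(3,4)[OF c(1)] u'[of "q (wy c)"] v'[OF c(1)] c(2) by auto
  qed
  moreover have "\<forall>c\<in>{1..m}. us c = 0 \<longrightarrow> wy c \<le> m \<and> us (wy c) \<noteq> 0 \<and>
        mv' c = a (q (wy c)) c - u' (q (wy c)) - v' c \<and>
        (\<forall>r\<in>{1..i}. ru r \<noteq> 0 \<longrightarrow> mv' c \<le> a r c - u' r - v' c)"
  proof (intro ballI impI conjI)
    fix c assume c: "c \<in> {1..m}" "us c = 0"
    show "wy c \<le> m" "us (wy c) \<noteq> 0" by (rule wyr[OF c(1)])+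
    show "mv' c = a (q (wy c)) c - u' (q (wy c)) - v' c"
      using T(12)[OF c] wyr(3,4)[OF c(1)] u'[of "q (wy c)"] v'[OF c(1)] mv'[OF c] c(2) by simp
    fix r assume r: "r \<in> {1..i}" "ru r \<noteq> 0"
    show "mv' c \<le> a r c - u' r - v' c"
      using T(13)[OF c r] u'[of r] r v'[OF c(1)] mv'[OF c] c(2) by simp
  qed
  ultimately show ?thesis
    unfolding tree_inv_def using T(1-5) T(9,10,14,15,16) mv'[OF j(1,2)]
    by (intro conjI) (assumption | (intro ballI allI impI, rule T; assumption) | simp)+
qed

text \<open>Adding \<open>j\<close> together with its row \<open>q j\<close> gives each outside
  column one new candidate for its least reduced cost. The stamp \<open>Suc k\<close> exceeds all
  earlier ones, so parents remain strictly older than their children.\<close>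

lemma tree_inv_extend:
  assumes TI: "tree_inv a m i k u v q us wy mv ru"
    and j: "j \<in> {1..m}" "us j = 0" "mv j = 0" "q j \<noteq> 0"
    and mv': "\<And>c. c \<in> {1..m} \<Longrightarrow> us c = 0 \<Longrightarrow> c \<noteq> j \<Longrightarrow>
      (if a (q j) c - u (q j) - v c < mv c
       then mv' c = a (q j) c - u (q j) - v c \<and> wy' c = j else mv' c = mv c \<and> wy' c = wy c)"
    and wy': "\<And>c. c \<in> {1..m} \<Longrightarrow> us c \<noteq> 0 \<or> c = j \<Longrightarrow> wy' c = wy c"
  shows "tree_inv a m i (Suc k) u v q (us(j := Suc k)) wy' mv' (ru(q j := 1))"
proof -
  note T = tree_invD[OF TI] and usk = tree_inv_stamp_le[OF TI]
  have qj: "q j \<in> {1..i}" using T(8)[OF j(1)] j(4) by auto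
  have wyj: "wy j \<noteq> j" using T(12)[OF j(1,2)] j(2) by metis
  let ?us = "us(j := Suc k)" and ?ru = "ru(q j := 1)"
  have "\<forall>c\<in>{1..m}. ?us c \<noteq> 0 \<longrightarrow> q c \<noteq> 0 \<and> 2 \<le> ?us c \<and>
        ?us c \<le> Suc k \<and> wy' c \<le> m \<and> ?us (wy' c) \<noteq> 0 \<and>
        ?us (wy' c) < ?us c \<and> u (q (wy' c)) + v c = a (q (wy' c)) c"
  proof (intro ballI impI)
    fix c assume c: "c \<in> {1..m}" "?us c \<noteq> 0"
    show "q c \<noteq> 0 \<and> 2 \<le> ?us c \<and>
        ?us c \<le> Suc k \<and> wy' c \<le> m \<and> ?us (wy' c) \<noteq> 0 \<and>
        ?us (wy' c) < ?us c \<and> u (q (wy' c)) + v c = a (q (wy' c)) c"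
    proof (cases "c = j")
      case True
      then show ?thesis
        using wy'[OF c(1)] wyj T(12)[OF j(1,2)] j T(5) usk[of "wy j"] by auto
    next
      case False
      then have us: "us c \<noteq> 0" using c by simp
      then have "wy c \<noteq> j" using j T(11)[OF c(1)] by auto
      with us False wy'[OF c(1)] T(11)[OF c(1)] show ?thesis by auto
    qed
  qed
  moreover have "\<forall>c\<in>{1..m}. ?us c = 0 \<longrightarrow> wy' c \<le> m \<and> ?us (wy' c) \<noteq> 0 \<and>
        mv' c = a (q (wy' c)) c - u (q (wy' c)) - v c \<and>
        (\<forall>r\<in>{1..i}. ?ru r \<noteq> 0 \<longrightarrow> mv' c \<le> a r c - u r - v c)"
  proof (intro ballI impI)
    fix c assume c: "c \<in> {1..m}" "?us c = 0"
    then have cj: "c \<noteq> j" "us c = 0" by (auto split: if_splits)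
    note cT = T(12)[OF c(1) cj(2)] and new = mv'[OF c(1) cj(2,1)]
    have "wy c \<noteq> j" using j cT by auto
    then have 1: "wy' c \<le> m \<and> ?us (wy' c) \<noteq> 0 \<and> mv' c = a (q (wy' c)) c - u (q (wy' c)) - v c"
      using cT new j(1) by (simp split: if_splits)
    have le: "mv' c \<le> a (q j) c - u (q j) - v c" "mv' c \<le> mv c"
      using new by (auto split: if_splits)
    have "mv' c \<le> a r c - u r - v c" if "r \<in> {1..i}" "?ru r \<noteq> 0" for r
      using le T(13)[OF c(1) cj(2) that(1)] that(2) by (cases "r = q j") auto
    with 1 show "wy' c \<le> m \<and> ?us (wy' c) \<noteq> 0 \<and>
        mv' c = a (q (wy' c)) c - u (q (wy' c)) - v c \<and>
        (\<forall>r\<in>{1..i}. ?ru r \<noteq> 0 \<longrightarrow> mv' c \<le> a r c - u r - v c)"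
      by blast
  qed
  moreover have "\<forall>r\<in>{1..i}. ?ru r \<noteq> 0 \<longleftrightarrow> (\<exists>c\<in>{0..m}. ?us c \<noteq> 0 \<and> q c = r)"
  proof
    fix r assume r: "r \<in> {1..i}"
    show "?ru r \<noteq> 0 \<longleftrightarrow> (\<exists>c\<in>{0..m}. ?us c \<noteq> 0 \<and> q c = r)"
    proof (cases "r = q j")
      case True
      then show ?thesis using j(1) by (auto intro!: bexI[of _ j])
    next
      case False
      then have "(\<exists>c\<in>{0..m}. ?us c \<noteq> 0 \<and> q c = r) \<longleftrightarrow> (\<exists>c\<in>{0..m}. us c \<noteq> 0 \<and> q c = r)"
        by (intro bex_cong) auto
      with T(14)[OF r] False show ?thesis by simp
    qed
  qed
  moreover have "\<forall>r>i. ?ru r = 0" using T(15) qj by auto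
  moreover have "card {c\<in>{1..m}. ?us c \<noteq> 0} = Suc k - 1"
  proof -
    have "{c\<in>{1..m}. ?us c \<noteq> 0} = insert j {c\<in>{1..m}. us c \<noteq> 0}"
      using j by auto
    then show ?thesis using j T(5,16) by simp
  qed
  moreover have "?us 0 = 1" using T(4) j by auto
  ultimately show ?thesis
    unfolding tree_inv_def using T(1-3) T(6-10)
    by (intro conjI) (assumption | blast | simp)+
qed

section \<open>Augmenting along the tree path\<close>

text \<open>
  While the matching is shifted along the tree path from a free column to the root, column \<open>y\<close>
  is the hole: the other columns, the virtual one included, carry a perfect matching of the
  rows \<open>1..i\<close> along tight edges.
\<close>

definition augment_inv ::
  "(nat \<Rightarrow> nat \<Rightarrow> real) \<Rightarrow> nat \<Rightarrow> nat \<Rightarrow> nat \<Rightarrow> (nat \<Rightarrow> real) \<Rightarrow> (nat \<Rightarrow> real) \<Rightarrow> (nat \<Rightarrow> nat) \<Rightarrow>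
   (nat \<Rightarrow> nat) \<Rightarrow> (nat \<Rightarrow> nat) \<Rightarrow> bool" where
  "augment_inv a m i y u v q us wy \<longleftrightarrow>
     (\<forall>r\<in>{1..i}. \<forall>c\<in>{1..m}. u r + v c \<le> a r c) \<and> (\<forall>r>i. u r = 0) \<and>
     (\<forall>c\<in>{1..m}. v c \<le> 0 \<and> q c \<le> i \<and> (c \<noteq> y \<longrightarrow> q c = 0 \<longrightarrow> v c = 0) \<and>
        (c \<noteq> y \<longrightarrow> q c \<noteq> 0 \<longrightarrow> u (q c) + v c = a (q c) c)) \<and>
     inj_on q {c\<in>{0..m} - {y}. q c \<noteq> 0} \<and> {1..i} \<subseteq> q ` ({0..m} - {y}) \<and> q 0 \<le> i \<and>
     y \<le> m \<and> us y \<noteq> 0 \<and> us 0 = 1 \<and>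
     (\<forall>c\<in>{1..m}. us c \<noteq> 0 \<longrightarrow> us c \<le> us y \<longrightarrow> 2 \<le> us c \<and> wy c \<le> m \<and> us (wy c) \<noteq> 0 \<and>
        us (wy c) < us c \<and> q (wy c) \<noteq> 0 \<and> u (q (wy c)) + v c = a (q (wy c)) c)"

text \<open>The virtual column holds row \<open>i\<close>, the real columns hold the rows below it,
  and the free column \<open>j\<close> is the first hole. Its edge to the row of its parent is tight
  because \<open>mv j = 0\<close>.\<close>

lemma augment_inv_init:
  assumes TI: "tree_inv a m i k u v q us wy mv ru"
    and j: "j \<in> {1..m}" "us j = 0" "mv j = 0" "q j = 0"
  shows "augment_inv a m i j u v q (us(j := Suc k)) wy"
proof -
  note T = tree_invD[OF TI] and wyr = tree_inv_parent[OF TI] and usk = tree_inv_stamp_le[OF TI]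
  let ?us = "us(j := Suc k)"
  have "inj_on q {c\<in>{0..m} - {j}. q c \<noteq> 0}"
  proof (rule inj_onI)
    fix x y assume xy: "x \<in> {c\<in>{0..m} - {j}. q c \<noteq> 0}" "y \<in> {c\<in>{0..m} - {j}. q c \<noteq> 0}" "q x = q y"
    have "x \<noteq> 0 \<Longrightarrow> q x < i" "y \<noteq> 0 \<Longrightarrow> q y < i" using T(8)[of x] T(8)[of y] xy by auto
    then show "x = y"
      using xy T(3) inj_onD[OF T(9), of x y] by (cases "x = 0"; cases "y = 0") auto
  qed
  moreover have "{1..i} \<subseteq> q ` ({0..m} - {j})"
  proof
    fix r assume r: "r \<in> {1..i}"
    show "r \<in> q ` ({0..m} - {j})"
    proof (cases "r = i")
      case True
      then show ?thesis using T(3) j by (intro image_eqI[of _ _ 0]) auto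
    next
      case False
      then have "r \<in> q ` {1..m}" using T(10) r by fastforce
      then obtain c where "c \<in> {1..m}" "q c = r" by blast
      then show ?thesis using j r by (intro image_eqI[of _ _ c]) auto
    qed
  qed
  moreover have "\<forall>c\<in>{1..m}. ?us c \<noteq> 0 \<longrightarrow> ?us c \<le> ?us j \<longrightarrow> 2 \<le> ?us c \<and> wy c \<le> m \<and>
      ?us (wy c) \<noteq> 0 \<and> ?us (wy c) < ?us c \<and> q (wy c) \<noteq> 0 \<and> u (q (wy c)) + v c = a (q (wy c)) c"
  proof (intro ballI impI)
    fix c assume c: "c \<in> {1..m}" "?us c \<noteq> 0"
    note w = wyr[OF c(1)]
    have "wy c \<noteq> j" using j w by auto
    moreover have "u (q (wy c)) + v c = a (q (wy c)) c"
      using T(11)[OF c(1)] T(12)[OF j(1,2)] j c by (cases "c = j") auto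
    moreover have "2 \<le> us c \<and> us (wy c) < us c" if "c \<noteq> j"
      using T(11)[OF c(1)] c that by auto
    ultimately show "2 \<le> ?us c \<and> wy c \<le> m \<and>
      ?us (wy c) \<noteq> 0 \<and> ?us (wy c) < ?us c \<and> q (wy c) \<noteq> 0 \<and> u (q (wy c)) + v c = a (q (wy c)) c"
      using w T(5) usk[OF w(1)] by auto
  qed
  moreover have "\<forall>c\<in>{1..m}. v c \<le> 0 \<and> q c \<le> i \<and> (c \<noteq> j \<longrightarrow> q c = 0 \<longrightarrow> v c = 0) \<and>
        (c \<noteq> j \<longrightarrow> q c \<noteq> 0 \<longrightarrow> u (q c) + v c = a (q c) c)"
    using T(8) by (meson less_imp_le)
  moreover have "?us 0 = 1" using T(4) j by auto
  ultimately show ?thesis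
    unfolding augment_inv_def using T(3,6,7) j
    by (intro conjI) (assumption | blast | simp)+
qed

text \<open>Column \<open>y\<close> takes over the row of its parent along a tight tree edge, and
  the hole moves to the parent. The stamp of the hole drops, so the walk must end at the
  root.\<close>

lemma augment_inv_step:
  assumes A: "augment_inv a m i y u v q us wy" and y: "y \<noteq> 0"
  shows "augment_inv a m i (wy y) u v (q(y := q (wy y))) us wy \<and> us (wy y) < us y"
proof -
  let ?w = "wy y" and ?q = "q(y := q (wy y))"
  have y1: "y \<in> {1..m}" and usy: "us y \<noteq> 0" using A y unfolding augment_inv_def by auto
  have w: "2 \<le> us y \<and> ?w \<le> m \<and> us ?w \<noteq> 0 \<and> us ?w < us y \<and> q ?w \<noteq> 0 \<and> u (q ?w) + v y = a (q ?w) y"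
    using A y1 usy unfolding augment_inv_def by blast
  then have wy: "?w \<noteq> y" by auto
  have c: "\<forall>c\<in>{1..m}. v c \<le> 0 \<and> q c \<le> i \<and> (c \<noteq> y \<longrightarrow> q c = 0 \<longrightarrow> v c = 0) \<and>
        (c \<noteq> y \<longrightarrow> q c \<noteq> 0 \<longrightarrow> u (q c) + v c = a (q c) c)"
    "inj_on q {c\<in>{0..m} - {y}. q c \<noteq> 0}" "{1..i} \<subseteq> q ` ({0..m} - {y})" "q 0 \<le> i"
    using A unfolding augment_inv_def by blast+
  have qw: "q ?w \<le> i" using c(1,4) w by (cases "?w = 0") auto
  have "inj_on ?q {c\<in>{0..m} - {?w}. ?q c \<noteq> 0}"
  proof (rule inj_onI)
    fix x z assume xz: "x \<in> {c\<in>{0..m} - {?w}. ?q c \<noteq> 0}" "z \<in> {c\<in>{0..m} - {?w}. ?q c \<noteq> 0}"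
      "?q x = ?q z"
    show "x = z"
      using inj_onD[OF c(2), of x z] inj_onD[OF c(2), of ?w z] inj_onD[OF c(2), of x ?w] xz w wy
      by (cases "x = y"; cases "z = y") auto
  qed
  moreover have "{1..i} \<subseteq> ?q ` ({0..m} - {?w})"
  proof
    fix r assume r: "r \<in> {1..i}"
    then obtain d where d: "d \<in> {0..m} - {y}" "q d = r" using c(3) by blast
    show "r \<in> ?q ` ({0..m} - {?w})"
    proof (cases "d = ?w")
      case True
      then show ?thesis using d y1 wy by (intro image_eqI[of _ _ y]) auto
    next
      case False
      then show ?thesis using d by (intro image_eqI[of _ _ d]) auto
    qed
  qed
  moreover have "\<forall>c\<in>{1..m}. v c \<le> 0 \<and> ?q c \<le> i \<and> (c \<noteq> ?w \<longrightarrow> ?q c = 0 \<longrightarrow> v c = 0) \<and>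
        (c \<noteq> ?w \<longrightarrow> ?q c \<noteq> 0 \<longrightarrow> u (?q c) + v c = a (?q c) c)"
    using c(1) w qw by auto
  moreover have "\<forall>c\<in>{1..m}. us c \<noteq> 0 \<longrightarrow> us c \<le> us ?w \<longrightarrow> 2 \<le> us c \<and> wy c \<le> m \<and> us (wy c) \<noteq> 0 \<and>
        us (wy c) < us c \<and> ?q (wy c) \<noteq> 0 \<and> u (?q (wy c)) + v c = a (?q (wy c)) c"
  proof (intro ballI impI)
    fix c assume c: "c \<in> {1..m}" "us c \<noteq> 0" "us c \<le> us ?w"
    then have "2 \<le> us c \<and> wy c \<le> m \<and> us (wy c) \<noteq> 0 \<and>
        us (wy c) < us c \<and> q (wy c) \<noteq> 0 \<and> u (q (wy c)) + v c = a (q (wy c)) c"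
      using A w unfolding augment_inv_def by (meson le_trans less_imp_le)
    \<comment> \<open>Columns not younger than the new hole have parents older than
      \<open>y\<close>, so none of their parents is the column whose row has just changed.\<close>
    moreover from this have "wy c \<noteq> y" using c w by auto
    ultimately show "2 \<le> us c \<and> wy c \<le> m \<and> us (wy c) \<noteq> 0 \<and>
        us (wy c) < us c \<and> ?q (wy c) \<noteq> 0 \<and> u (?q (wy c)) + v c = a (?q (wy c)) c"
      by simp
  qed
  moreover have "(\<forall>r\<in>{1..i}. \<forall>c\<in>{1..m}. u r + v c \<le> a r c) \<and> (\<forall>r>i. u r = 0)" "us 0 = 1"
    using A unfolding augment_inv_def by blast+
  moreover have "?q 0 \<le> i" using c(4) y by simp
  ultimately show ?thesis
    unfolding augment_inv_def using w by (intro conjI) (blast | simp)+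
qed

lemma augment_inv_dual_inv: "augment_inv a m i 0 u v q us wy \<Longrightarrow> dual_inv a m i u v q"
proof -
  assume "augment_inv a m i 0 u v q us wy"
  moreover have "{0..m} - {0} = {1..m}" by auto
  ultimately show ?thesis unfolding augment_inv_def dual_inv_def by simp
qed

text \<open>A hole in a real column has stamp at least 2. A bound of 1 on the stamp therefore shows
  that the hole has reached the root.\<close>

lemma augment_inv_stamp:
  "augment_inv a m i y u v q us wy \<Longrightarrow> y = 0 \<or> 2 \<le> us y"
  unfolding augment_inv_def by (metis One_nat_def Suc_leI atLeastAtMost_iff le_refl neq0_conv)

section \<open>Reduction to the assignment problem\<close>

lemma sum_two_points:
  fixes f :: "nat \<Rightarrow> 'b::comm_monoid_add"
  assumes "a \<in> {1..m'}" "b \<in> {1..m'}" "a \<noteq> b"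
  shows "(\<Sum>i = 1..m'. f i) = f a + f b + (\<Sum>i\<in>{1..m'} - {a, b}. f i)"
proof -
  have "(\<Sum>i = 1..m'. f i) = f a + (\<Sum>i\<in>{1..m'} - {a}. f i)"
    using assms by (intro sum.remove) auto
  also have "(\<Sum>i\<in>{1..m'} - {a}. f i) = f b + (\<Sum>i\<in>{1..m'} - {a} - {b}. f i)"
    using assms by (intro sum.remove) auto
  finally show ?thesis by (simp add: add.assoc insert_commute Diff_insert[symmetric])
qed

text \<open>The common remainder \<open>R\<close> reduces a comparison of the two sums to the two
  terms that change. The generality of the type lets it serve values, counts and the termination
  measure alike.\<close>

lemma sum_swap_two:
  fixes f f' :: "nat \<Rightarrow> 'b::comm_monoid_add"
  assumes "a \<in> {1..m'}" "b \<in> {1..m'}" "a \<noteq> b" "\<And>i. i \<noteq> a \<Longrightarrow> i \<noteq> b \<Longrightarrow> f' i = f i"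
  obtains R where "(\<Sum>i = 1..m'. f i) = f a + f b + R" "(\<Sum>i = 1..m'. f' i) = f' a + f' b + R"
proof
  show "(\<Sum>i = 1..m'. f i) = f a + f b + (\<Sum>i\<in>{1..m'} - {a, b}. f i)"
    by (rule sum_two_points) fact+
  have "(\<Sum>i\<in>{1..m'} - {a, b}. f' i) = (\<Sum>i\<in>{1..m'} - {a, b}. f i)"
    using assms(4) by (intro sum.cong) auto
  with sum_two_points[OF assms(1-3), of f']
  show "(\<Sum>i = 1..m'. f' i) = f' a + f' b + (\<Sum>i\<in>{1..m'} - {a, b}. f i)" by simp
qed

section \<open>Classes and ranks of the items\<close>

locale lu_problem =
  fixes I :: lu_instance
  assumes valid: "valid_instance I" and Delta: "Delta I \<le> 1" and Monge: "monotone_Monge I"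
begin

abbreviation m :: nat where "m \<equiv> num_items I"
abbreviation n :: nat where "n \<equiv> num_positions I"
abbreviation p :: nat where "p \<equiv> num_props I"
abbreviation W :: "nat \<Rightarrow> nat \<Rightarrow> real" where "W \<equiv> val I"
abbreviation P :: "nat \<Rightarrow> nat set" where "P \<equiv> property I"

text \<open>0 marks the items without a property, which no bound touches. For the others the choice
  is unambiguous by \<open>cls_unique\<close>.\<close>

definition cls :: "nat \<Rightarrow> nat" where
  "cls i = (if \<exists>l\<in>{1..p}. i \<in> P l then (SOME l. l \<in> {1..p} \<and> i \<in> P l) else 0)"

text \<open>The place of \<open>i\<close> in the increasing list of its class. For
  \<open>cls i = 0\<close> it depends on the arbitrary set \<open>P 0\<close>, hence the guards
  \<open>cls i \<noteq> 0\<close> below.\<close>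

definition rank :: "nat \<Rightarrow> nat" where
  "rank i = card {i' \<in> P (cls i). i' \<le> i}"

lemma sizes: "1 \<le> n" "n \<le> m"
  using valid by (auto simp: valid_instance_def)

lemma P_subset: "l \<in> {1..p} \<Longrightarrow> P l \<subseteq> {1..m}"
  using valid by (auto simp: valid_instance_def)

lemma finite_P: "l \<in> {1..p} \<Longrightarrow> finite (P l)"
  using P_subset finite_subset by blast

lemma cls_unique:
  assumes "l \<in> {1..p}" "l' \<in> {1..p}" "i \<in> P l" "i \<in> P l'"
  shows "l = l'"
proof -
  have "i \<in> {1..m}" using P_subset assms by blast
  then have "card (item_type I i) \<le> Delta I"
    unfolding Delta_def by (intro Max_ge) auto
  then have "card (item_type I i) \<le> 1"
    using Delta by simp
  moreover have "finite (item_type I i)" by (simp add: item_type_def)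
  moreover have "l \<in> item_type I i" "l' \<in> item_type I i"
    using assms by (simp_all add: item_type_def)
  ultimately show ?thesis
    by (metis One_nat_def card_le_Suc0_iff_eq)
qed

lemma cls_iff: "l \<in> {1..p} \<Longrightarrow> i \<in> P l \<longleftrightarrow> cls i = l"
proof -
  assume l: "l \<in> {1..p}"
  show ?thesis
  proof
    assume i: "i \<in> P l"
    then have "(SOME l. l \<in> {1..p} \<and> i \<in> P l) = l"
      using l cls_unique by (intro some_equality) auto
    then show "cls i = l" using i l by (auto simp: cls_def)
  next
    assume c: "cls i = l"
    with l have "\<exists>l. l \<in> {1..p} \<and> i \<in> P l" by (auto simp: cls_def split: if_splits)
    from someI_ex[OF this] c show "i \<in> P l"
      using l by (auto simp: cls_def split: if_splits)
  qed
qed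

lemma cls_le: "cls i \<le> p"
proof (cases "\<exists>l\<in>{1..p}. i \<in> P l")
  case True
  then obtain l where "l \<in> {1..p}" "i \<in> P l" by blast
  then show ?thesis using cls_iff by auto
qed (simp add: cls_def)

lemma P_eq: "l \<in> {1..p} \<Longrightarrow> P l = {i \<in> {1..m}. cls i = l}"
  using cls_iff P_subset by blast

lemma sum_card_P: "(\<Sum>l = 1..p. card (P l)) \<le> m"
proof -
  have "(\<Sum>l = 1..p. card (P l)) = card (\<Union>l\<in>{1..p}. P l)"
    using finite_P cls_unique by (intro card_UN_disjoint[symmetric]) auto
  also have "\<dots> \<le> card {1..m}"
    using P_subset by (intro card_mono UN_least) auto
  finally show ?thesis by simp
qed

text \<open>The input lists each class increasingly, so the place where the program meets an item is
  its rank, up to the shift from 0-based lists.\<close>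

lemma rank_nth:
  assumes "l \<in> {1..p}" "r < card (P l)"
  shows "sorted_list_of_set (P l) ! r \<in> P l" "rank (sorted_list_of_set (P l) ! r) = Suc r"
proof -
  let ?xs = "sorted_list_of_set (P l)"
  have set: "set ?xs = P l" and len: "length ?xs = card (P l)"
    and sorted: "sorted ?xs" and dist: "distinct ?xs"
    using finite_P[OF assms(1)] by auto
  show mem: "?xs ! r \<in> P l"
    using set len assms(2) by (metis nth_mem)
  have "{i' \<in> P l. i' \<le> ?xs ! r} = (!) ?xs ` {..r}"
  proof (intro equalityI subsetI)
    fix i assume i: "i \<in> {i' \<in> P l. i' \<le> ?xs ! r}"
    then obtain k where k: "k < length ?xs" "?xs ! k = i"
      using set by (metis (no_types, lifting) in_set_conv_nth mem_Collect_eq)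
    have "k \<le> r"
    proof (rule ccontr)
      assume "\<not> k \<le> r"
      then have "?xs ! r < ?xs ! k"
        using sorted dist k by (meson not_le_imp_less sorted_wrt_nth_less strict_sorted_iff)
      with i k show False by simp
    qed
    with k show "i \<in> (!) ?xs ` {..r}" by blast
  next
    fix i assume "i \<in> (!) ?xs ` {..r}"
    then obtain k where k: "k \<le> r" "i = ?xs ! k" by blast
    then have "?xs ! k \<in> P l" using set len assms(2) by (metis le_less_trans nth_mem)
    moreover have "?xs ! k \<le> ?xs ! r"
      using sorted k len assms(2) by (simp add: sorted_nth_mono)
    ultimately show "i \<in> {i' \<in> P l. i' \<le> ?xs ! r}" using k by simp
  qed
  moreover have "inj_on ((!) ?xs) {..r}"
    using dist len assms(2) by (intro inj_on_nth) auto
  ultimately have "card {i' \<in> P l. i' \<le> ?xs ! r} = Suc r"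
    by (simp add: card_image)
  moreover have "cls (?xs ! r) = l" using cls_iff[OF assms(1)] mem by simp
  ultimately show "rank (?xs ! r) = Suc r" by (simp add: rank_def)
qed

lemma rank_le_eq_image:
  assumes "l \<in> {1..p}"
  shows "{i \<in> P l. rank i \<le> t} = (!) (sorted_list_of_set (P l)) ` {..<min t (card (P l))}"
proof (intro equalityI subsetI)
  let ?xs = "sorted_list_of_set (P l)"
  have set: "set ?xs = P l" and len: "length ?xs = card (P l)"
    using finite_P[OF assms(1)] by auto
  fix i assume i: "i \<in> {i \<in> P l. rank i \<le> t}"
  then obtain k where k: "k < length ?xs" "?xs ! k = i"
    using set by (metis (no_types, lifting) in_set_conv_nth mem_Collect_eq)
  then have "rank i = Suc k" using rank_nth(2)[OF assms, of k] len by simp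
  then show "i \<in> (!) ?xs ` {..<min t (card (P l))}"
    using i k len by (intro image_eqI[of _ _ k]) auto
next
  fix i assume "i \<in> (!) (sorted_list_of_set (P l)) ` {..<min t (card (P l))}"
  then obtain k where "k < t" "k < card (P l)" "i = sorted_list_of_set (P l) ! k" by auto
  then show "i \<in> {i \<in> P l. rank i \<le> t}"
    using rank_nth[OF assms, of k] by simp
qed

text \<open>Ranks run through \<open>1..card (P l)\<close> without gaps. Because of the
  \<open>min\<close>, a lower bound can be met by counting ranks only if it does not exceed the size
  of the class.\<close>

lemma card_rank_le:
  assumes "l \<in> {1..p}"
  shows "card {i \<in> P l. rank i \<le> t} = min t (card (P l))"
  unfolding rank_le_eq_image[OF assms]
  by (subst card_image) (auto intro!: inj_on_nth simp: finite_P[OF assms])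

section \<open>Rankings as matchings\<close>

definition count :: "(nat \<Rightarrow> nat) \<Rightarrow> nat \<Rightarrow> nat \<Rightarrow> nat" where
  "count q l k = card {i \<in> {1..m}. cls i = l \<and> q i \<in> {1..k}}"

definition count_ok :: "(nat \<Rightarrow> nat) \<Rightarrow> bool" where
  "count_ok q \<longleftrightarrow> (\<forall>l\<in>{1..p}. \<forall>k\<in>{1..n}. lower I k l \<le> count q l k \<and> count q l k \<le> upper I k l)"

definition total_value :: "(nat \<Rightarrow> nat) \<Rightarrow> real" where
  "total_value q = assign_sum (\<lambda>j i. W i j) m q"

lemma ranking_of_matching:
  assumes q: "matching n m q"
    and x: "\<And>i j. i \<in> {1..m} \<Longrightarrow> j \<in> {1..n} \<Longrightarrow> x i j = (if q i = j then 1 else 0)"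
  shows "lu_feasible I x \<longleftrightarrow> count_ok q" "ranking_value I x = total_value q"
proof -
  have qn: "q i \<le> n" if "i \<in> {1..m}" for i using q that unfolding matching_def by blast
  have "is_ranking I x"
    unfolding is_ranking_def
  proof (intro conjI ballI)
    fix i j assume "i \<in> {1..m}" "j \<in> {1..n}"
    then show "x i j \<in> {0, 1}" using x by simp
  next
    fix j assume j: "j \<in> {1..n}"
    then obtain c where c: "c \<in> {1..m}" "q c = j" and u: "\<And>c'. c' \<in> {1..m} \<Longrightarrow> q c' = j \<Longrightarrow> c' = c"
      using q unfolding matching_def by blast
    have "x i j = (if i = c then 1 else 0)" if "i \<in> {1..m}" for i
    proof (cases "i = c")
      case True
      then show ?thesis using x[OF that j] c(2) by simp
    next
      case False
      then have "q i \<noteq> j" using u[OF that] by blast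
      then show ?thesis using x[OF that j] False by simp
    qed
    then have "(\<Sum>i = 1..m. x i j) = (\<Sum>i = 1..m. if i = c then 1 else 0)"
      by (intro sum.cong) auto
    then show "(\<Sum>i = 1..m. x i j) = 1" using c(1) by simp
  next
    fix i assume i: "i \<in> {1..m}"
    have "(\<Sum>j = 1..n. x i j) = (\<Sum>j = 1..n. if j = q i then 1 else 0)"
      using x i by (intro sum.cong) auto
    then show "(\<Sum>j = 1..n. x i j) \<le> 1" by simp
  qed
  moreover have "(\<Sum>j = 1..k. \<Sum>i\<in>P l. x i j) = count q l k" if lk: "l \<in> {1..p}" "k \<in> {1..n}" for l k
  proof -
    have "(\<Sum>j = 1..k. \<Sum>i\<in>P l. x i j) = (\<Sum>i\<in>P l. \<Sum>j = 1..k. x i j)"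
      by (rule sum.swap)
    also have "\<dots> = (\<Sum>i\<in>P l. if q i \<in> {1..k} then 1 else 0)"
    proof (rule sum.cong[OF refl])
      fix i assume "i \<in> P l"
      then have i: "i \<in> {1..m}" using P_subset lk by blast
      have "(\<Sum>j = 1..k. x i j) = (\<Sum>j = 1..k. if j = q i then 1 else 0)"
        using x i lk by (intro sum.cong) auto
      then show "(\<Sum>j = 1..k. x i j) = (if q i \<in> {1..k} then 1 else 0)" by simp
    qed
    also have "\<dots> = card {i \<in> P l. q i \<in> {1..k}}"
      using finite_P lk by (simp add: sum.inter_filter[symmetric])
    also have "{i \<in> P l. q i \<in> {1..k}} = {i \<in> {1..m}. cls i = l \<and> q i \<in> {1..k}}"
      using P_eq lk by auto
    finally show ?thesis by (simp add: count_def)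
  qed
  ultimately show "lu_feasible I x \<longleftrightarrow> count_ok q"
    unfolding lu_feasible_def count_ok_def by simp
  have "(\<Sum>j = 1..n. W i j * real (x i j)) = (if q i = 0 then 0 else W i (q i))" if i: "i \<in> {1..m}" for i
  proof -
    have "(\<Sum>j = 1..n. W i j * real (x i j)) = (\<Sum>j = 1..n. if j = q i then W i j else 0)"
      using x i by (intro sum.cong) auto
    then show ?thesis using qn[OF i] by simp
  qed
  then show "ranking_value I x = total_value q"
    unfolding ranking_value_def total_value_def assign_sum_if by (intro sum.cong) auto
qed

lemma matching_of_ranking:
  assumes "lu_feasible I y"
  obtains q where "matching n m q" "count_ok q" "ranking_value I y = total_value q"
proof -
  \<comment> \<open>Row \<open>i\<close> of \<open>y\<close> contains at most one 1, so the weighted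
    sum is the position of that 1, or 0 if item \<open>i\<close> is unranked.\<close>
  define q where "q i = (\<Sum>j = 1..n. j * y i j)" for i
  have R: "\<And>i j. i \<in> {1..m} \<Longrightarrow> j \<in> {1..n} \<Longrightarrow> y i j = 0 \<or> y i j = 1"
    "\<And>j. j \<in> {1..n} \<Longrightarrow> (\<Sum>i = 1..m. y i j) = 1"
    "\<And>i. i \<in> {1..m} \<Longrightarrow> (\<Sum>j = 1..n. y i j) \<le> 1"
    using assms unfolding lu_feasible_def is_ranking_def by auto
  have q1: "q i = j" if ij: "i \<in> {1..m}" "j \<in> {1..n}" "y i j = 1" for i j
  proof -
    have "(\<Sum>j = 1..n. y i j) = y i j + (\<Sum>j\<in>{1..n} - {j}. y i j)"
      using ij by (intro sum.remove) auto
    then have "(\<Sum>j\<in>{1..n} - {j}. y i j) = 0"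
      using R(3)[OF ij(1)] ij by simp
    then have z: "\<forall>j'\<in>{1..n} - {j}. y i j' = 0"
      by (subst (asm) sum_eq_0_iff) auto
    have "q i = j * y i j + (\<Sum>j\<in>{1..n} - {j}. j * y i j)"
      unfolding q_def using ij by (intro sum.remove) auto
    with z ij show ?thesis by simp
  qed
  have x: "y i j = (if q i = j then 1 else 0)" if ij: "i \<in> {1..m}" "j \<in> {1..n}" for i j
  proof (cases "y i j = 1")
    case True
    then show ?thesis using q1 ij by simp
  next
    case False
    then have 0: "y i j = 0" using R(1)[OF ij] by simp
    have "q i \<noteq> j"
    proof
      assume "q i = j"
      with ij have "(\<Sum>j = 1..n. j * y i j) \<noteq> 0" unfolding q_def by simp
      then obtain j' where "j' \<in> {1..n}" "j' * y i j' \<noteq> 0"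
        by (meson sum.neutral)
      then have "y i j' = 1" "j' \<in> {1..n}" using R(1)[OF ij(1), of j'] by auto
      then have "q i = j'" using q1 ij by simp
      with \<open>q i = j\<close> \<open>y i j' = 1\<close> 0 show False by simp
    qed
    with 0 show ?thesis by simp
  qed
  have qn: "q i \<le> n" if i: "i \<in> {1..m}" for i
  proof (cases "\<exists>j\<in>{1..n}. y i j = 1")
    case True
    then show ?thesis using q1 i by fastforce
  next
    case False
    then have "\<forall>j\<in>{1..n}. y i j = 0" using R(1)[OF i] by blast
    then show ?thesis by (simp add: q_def)
  qed
  have "matching n m q"
    unfolding matching_def
  proof (intro conjI ballI)
    fix j assume j: "j \<in> {1..n}"
    have "(\<Sum>i = 1..m. y i j) \<noteq> 0" using R(2)[OF j] by simp
    then obtain c where c: "c \<in> {1..m}" "y c j \<noteq> 0" by (meson sum.neutral)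
    then have c1: "y c j = 1" using R(1)[OF c(1) j] by simp
    have "c' = c" if c': "c' \<in> {1..m}" "q c' = j" for c'
    proof (rule ccontr)
      assume "c' \<noteq> c"
      have "y c' j = 1" using x[OF c'(1) j] c' by simp
      have "(\<Sum>i = 1..m. y i j) = y c j + (\<Sum>i\<in>{1..m} - {c}. y i j)"
        using c by (intro sum.remove) auto
      moreover have "y c' j \<le> (\<Sum>i\<in>{1..m} - {c}. y i j)"
        using c' \<open>c' \<noteq> c\<close> by (intro member_le_sum) auto
      ultimately show False using R(2)[OF j] c1 \<open>y c' j = 1\<close> by simp
    qed
    then show "\<exists>!c. c \<in> {1..m} \<and> q c = j"
      using c(1) q1[OF c(1) j c1] by blast
  qed (use qn in auto)
  with ranking_of_matching[OF this x] assms that show ?thesis by blast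
qed

lemma count_swap:
  assumes ab: "a \<in> {1..m}" "b \<in> {1..m}" "cls a = cls b"
  shows "count (q(a := q b, b := q a)) l k = count q l k"
proof (cases "a = b")
  case False
  have c: "count q l k = (\<Sum>i = 1..m. if cls i = l \<and> q i \<in> {1..k} then 1 else 0)" for q
    unfolding count_def by (simp add: sum.inter_filter[symmetric])
  let ?q = "q(a := q b, b := q a)"
  obtain R where "count q l k = (if cls a = l \<and> q a \<in> {1..k} then 1 else 0) +
      (if cls b = l \<and> q b \<in> {1..k} then 1 else 0) + R"
    "count ?q l k = (if cls a = l \<and> ?q a \<in> {1..k} then 1 else 0) +
      (if cls b = l \<and> ?q b \<in> {1..k} then 1 else 0) + R"
    unfolding c
    by (rule sum_swap_two[OF ab(1,2) False, of "\<lambda>i. if cls i = l \<and> ?q i \<in> {1..k} then 1 else 0"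
          "\<lambda>i. if cls i = l \<and> q i \<in> {1..k} then 1 else 0"]) auto
  with ab(3) False show ?thesis by simp
qed simp


section \<open>Admissible positions and the exchange argument\<close>

definition allowed :: "nat \<Rightarrow> nat \<Rightarrow> bool" where
  "allowed i j \<longleftrightarrow> cls i = 0 \<or>
     (\<forall>k\<in>{1..n}. (j \<le> k \<longrightarrow> rank i \<le> upper I k (cls i)) \<and> (k < j \<longrightarrow> lower I k (cls i) < rank i))"

definition mandatory :: "nat \<Rightarrow> bool" where
  "mandatory i \<longleftrightarrow> cls i \<noteq> 0 \<and> (\<exists>k\<in>{1..n}. rank i \<le> lower I k (cls i))"

definition admissible :: "(nat \<Rightarrow> nat) \<Rightarrow> bool" where
  "admissible q \<longleftrightarrow> (\<forall>i\<in>{1..m}. (q i \<noteq> 0 \<longrightarrow> allowed i (q i)) \<and> (mandatory i \<longrightarrow> q i \<noteq> 0))"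

text \<open>Items of class 0 get no prescribed order and are not exchanged, so each of them keeps
  its own value in the last column.\<close>

definition best_later :: "(nat \<Rightarrow> nat) \<Rightarrow> bool" where
  "best_later ag \<longleftrightarrow> (\<forall>i\<in>{1..m}. ag i \<in> {i..m} \<and> cls (ag i) = cls i \<and> (cls i = 0 \<longrightarrow> ag i = i) \<and>
     (\<forall>i'\<in>{i..m}. cls i' = cls i \<longrightarrow> cls i \<noteq> 0 \<longrightarrow> W i' n \<le> W (ag i) n))"

text \<open>
  The hypothesis on \<open>W\<close> says nothing about the order of the entries of the last column. Giving
  item \<open>i\<close> there the value of the best later item of its class makes this column monotone within
  each class.
\<close>

definition adj_val :: "(nat \<Rightarrow> nat) \<Rightarrow> nat \<Rightarrow> nat \<Rightarrow> real" where
  "adj_val ag j i = (if j = n then W (ag i) n else W i j)"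

lemma best_laterD:
  assumes "best_later ag" "i \<in> {1..m}"
  shows "ag i \<in> {1..m}" "i \<le> ag i" "cls (ag i) = cls i" "cls i = 0 \<Longrightarrow> ag i = i"
    and "\<And>i'. i \<le> i' \<Longrightarrow> i' \<le> m \<Longrightarrow> cls i' = cls i \<Longrightarrow> W i' n \<le> W (ag i) n \<or> cls i = 0"
  using assms unfolding best_later_def by (auto dest!: bspec)

text \<open>The hypothesis compares two items at \<open>j\<^sub>1\<close> only in the presence of
  some \<open>j\<^sub>2 > j\<^sub>1\<close>. Here \<open>n\<close> is that witness, whence
  \<open>j < n\<close>.\<close>

lemma W_antimono:
  assumes "1 \<le> i1" "i1 \<le> i2" "i2 \<le> m" "1 \<le> j" "j < n"
  shows "W i2 j \<le> W i1 j"
proof (cases "i1 = i2")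
  case False
  then have "1 \<le> i1 \<and> i1 < i2 \<and> i2 \<le> m \<and> 1 \<le> j \<and> j < n \<and> n \<le> n" using assms by simp
  then show ?thesis using Monge unfolding monotone_Monge_def by blast
qed simp

lemma W_Monge:
  assumes "1 \<le> i1" "i1 < i2" "i2 \<le> m" "1 \<le> j1" "j1 < j2" "j2 \<le> n"
  shows "W i1 j2 + W i2 j1 \<le> W i1 j1 + W i2 j2"
  using Monge assms unfolding monotone_Monge_def by blast

text \<open>In the last column \<open>i1\<close> chooses among all candidates of \<open>i2\<close>
  and possibly more.\<close>

lemma adj_val_antimono:
  assumes ag: "best_later ag" and i: "i1 \<in> {1..m}" "i2 \<in> {1..m}" "i1 < i2" "cls i1 = cls i2" "cls i1 \<noteq> 0"
    and j: "j \<in> {1..n}"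
  shows "adj_val ag j i2 \<le> adj_val ag j i1"
proof (cases "j = n")
  case True
  have "W (ag i2) n \<le> W (ag i1) n"
    using best_laterD(5)[OF ag i(1), of "ag i2"] best_laterD(1-3)[OF ag i(2)] i by auto
  then show ?thesis using True by (simp add: adj_val_def)
next
  case False
  then show ?thesis using W_antimono[of i1 i2 j] i j by (simp add: adj_val_def)
qed

text \<open>Only \<open>j2 = n\<close> needs care. Let \<open>b = ag i1\<close>. If \<open>b\<close>
  precedes \<open>i2\<close>, the Monge inequality holds for \<open>b\<close> and \<open>i2\<close>,
  and at \<open>j1\<close> item \<open>i1\<close> is worth at least as much as \<open>b\<close>.
  Otherwise \<open>b\<close> is a candidate for \<open>i2\<close> too, so the adjusted last value of
  \<open>i1\<close> is at most that of \<open>i2\<close>, and monotonicity at \<open>j1 < n\<close>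
  suffices.\<close>

lemma adj_val_Monge:
  assumes ag: "best_later ag" and i: "i1 \<in> {1..m}" "i2 \<in> {1..m}" "i1 < i2" "cls i1 = cls i2" "cls i1 \<noteq> 0"
    and j: "1 \<le> j1" "j1 < j2" "j2 \<le> n"
  shows "adj_val ag j2 i1 + adj_val ag j1 i2 \<le> adj_val ag j1 i1 + adj_val ag j2 i2"
proof (cases "j2 = n")
  case False
  then show ?thesis using W_Monge[of i1 i2 j1 j2] i j by (simp add: adj_val_def)
next
  case True
  let ?b = "ag i1"
  note b = best_laterD(1-3)[OF ag i(1)]
  show ?thesis
  proof (cases "?b < i2")
    case True
    have "W ?b j1 \<le> W i1 j1" using W_antimono[of i1 ?b j1] b i j by auto
    moreover have "W ?b n + W i2 j1 \<le> W ?b j1 + W i2 n"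
      using W_Monge[of ?b i2 j1 n] True b i j \<open>j2 = n\<close> by auto
    moreover have "W i2 n \<le> W (ag i2) n" using best_laterD(5)[OF ag i(2), of i2] i by auto
    ultimately show ?thesis using j \<open>j2 = n\<close> by (simp add: adj_val_def)
  next
    case False
    then have "W ?b n \<le> W (ag i2) n" using best_laterD(5)[OF ag i(2), of ?b] b i by auto
    moreover have "W i2 j1 \<le> W i1 j1" using W_antimono[of i1 i2 j1] i j by auto
    ultimately show ?thesis using j \<open>j2 = n\<close> by (simp add: adj_val_def)
  qed
qed

text \<open>The part \<open>q i1 \<noteq> 0\<close> makes the ranked items an initial segment of
  their class, so the \<open>r\<close>-th ranked item of a class is the one with \<open>rank\<close>
  equal to \<open>r\<close>.\<close>

definition class_sorted :: "(nat \<Rightarrow> nat) \<Rightarrow> bool" where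
  "class_sorted q \<longleftrightarrow> (\<forall>i1\<in>{1..m}. \<forall>i2\<in>{1..m}. i1 < i2 \<longrightarrow> cls i1 = cls i2 \<longrightarrow> cls i1 \<noteq> 0 \<longrightarrow>
     q i2 \<noteq> 0 \<longrightarrow> q i1 \<noteq> 0 \<and> q i1 < q i2)"

text \<open>If \<open>i1\<close> is unranked it replaces \<open>i2\<close>, which monotonicity
  permits; if both are ranked they change places, which the Monge inequality permits.\<close>

lemma swap_adj_val:
  assumes ag: "best_later ag" and i: "i1 \<in> {1..m}" "i2 \<in> {1..m}" "i1 < i2" "cls i1 = cls i2" "cls i1 \<noteq> 0"
    and q: "q i2 \<noteq> 0" "q i1 = 0 \<or> q i2 < q i1" "q i1 \<le> n" "q i2 \<le> n"
  shows "assign_sum (adj_val ag) m q \<le> assign_sum (adj_val ag) m (q(i1 := q i2, i2 := q i1))"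
proof -
  let ?q = "q(i1 := q i2, i2 := q i1)"
  let ?f = "\<lambda>q i. if q i = 0 then 0 else adj_val ag (q i) i"
  have "i1 \<noteq> i2" using i by simp
  then obtain R where R: "(\<Sum>i = 1..m. ?f q i) = ?f q i1 + ?f q i2 + R"
      "(\<Sum>i = 1..m. ?f ?q i) = ?f ?q i1 + ?f ?q i2 + R"
    by (rule sum_swap_two[OF i(1,2), of "?f ?q" "?f q"]) auto
  have "?f q i1 + ?f q i2 \<le> ?f ?q i1 + ?f ?q i2"
  proof (cases "q i1 = 0")
    case True
    then show ?thesis using adj_val_antimono[OF ag i, of "q i2"] q i(3) by simp
  next
    case False
    then show ?thesis using adj_val_Monge[OF ag i, of "q i2" "q i1"] q i(3) by simp
  qed
  then show ?thesis unfolding assign_sum_if R by simp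
qed

text \<open>An exchange sort: swapping a pair of one class that is in the wrong order keeps all
  class counts and does not lower the adjusted value.\<close>

lemma ex_class_sorted:
  assumes ag: "best_later ag" and q: "matching n m q"
  shows "\<exists>q'. matching n m q' \<and> class_sorted q' \<and> (\<forall>l k. count q' l k = count q l k) \<and>
     assign_sum (adj_val ag) m q \<le> assign_sum (adj_val ag) m q'"
  using q
\<comment> \<open>The key \<open>n + 1 - q i\<close>, or 0 for an unranked item, grows with the
  quality of the position. Both kinds of disorder then mean that the smaller item has the smaller
  key, and every swap lowers the sum of the keys weighted by the item numbers.\<close>
proof (induction "\<Sum>i = 1..m. i * (if q i = 0 then 0 else n + 1 - q i)" arbitrary: q rule: less_induct)
  case less
  show ?case
  proof (cases "class_sorted q")
    case True
    then show ?thesis using less.prems by blast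
  next
    case False
    then obtain i1 i2 where i: "i1 \<in> {1..m}" "i2 \<in> {1..m}" "i1 < i2" "cls i1 = cls i2" "cls i1 \<noteq> 0"
      and q2: "q i2 \<noteq> 0" and q1: "\<not> (q i1 \<noteq> 0 \<and> q i1 < q i2)"
      unfolding class_sorted_def by blast
    have qn: "q i1 \<le> n" "q i2 \<le> n" using less.prems i unfolding matching_def by auto
    have ne: "i1 \<noteq> i2" using i by simp
    have "q i1 \<noteq> q i2"
    proof
      assume eq: "q i1 = q i2"
      have "q i2 \<in> {1..n}" using qn q2 by simp
      then have "\<exists>!c. c \<in> {1..m} \<and> q c = q i2" using less.prems unfolding matching_def by blast
      with eq i ne show False by blast
    qed
    with q1 have viol: "q i1 = 0 \<or> q i2 < q i1" by linarith
    let ?q = "q(i1 := q i2, i2 := q i1)"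
    let ?g = "\<lambda>q i. i * (if q i = 0 then 0 else n + 1 - q i)"
    obtain R where R: "(\<Sum>i = 1..m. ?g q i) = ?g q i1 + ?g q i2 + R"
        "(\<Sum>i = 1..m. ?g ?q i) = ?g ?q i1 + ?g ?q i2 + R"
      by (rule sum_swap_two[OF i(1,2) ne, of "?g ?q" "?g q"]) auto
    define x y where "x = (if q i1 = 0 then 0 else n + 1 - q i1)" and "y = (if q i2 = 0 then 0 else n + 1 - q i2)"
    have "x < y" using viol q2 qn by (auto simp: x_def y_def)
    then obtain e where e: "y = x + e" "e > 0" by (metis less_imp_add_positive)
    have "?g ?q i1 + ?g ?q i2 = i1 * y + i2 * x" "?g q i1 + ?g q i2 = i1 * x + i2 * y"
      using ne by (simp_all add: x_def y_def)
    \<comment> \<open>The rearrangement inequality: the two sides differ by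
      \<open>(i2 - i1) * (y - x)\<close>.\<close>
    moreover have "i1 * y + i2 * x < i1 * x + i2 * y"
      using i(3) e by (simp add: algebra_simps)
    ultimately have "(\<Sum>i = 1..m. ?g ?q i) < (\<Sum>i = 1..m. ?g q i)"
      unfolding R by linarith
    from less.hyps[OF this matching_swap[OF less.prems i(1,2)]] obtain q' where
      "matching n m q'" "class_sorted q'" "\<forall>l k. count q' l k = count ?q l k"
      "assign_sum (adj_val ag) m ?q \<le> assign_sum (adj_val ag) m q'"
      by blast
    moreover have "assign_sum (adj_val ag) m q \<le> assign_sum (adj_val ag) m ?q"
      by (rule swap_adj_val[OF ag i q2 viol qn])
    ultimately show ?thesis
      using count_swap[OF i(1,2,4)] by (metis order_trans)
  qed
qed

lemma rank_less:
  assumes "i \<in> {1..m}" "cls i \<noteq> 0"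
  shows "rank i = Suc (card {i' \<in> {1..m}. cls i' = cls i \<and> i' < i})"
proof -
  have l: "cls i \<in> {1..p}" using assms cls_le[of i] by simp
  have "{i' \<in> P (cls i). i' \<le> i} = insert i {i' \<in> {1..m}. cls i' = cls i \<and> i' < i}"
    unfolding P_eq[OF l] using assms(1) by auto
  then show ?thesis unfolding rank_def by simp
qed

text \<open>In sorted order only smaller items of its class precede \<open>i\<close>, and all of
  them do once \<open>i\<close> is ranked. So the first \<open>k\<close> positions hold at least
  \<open>rank i\<close> items of the class iff \<open>i\<close> is one of them (\<open>lo\<close>
  and \<open>hi\<close>), and bounds on counts become bounds on ranks.\<close>

lemma class_sorted_admissible:
  assumes q: "matching n m q" "count_ok q" and s: "class_sorted q"
  shows "admissible q"
proof -
  have sD: "q i1 \<noteq> 0 \<and> q i1 < q i2"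
    if "i1 \<in> {1..m}" "i2 \<in> {1..m}" "i1 < i2" "cls i1 = cls i2" "cls i1 \<noteq> 0" "q i2 \<noteq> 0" for i1 i2
    using s that unfolding class_sorted_def by blast
  have ok: "lower I k l \<le> count q l k" "count q l k \<le> upper I k l" if "l \<in> {1..p}" "k \<in> {1..n}" for k l
    using q(2) that unfolding count_ok_def by blast+
  have lo: "count q (cls i) k < rank i"
    if i: "i \<in> {1..m}" "cls i \<noteq> 0" and k: "q i = 0 \<or> k < q i" for i k
  proof -
    have "{i' \<in> {1..m}. cls i' = cls i \<and> q i' \<in> {1..k}} \<subseteq> {i' \<in> {1..m}. cls i' = cls i \<and> i' < i}"
    proof
      fix i' assume i': "i' \<in> {i' \<in> {1..m}. cls i' = cls i \<and> q i' \<in> {1..k}}"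
      have "i' \<noteq> i" using i' k by auto
      moreover have "\<not> i < i'" using sD[of i i'] i i' k by auto
      ultimately show "i' \<in> {i' \<in> {1..m}. cls i' = cls i \<and> i' < i}" using i' by simp
    qed
    then have "count q (cls i) k \<le> card {i' \<in> {1..m}. cls i' = cls i \<and> i' < i}"
      unfolding count_def by (intro card_mono) auto
    then show ?thesis using rank_less[OF i] by simp
  qed
  have hi: "rank i \<le> count q (cls i) k"
    if i: "i \<in> {1..m}" "cls i \<noteq> 0" and k: "q i \<noteq> 0" "q i \<le> k" for i k
  proof -
    have "insert i {i' \<in> {1..m}. cls i' = cls i \<and> i' < i} \<subseteq> {i' \<in> {1..m}. cls i' = cls i \<and> q i' \<in> {1..k}}"
    proof
      fix i' assume "i' \<in> insert i {i' \<in> {1..m}. cls i' = cls i \<and> i' < i}"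
      then consider "i' = i" | "i' \<in> {1..m}" "cls i' = cls i" "i' < i" by blast
      then show "i' \<in> {i' \<in> {1..m}. cls i' = cls i \<and> q i' \<in> {1..k}}"
        using sD[of i' i] i k by cases auto
    qed
    then have "card (insert i {i' \<in> {1..m}. cls i' = cls i \<and> i' < i}) \<le> count q (cls i) k"
      unfolding count_def by (intro card_mono) auto
    then show ?thesis using rank_less[OF i] by simp
  qed
  show ?thesis
    unfolding admissible_def
  proof (intro ballI conjI impI)
    fix i assume i: "i \<in> {1..m}" "q i \<noteq> 0"
    show "allowed i (q i)"
    proof (cases "cls i = 0")
      case False
      then have "cls i \<in> {1..p}" using cls_le[of i] by simp
      then show ?thesis
        unfolding allowed_def using ok[of "cls i"] lo[OF i(1) False] hi[OF i(1) False i(2)]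
        by (intro disjI2 ballI conjI impI) (blast intro: order_trans, blast intro: le_less_trans)
    qed (simp add: allowed_def)
  next
    fix i assume i: "i \<in> {1..m}" "mandatory i"
    then obtain k where k: "k \<in> {1..n}" "rank i \<le> lower I k (cls i)" "cls i \<noteq> 0"
      unfolding mandatory_def by blast
    then have "cls i \<in> {1..p}" using cls_le[of i] by simp
    then have "rank i \<le> count q (cls i) k" using ok(1)[of "cls i" k] k by simp
    then show "q i \<noteq> 0" using lo[OF i(1) k(3), of k] by linarith
  qed
qed

text \<open>Comparing sets suffices, whatever the order within a class: the items of rank at most
  \<open>L\<close> are mandatory and confined to the first \<open>k\<close> positions, and only
  items of rank at most \<open>U\<close> are allowed there. A class smaller than \<open>L\<close>
  would have too few items of the first kind, hence the premise on its size.\<close>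

lemma admissible_count_ok:
  assumes q: "matching n m q" "admissible q"
    and L: "\<And>k l. k \<in> {1..n} \<Longrightarrow> l \<in> {1..p} \<Longrightarrow> lower I k l \<le> card (P l)"
  shows "count_ok q"
  unfolding count_ok_def
proof (intro ballI conjI)
  fix l k assume l: "l \<in> {1..p}" and k: "k \<in> {1..n}"
  have cnt: "count q l k = card {i \<in> P l. q i \<in> {1..k}}"
    unfolding count_def using P_eq[OF l] by (intro arg_cong[of _ _ card]) auto
  have adm: "(q i \<noteq> 0 \<longrightarrow> allowed i (q i)) \<and> (mandatory i \<longrightarrow> q i \<noteq> 0)" "cls i = l" if "i \<in> P l" for i
    using q(2) that P_eq[OF l] unfolding admissible_def by auto
  have "{i \<in> P l. rank i \<le> lower I k l} \<subseteq> {i \<in> P l. q i \<in> {1..k}}"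
  proof
    fix i assume i: "i \<in> {i \<in> P l. rank i \<le> lower I k l}"
    then have "mandatory i" using adm(2)[of i] k l unfolding mandatory_def by auto
    then have "q i \<noteq> 0" "allowed i (q i)" using adm(1)[of i] i by auto
    then have "\<not> k < q i" using i adm(2)[of i] k l unfolding allowed_def by auto
    with \<open>q i \<noteq> 0\<close> i show "i \<in> {i \<in> P l. q i \<in> {1..k}}" by simp
  qed
  then have "card {i \<in> P l. rank i \<le> lower I k l} \<le> count q l k"
    unfolding cnt using finite_P[OF l] by (intro card_mono) auto
  then show "lower I k l \<le> count q l k"
    using card_rank_le[OF l] L[OF k l] by simp
  have "{i \<in> P l. q i \<in> {1..k}} \<subseteq> {i \<in> P l. rank i \<le> upper I k l}"
  proof
    fix i assume i: "i \<in> {i \<in> P l. q i \<in> {1..k}}"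
    then have "allowed i (q i)" using adm(1)[of i] by auto
    then show "i \<in> {i \<in> P l. rank i \<le> upper I k l}"
      using i adm(2)[of i] k l unfolding allowed_def by auto
  qed
  then have "count q l k \<le> card {i \<in> P l. rank i \<le> upper I k l}"
    unfolding cnt using finite_P[OF l] by (intro card_mono) auto
  then show "count q l k \<le> upper I k l"
    using card_rank_le[OF l] by simp
qed

lemma count_le_card_P: "l \<in> {1..p} \<Longrightarrow> count q l k \<le> card (P l)"
  unfolding count_def using P_eq finite_P by (intro card_mono) auto

section \<open>Constraints as penalties\<close>

definition penalty :: "nat \<Rightarrow> nat \<Rightarrow> nat" where
  "penalty j i = (if allowed i j then (if mandatory i then 1 else 2) else 3)"

text \<open>The least penalty is 1 and not 0, so that \<open>N \<ge> weight\<close> makes every cost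
  nonnegative.\<close>

definition cost :: "(nat \<Rightarrow> nat) \<Rightarrow> real \<Rightarrow> nat \<Rightarrow> nat \<Rightarrow> real" where
  "cost ag N j i = real (penalty j i) * N - adj_val ag j i"

definition weight :: real where
  "weight = (\<Sum>j = 1..n. \<Sum>i = 1..m. \<bar>W i j\<bar>)"

text \<open>The sum over the whole column is taken because in the last column the value may belong
  to another item, \<open>ag i\<close>.\<close>

lemma adj_val_bound:
  assumes "best_later ag" "i \<in> {1..m}"
  shows "\<bar>adj_val ag j i\<bar> \<le> (\<Sum>i = 1..m. \<bar>W i j\<bar>)"
proof -
  have "\<bar>W i' j\<bar> \<le> (\<Sum>i = 1..m. \<bar>W i j\<bar>)" if "i' \<in> {1..m}" for i'
    using that by (intro member_le_sum) auto
  from this[of i] this[of "ag i"] show ?thesis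
    using best_laterD(1)[OF assms] assms(2) by (cases "j = n") (simp_all add: adj_val_def)
qed

lemma adj_val_weight:
  assumes "best_later ag" "i \<in> {1..m}" "j \<in> {1..n}"
  shows "\<bar>adj_val ag j i\<bar> \<le> weight"
proof -
  have "(\<Sum>i = 1..m. \<bar>W i j\<bar>) \<le> weight"
    unfolding weight_def using assms(3) by (intro member_le_sum[of j _ "\<lambda>j. \<Sum>i = 1..m. \<bar>W i j\<bar>"]) (auto intro: sum_nonneg)
  then show ?thesis using adj_val_bound[OF assms(1,2), of j] by simp
qed

lemma cost_nonneg:
  assumes "best_later ag" "i \<in> {1..m}" "j \<in> {1..n}" "weight \<le> N"
  shows "0 \<le> cost ag N j i"
proof -
  have "\<bar>adj_val ag j i\<bar> \<le> N" using adj_val_weight[OF assms(1-3)] assms(4) by simp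
  then show ?thesis by (auto simp: cost_def penalty_def)
qed

text \<open>A matching uses each position once, so the bounds by column sums add up to
  \<open>weight\<close>.\<close>

lemma assign_sum_adj_val_weight:
  assumes "best_later ag" "matching n m q"
  shows "\<bar>assign_sum (adj_val ag) m q\<bar> \<le> weight"
proof -
  let ?M = "{c. c \<in> {1..m} \<and> q c \<noteq> 0}"
  have "\<bar>assign_sum (adj_val ag) m q\<bar> \<le> (\<Sum>c\<in>?M. \<bar>adj_val ag (q c) c\<bar>)"
    unfolding assign_sum_def by (rule sum_abs)
  also have "\<dots> \<le> (\<Sum>c\<in>?M. \<Sum>i = 1..m. \<bar>W i (q c)\<bar>)"
    using adj_val_bound[OF assms(1)] by (intro sum_mono) auto
  also have "\<dots> = weight"
    unfolding weight_def by (rule sum.reindex_bij_betw[OF matching_bij[OF assms(2)]])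
  finally show ?thesis .
qed

text \<open>Relative to the base 2, a ranked item scores 1 if its position is forbidden, and
  otherwise -1 if it is mandatory and 0 if it is optional. Adding 1 for every mandatory item leaves
  a nonnegative score that is 0 iff the item meets its part of \<open>admissible\<close>.\<close>

definition excess :: "(nat \<Rightarrow> nat) \<Rightarrow> int" where
  "excess q = (\<Sum>i = 1..m.
     (if q i = 0 then 0 else int (penalty (q i) i) - 2) + (if mandatory i then 1 else 0))"

text \<open>Exactly \<open>n\<close> items are ranked, so the base 2 contributes the constant
  \<open>2 * n\<close>, and minimizing the penalties means minimizing \<open>excess\<close>.\<close>

lemma assign_sum_penalty:
  assumes q: "matching n m q"
  shows "assign_sum (\<lambda>j i. real (penalty j i)) m q
      = 2 * real n - real (card {i \<in> {1..m}. mandatory i}) + real_of_int (excess q)"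
    and "0 \<le> excess q" and "excess q = 0 \<longleftrightarrow> admissible q"
proof -
  define h where "h i = (if q i = 0 then 0 else int (penalty (q i) i) - 2) + (if mandatory i then 1 else 0)" for i
  have ex: "excess q = (\<Sum>i = 1..m. h i)" by (simp add: excess_def h_def)
  have h: "0 \<le> h i" "h i = 0 \<longleftrightarrow> (q i \<noteq> 0 \<longrightarrow> allowed i (q i)) \<and> (mandatory i \<longrightarrow> q i \<noteq> 0)" for i
    by (auto simp: h_def penalty_def)
  show "0 \<le> excess q" unfolding ex using h by (simp add: sum_nonneg)
  show "excess q = 0 \<longleftrightarrow> admissible q"
    unfolding admissible_def ex using h by (subst sum_nonneg_eq_0_iff) auto
  have "real_of_int (h i) = (if q i = 0 then 0 else real (penalty (q i) i)) -
      2 * (if q i = 0 then 0 else 1) + (if mandatory i then 1 else 0)" for i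
    by (simp add: h_def)
  then have "real_of_int (\<Sum>i = 1..m. h i) = assign_sum (\<lambda>j i. real (penalty j i)) m q -
      2 * (\<Sum>i = 1..m. if q i = 0 then 0 else 1) + (\<Sum>i = 1..m. if mandatory i then 1 else 0)"
    unfolding assign_sum_if by (simp add: sum.distrib sum_subtractf sum_distrib_left)
  moreover have "(\<Sum>i = 1..m. if q i = 0 then 0 else 1 :: real) = real n"
  proof -
    have "(\<Sum>i = 1..m. if q i = 0 then 0 else 1 :: real) = assign_sum (\<lambda>_ _. 1) m q"
      by (simp add: assign_sum_if)
    also have "\<dots> = real n"
      using bij_betw_same_card[OF matching_bij[OF q]] by (simp add: assign_sum_def)
    finally show ?thesis .
  qed
  moreover have "(\<Sum>i = 1..m. if mandatory i then 1 else 0 :: real) = real (card {i \<in> {1..m}. mandatory i})"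
    by (simp add: sum.inter_filter[symmetric])
  ultimately show "assign_sum (\<lambda>j i. real (penalty j i)) m q
      = 2 * real n - real (card {i \<in> {1..m}. mandatory i}) + real_of_int (excess q)"
    unfolding ex by simp
qed

lemma assign_sum_cost:
  "assign_sum (cost ag N) m q = N * assign_sum (\<lambda>j i. real (penalty j i)) m q - assign_sum (adj_val ag) m q"
  unfolding assign_sum_def cost_def by (simp add: sum_subtractf sum_distrib_left mult.commute)

text \<open>Against an admissible competitor, \<open>N\<close> times the excess is at most a
  difference of two adjusted values, hence at most \<open>2 * weight < N\<close>. An integer excess
  below 1 is 0, and what remains of the cost comparison is one of values.\<close>

lemma min_cost_admissible:
  assumes ag: "best_later ag" and N: "2 * weight < N"
    and q: "matching n m q"
    and opt: "\<And>q'. matching n m q' \<Longrightarrow> assign_sum (cost ag N) m q \<le> assign_sum (cost ag N) m q'"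
    and q': "matching n m q'" "admissible q'"
  shows "admissible q" "assign_sum (adj_val ag) m q' \<le> assign_sum (adj_val ag) m q"
proof -
  have H: "excess q' = 0" "0 \<le> excess q" "excess q = 0 \<longleftrightarrow> admissible q"
    using assign_sum_penalty(3)[OF q'(1)] q'(2) assign_sum_penalty(2,3)[OF q] by blast+
  have le: "N * real_of_int (excess q) - assign_sum (adj_val ag) m q \<le> - assign_sum (adj_val ag) m q'"
    using opt[OF q'(1)] H(1)
    unfolding assign_sum_cost assign_sum_penalty(1)[OF q] assign_sum_penalty(1)[OF q'(1)]
    by (simp add: algebra_simps)
  have "N * real_of_int (excess q) < N"
    using le assign_sum_adj_val_weight[OF ag q] assign_sum_adj_val_weight[OF ag q'(1)] N by linarith
  moreover have "0 < N"
    using N assign_sum_adj_val_weight[OF ag q] by linarith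
  ultimately have "real_of_int (excess q) < 1" by simp
  with H(2) have H0: "excess q = 0" by linarith
  then show "admissible q" using H(3) by simp
  show "assign_sum (adj_val ag) m q' \<le> assign_sum (adj_val ag) m q"
    using le H0 by simp
qed

text \<open>The adjusted value pays \<open>c\<close> at position \<open>n\<close> as if
  \<open>ag c\<close> stood there, and the exchange makes this real. Item \<open>c\<close> moves to
  the former position of \<open>ag c\<close>, where it is worth at least as much since
  \<open>c \<le> ag c\<close>; if \<open>ag c\<close> was unranked, \<open>c\<close> leaves the
  ranking.\<close>

lemma swap_last:
  assumes ag: "best_later ag" and q: "matching n m q" and c: "c \<in> {1..m}" "q c = n"
  defines "q2 \<equiv> q(c := q (ag c), ag c := q c)"
  shows "matching n m q2" "count q2 l k = count q l k" "assign_sum (adj_val ag) m q \<le> total_value q2"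
proof -
  note b = best_laterD(1-3)[OF ag c(1)]
  show "matching n m q2" unfolding q2_def by (rule matching_swap[OF q c(1) b(1)])
  show "count q2 l k = count q l k" unfolding q2_def by (rule count_swap[OF c(1) b(1) b(3)[symmetric]])
  have u: "i = c" if "i \<in> {1..m}" "q i = n" for i
  proof -
    have "\<exists>!c. c \<in> {1..m} \<and> q c = n" using q sizes unfolding matching_def by auto
    with that c show ?thesis by blast
  qed
  let ?f = "\<lambda>i. if q i = 0 then 0 else if i = c then W (ag c) n else W i (q i)"
  have 1: "assign_sum (adj_val ag) m q = (\<Sum>i = 1..m. ?f i)"
    unfolding assign_sum_if
  proof (rule sum.cong[OF refl])
    fix i assume "i \<in> {1..m}"
    then show "(if q i = 0 then 0 else adj_val ag (q i) i) = ?f i"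
      using u[of i] c(2) by (cases "i = c") (auto simp: adj_val_def)
  qed
  let ?g = "\<lambda>i. if q2 i = 0 then 0 else W i (q2 i)"
  have 2: "total_value q2 = (\<Sum>i = 1..m. ?g i)"
    unfolding total_value_def assign_sum_if ..
  show "assign_sum (adj_val ag) m q \<le> total_value q2"
  proof (cases "ag c = c")
    case True
    then show ?thesis unfolding 1 2 using c by (intro sum_mono) (auto simp: q2_def)
  next
    case False
    then obtain R where R: "(\<Sum>i = 1..m. ?f i) = ?f c + ?f (ag c) + R" "(\<Sum>i = 1..m. ?g i) = ?g c + ?g (ag c) + R"
      using c by - (rule sum_swap_two[OF c(1) b(1), of ?g ?f], auto simp: q2_def)
    have "q (ag c) \<le> n" using q b unfolding matching_def by blast
    moreover have "q (ag c) \<noteq> n" using u[OF b(1)] False by blast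
    \<comment> \<open>Position \<open>n\<close> belongs to \<open>c\<close> alone, so
      \<open>ag c\<close> stood in a column where monotonicity is available.\<close>
    ultimately have "W (ag c) (q (ag c)) \<le> W c (q (ag c))" if "q (ag c) \<noteq> 0"
      using W_antimono[of c "ag c" "q (ag c)"] b c that by auto
    then show ?thesis unfolding 1 2 R using False c sizes by (auto simp: q2_def)
  qed
qed

text \<open>A chain of estimates: a feasible ranking is worth at most its adjusted value, sorting
  does not lower that, the optimality of \<open>q\<close> bounds it by the adjusted value of
  \<open>q\<close>, and the last exchange bounds this by the value of \<open>q2\<close>. Feasibility
  travels along the same chain.\<close>

lemma assignment_optimal:
  assumes ag: "best_later ag" and N: "2 * weight < N"
    and q: "matching n m q"
    and opt: "\<And>q'. matching n m q' \<Longrightarrow> assign_sum (cost ag N) m q \<le> assign_sum (cost ag N) m q'"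
    and c: "c \<in> {1..m}" "q c = n" and q2: "q2 = q(c := q (ag c), ag c := q c)"
    and x: "\<And>i j. i \<in> {1..m} \<Longrightarrow> j \<in> {1..n} \<Longrightarrow> x i j = (if q2 i = j then 1 else 0)"
  shows "(\<exists>y. lu_feasible I y) \<longleftrightarrow> count_ok q2" "count_ok q2 \<Longrightarrow> lu_optimal I x"
proof -
  note q2f = swap_last[OF ag q c, folded q2]
  note xf = ranking_of_matching[OF q2f(1) x]
  have main: "count_ok q2 \<and> ranking_value I y \<le> ranking_value I x" if y: "lu_feasible I y" for y
  proof -
    obtain q0 where q0: "matching n m q0" "count_ok q0" "ranking_value I y = total_value q0"
      using matching_of_ranking[OF y] by blast
    obtain q' where q': "matching n m q'" "class_sorted q'" "\<forall>l k. count q' l k = count q0 l k"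
      "assign_sum (adj_val ag) m q0 \<le> assign_sum (adj_val ag) m q'"
      using ex_class_sorted[OF ag q0(1)] by blast
    have "count_ok q'" using q0(2) q'(3) by (simp add: count_ok_def)
    then have adm': "admissible q'" using class_sorted_admissible q' by blast
    note adm = min_cost_admissible[OF ag N q opt q'(1) adm']
    have "count_ok q"
    \<comment> \<open>The feasible \<open>y\<close> itself shows that no lower bound exceeds the
      size of its class.\<close>
    proof (rule admissible_count_ok[OF q adm(1)])
      fix k l assume "k \<in> {1..n}" "l \<in> {1..p}"
      then show "lower I k l \<le> card (P l)"
        using q0(2) count_le_card_P[of l q0 k] unfolding count_ok_def by (meson order_trans)
    qed
    then have "count_ok q2" using q2f(2) by (simp add: count_ok_def)
    \<comment> \<open>Item \<open>i\<close> is a candidate for \<open>ag i\<close>, so adjusted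
      values dominate \<open>W\<close>.\<close>
    moreover have "total_value q0 \<le> assign_sum (adj_val ag) m q0"
      unfolding total_value_def assign_sum_def
    proof (rule sum_mono)
      fix i assume "i \<in> {c \<in> {1..m}. q0 c \<noteq> 0}"
      then have "i \<in> {1..m}" by simp
      then show "W i (q0 i) \<le> adj_val ag (q0 i) i"
        using best_laterD(4,5)[OF ag, of i] by (cases "cls i = 0") (auto simp: adj_val_def)
    qed
    ultimately show ?thesis
      using q'(4) adm(2) q2f(3) xf(2) q0(3) by simp
  qed
  then show "(\<exists>y. lu_feasible I y) \<longleftrightarrow> count_ok q2" using xf(1) by blast
  show "lu_optimal I x" if "count_ok q2"
    unfolding lu_optimal_def using main xf(1) that by blast
qed

end

section \<open>The Hungarian method as a program\<close>

abbreviation IsZero :: "nexp \<Rightarrow> bexp" where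
  "IsZero e \<equiv> NLess e (NConst 1)"

abbreviation NonZero :: "nexp \<Rightarrow> bexp" where
  "NonZero e \<equiv> NLess (NConst 0) e"

abbreviation At :: "vname \<Rightarrow> vname \<Rightarrow> nexp" where
  "At a x \<equiv> NGet a (Var x)"

abbreviation RAt :: "vname \<Rightarrow> vname \<Rightarrow> rexp" where
  "RAt a x \<equiv> RGet a (Var x)"

section \<open>The scans of a phase\<close>

definition init_columns :: com where
  "init_columns = For ''j'' ''m''
     (Seq (RSet ''mv'' (Var ''j'') (RSub (RGet ''D'' (NAdd (At ''a'' ''j'') (Var ''i''))) (RAt ''v'' ''j'')))
     (Seq (NSet ''us'' (Var ''j'') (NConst 0)) (NSet ''wy'' (Var ''j'') (NConst 0))))"

text \<open>The reduced cost has no term \<open>u\<close> because row \<open>i\<close> enters with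
  potential 0.\<close>

lemma run_init_columns:
  assumes "nmem s ''m'' 0 = m"
  shows "run init_columns s (11 + m * (50 + 14)) (\<lambda>s'. \<forall>c\<in>{1..m}. nmem s' ''us'' c = 0 \<and> nmem s' ''wy'' c = 0 \<and>
     rmem s' ''mv'' c = rmem s ''D'' (nmem s ''a'' c + nmem s ''i'' 0) - rmem s ''v'' c)"
proof -
  let ?Inv = "\<lambda>k s'. \<forall>c\<in>{1..<k}. nmem s' ''us'' c = 0 \<and> nmem s' ''wy'' c = 0 \<and>
     rmem s' ''mv'' c = rmem s ''D'' (nmem s ''a'' c + nmem s ''i'' 0) - rmem s ''v'' c"
  have "run init_columns s (11 + m * (50 + 14)) (?Inv (Suc m))"
    unfolding init_columns_def
    by (rule run_For_body[OF assms]) (auto simp: agree_nmem agree_rmem less_Suc_eq)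
  then show ?thesis by (simp add: atLeastLessThanSuc_atLeastAtMost)
qed

definition init_rows :: com where
  "init_rows = For ''r'' ''n'' (NSet ''ru'' (Var ''r'') (NConst 0))"

lemma run_init_rows:
  assumes "nmem s ''n'' 0 = n"
  shows "run init_rows s (11 + n * (50 + 14))
    (\<lambda>s'. nmem s' ''ru'' = (\<lambda>r. if r \<in> {1..n} then 0 else nmem s ''ru'' r))"
proof -
  let ?Inv = "\<lambda>k s'. nmem s' ''ru'' = (\<lambda>r. if r \<in> {1..<k} then 0 else nmem s ''ru'' r)"
  have "run init_rows s (11 + n * (50 + 14)) (?Inv (Suc n))"
    unfolding init_rows_def
    by (rule run_For_body[OF assms]) (auto simp: fun_eq_iff less_Suc_eq)
  then show ?thesis by (simp add: atLeastLessThanSuc_atLeastAtMost)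
qed

definition select_column :: com where
  "select_column = Seq (NSet ''s'' (NConst 0) (NConst 0)) (For ''j'' ''m''
     (Cond (BAnd (IsZero (At ''us'' ''j''))
              (BNot (BAnd (NonZero (Var ''s'')) (BNot (RLess (RAt ''mv'' ''j'') (RAt ''mv'' ''s''))))))
        (NSet ''s'' (NConst 0) (Var ''j'')) Skip))"

lemma run_select_column:
  assumes "nmem s ''m'' 0 = m" and "\<exists>c\<in>{1..m}. nmem s ''us'' c = 0"
  shows "run select_column s (14 + m * (50 + 14)) (\<lambda>s'. nmem s' ''s'' 0 \<in> {1..m} \<and> nmem s ''us'' (nmem s' ''s'' 0) = 0 \<and>
     (\<forall>c\<in>{1..m}. nmem s ''us'' c = 0 \<longrightarrow> rmem s ''mv'' (nmem s' ''s'' 0) \<le> rmem s ''mv'' c))"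
proof -
  \<comment> \<open>Columns are numbered from 1, so 0 in \<open>''s''\<close> can mean that no
    column has been found yet.\<close>
  let ?Inv = "\<lambda>k s'. (nmem s' ''s'' 0 = 0 \<and> (\<forall>c\<in>{1..<k}. nmem s ''us'' c \<noteq> 0)) \<or>
     (nmem s' ''s'' 0 \<in> {1..<k} \<and> nmem s ''us'' (nmem s' ''s'' 0) = 0 \<and>
     (\<forall>c\<in>{1..<k}. nmem s ''us'' c = 0 \<longrightarrow> rmem s ''mv'' (nmem s' ''s'' 0) \<le> rmem s ''mv'' c))"
  have "run select_column s (3 + (11 + m * (50 + 14))) (?Inv (Suc m))"
    unfolding select_column_def
  proof (rule run_Seq)
    show "run (NSet ''s'' (NConst 0) (NConst 0)) s 3 (\<lambda>s'. s' = nupd ''s'' 0 0 s)"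
      by (rule run_loop_free) auto
  next
    fix s1 assume s1: "s1 = nupd ''s'' 0 0 s"
    show "run (For ''j'' ''m''
     (Cond (BAnd (IsZero (At ''us'' ''j''))
              (BNot (BAnd (NonZero (Var ''s'')) (BNot (RLess (RAt ''mv'' ''j'') (RAt ''mv'' ''s''))))))
        (NSet ''s'' (NConst 0) (Var ''j'')) Skip)) s1 (11 + m * (50 + 14)) (?Inv (Suc m))"
    proof (rule run_For_body)
      fix k s'
      assume k: "1 \<le> k" "nmem s' ''j'' 0 = k" and ag: "agree (For ''j'' ''m''
     (Cond (BAnd (IsZero (At ''us'' ''j''))
              (BNot (BAnd (NonZero (Var ''s'')) (BNot (RLess (RAt ''mv'' ''j'') (RAt ''mv'' ''s''))))))
        (NSet ''s'' (NConst 0) (Var ''j'')) Skip)) s1 s'" and Inv: "?Inv k s'"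
      have "nmem s' ''us'' = nmem s ''us''" "rmem s' ''mv'' = rmem s ''mv''"
        using agree_nmem[OF ag, of "''us''"] agree_rmem[OF ag, of "''mv''"] s1 by simp_all
      with k Inv show "?Inv (Suc k) (nupd ''j'' 0 (Suc k) (result (Cond (BAnd (IsZero (At ''us'' ''j''))
              (BNot (BAnd (NonZero (Var ''s'')) (BNot (RLess (RAt ''mv'' ''j'') (RAt ''mv'' ''s''))))))
        (NSet ''s'' (NConst 0) (Var ''j'')) Skip) s'))"
        by (force simp: less_Suc_eq)
    qed (use assms s1 in auto)
  qed
  then show ?thesis
    by (rule run_mono) (use assms(2) in \<open>auto simp: atLeastLessThanSuc_atLeastAtMost\<close>)
qed

definition update_rows :: com where
  "update_rows = For ''r'' ''n'' (Cond (NonZero (At ''ru'' ''r''))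
     (RSet ''u'' (Var ''r'') (RAdd (RAt ''u'' ''r'') (RVar ''de''))) Skip)"

lemma run_update_rows:
  assumes "nmem s ''n'' 0 = n"
  shows "run update_rows s (11 + n * (50 + 14)) (\<lambda>s'. rmem s' ''u'' =
     (\<lambda>r. if r \<in> {1..n} \<and> nmem s ''ru'' r \<noteq> 0 then rmem s ''u'' r + rmem s ''de'' 0 else rmem s ''u'' r))"
proof -
  let ?Inv = "\<lambda>k s'. rmem s' ''u'' =
     (\<lambda>r. if r \<in> {1..<k} \<and> nmem s ''ru'' r \<noteq> 0 then rmem s ''u'' r + rmem s ''de'' 0 else rmem s ''u'' r)"
  have "run update_rows s (11 + n * (50 + 14)) (?Inv (Suc n))"
    unfolding update_rows_def
    by (rule run_For_body[OF assms]) (auto simp: fun_eq_iff less_Suc_eq agree_nmem agree_rmem)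
  then show ?thesis by (simp add: atLeastLessThanSuc_atLeastAtMost)
qed

definition update_columns :: com where
  "update_columns = For ''j'' ''m'' (Cond (NonZero (At ''us'' ''j''))
     (RSet ''v'' (Var ''j'') (RSub (RAt ''v'' ''j'') (RVar ''de'')))
     (RSet ''mv'' (Var ''j'') (RSub (RAt ''mv'' ''j'') (RVar ''de''))))"

lemma run_update_columns:
  assumes "nmem s ''m'' 0 = m"
  shows "run update_columns s (11 + m * (50 + 14)) (\<lambda>s'.
     rmem s' ''v'' = (\<lambda>c. if c \<in> {1..m} \<and> nmem s ''us'' c \<noteq> 0 then rmem s ''v'' c - rmem s ''de'' 0 else rmem s ''v'' c) \<and>
     rmem s' ''mv'' = (\<lambda>c. if c \<in> {1..m} \<and> nmem s ''us'' c = 0 then rmem s ''mv'' c - rmem s ''de'' 0 else rmem s ''mv'' c))"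
proof -
  let ?Inv = "\<lambda>k s'.
     rmem s' ''v'' = (\<lambda>c. if c \<in> {1..<k} \<and> nmem s ''us'' c \<noteq> 0 then rmem s ''v'' c - rmem s ''de'' 0 else rmem s ''v'' c) \<and>
     rmem s' ''mv'' = (\<lambda>c. if c \<in> {1..<k} \<and> nmem s ''us'' c = 0 then rmem s ''mv'' c - rmem s ''de'' 0 else rmem s ''mv'' c)"
  have "run update_columns s (11 + m * (50 + 14)) (?Inv (Suc m))"
    unfolding update_columns_def
    by (rule run_For_body[OF assms]) (auto simp: fun_eq_iff less_Suc_eq agree_nmem agree_rmem)
  then show ?thesis by (simp add: atLeastLessThanSuc_atLeastAtMost)
qed

definition relax_columns :: com where
  "relax_columns = For ''j'' ''m'' (Cond (IsZero (At ''us'' ''j''))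
     (Seq (RSet ''t'' (NConst 0) (RSub (RSub (RGet ''D'' (NAdd (At ''a'' ''j'') (Var ''h''))) (RAt ''u'' ''h'')) (RAt ''v'' ''j'')))
        (Cond (RLess (RVar ''t'') (RAt ''mv'' ''j''))
           (Seq (RSet ''mv'' (Var ''j'') (RVar ''t'')) (NSet ''wy'' (Var ''j'') (Var ''s''))) Skip)) Skip)"

lemma run_relax_columns:
  fixes s :: store
  assumes "nmem s ''m'' 0 = m"
  defines "t \<equiv> \<lambda>c. rmem s ''D'' (nmem s ''a'' c + nmem s ''h'' 0) - rmem s ''u'' (nmem s ''h'' 0) - rmem s ''v'' c"
  shows "run relax_columns s (11 + m * (100 + 14)) (\<lambda>s'.
     rmem s' ''mv'' = (\<lambda>c. if c \<in> {1..m} \<and> nmem s ''us'' c = 0 \<and> t c < rmem s ''mv'' c then t c else rmem s ''mv'' c) \<and>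
     nmem s' ''wy'' = (\<lambda>c. if c \<in> {1..m} \<and> nmem s ''us'' c = 0 \<and> t c < rmem s ''mv'' c then nmem s ''s'' 0 else nmem s ''wy'' c))"
proof -
  let ?Inv = "\<lambda>k s'.
     rmem s' ''mv'' = (\<lambda>c. if c \<in> {1..<k} \<and> nmem s ''us'' c = 0 \<and> t c < rmem s ''mv'' c then t c else rmem s ''mv'' c) \<and>
     nmem s' ''wy'' = (\<lambda>c. if c \<in> {1..<k} \<and> nmem s ''us'' c = 0 \<and> t c < rmem s ''mv'' c then nmem s ''s'' 0 else nmem s ''wy'' c)"
  have "run relax_columns s (11 + m * (100 + 14)) (?Inv (Suc m))"
    unfolding relax_columns_def
  proof (rule run_For_body[OF assms(1)], goal_cases)
    case (7 k s')
    then have f: "nmem s' ''us'' = nmem s ''us''" "nmem s' ''a'' = nmem s ''a''" "nmem s' ''h'' = nmem s ''h''"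
        "nmem s' ''s'' = nmem s ''s''" "rmem s' ''D'' = rmem s ''D''" "rmem s' ''u'' = rmem s ''u''" "rmem s' ''v'' = rmem s ''v''"
      by (simp_all add: agree_nmem agree_rmem)
    show ?case
      using 7(1,3,5) f by (cases "nmem s ''us'' k = 0"; cases "t k < rmem s ''mv'' k")
        (simp_all add: t_def fun_eq_iff less_Suc_eq)
  qed simp_all
  then show ?thesis by (simp add: atLeastLessThanSuc_atLeastAtMost)
qed

text \<open>The length of the tree path is unknown, but \<open>n\<close> rounds suffice; once the
  hole is at column 0, the remaining rounds do nothing.\<close>

definition augment :: com where
  "augment = For ''k'' ''n'' (Cond (NonZero (Var ''s''))
     (Seq (NSet ''q'' (Var ''s'') (NGet ''q'' (At ''wy'' ''s''))) (NSet ''s'' (NConst 0) (At ''wy'' ''s''))) Skip)"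

lemma run_augment:
  assumes "nmem s ''n'' 0 = n"
    and "augment_inv A m i (nmem s ''s'' 0) u v (nmem s ''q'') (nmem s ''us'') (nmem s ''wy'')"
    and "nmem s ''us'' (nmem s ''s'' 0) \<le> n + 1"
  shows "run augment s (11 + n * (50 + 14)) (\<lambda>s'. dual_inv A m i u v (nmem s' ''q''))"
proof -
  \<comment> \<open>The stamp of the hole is at most \<open>n + 1\<close> initially and falls in
    each round. After \<open>n\<close> rounds a hole outside the root would have a stamp of at most
    1, which only the root has.\<close>
  let ?Inv = "\<lambda>k s'. augment_inv A m i (nmem s' ''s'' 0) u v (nmem s' ''q'') (nmem s ''us'') (nmem s ''wy'') \<and>
    (nmem s' ''s'' 0 = 0 \<or> nmem s ''us'' (nmem s' ''s'' 0) + k \<le> n + 2)"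
  have "run augment s (11 + n * (50 + 14)) (?Inv (Suc n))"
    unfolding augment_def
  proof (rule run_For_body[OF assms(1)])
    fix k s'
    let ?c = "Cond (NonZero (Var ''s''))
     (Seq (NSet ''q'' (Var ''s'') (NGet ''q'' (At ''wy'' ''s''))) (NSet ''s'' (NConst 0) (At ''wy'' ''s''))) Skip"
    assume ag: "agree (For ''k'' ''n'' ?c) s s'" and Inv: "?Inv k s'"
    have wy: "nmem s' ''wy'' = nmem s ''wy''"
      using agree_nmem[OF ag, of "''wy''"] by simp
    show "?Inv (Suc k) (nupd ''k'' 0 (Suc k) (result ?c s'))"
      using augment_inv_step[of A m i "nmem s' ''s'' 0" u v "nmem s' ''q''" "nmem s ''us''" "nmem s ''wy''"] Inv wy
      by (cases "nmem s' ''s'' 0 = 0") auto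
  qed (use assms in auto)
  then show ?thesis
  proof (rule run_mono)
    fix s' assume Inv: "?Inv (Suc n) s'"
    then have "nmem s' ''s'' 0 = 0" using augment_inv_stamp by fastforce
    with Inv show "dual_inv A m i u v (nmem s' ''q'')" using augment_inv_dual_inv by metis
  qed simp
qed

lemma writes_Hungarian [simp]:
  "nwrites init_columns = {''j'', ''us'', ''wy''}" "rwrites init_columns = {''mv''}"
  "nwrites init_rows = {''r'', ''ru''}" "rwrites init_rows = {}"
  "nwrites select_column = {''j'', ''s''}" "rwrites select_column = {}"
  "nwrites update_rows = {''r''}" "rwrites update_rows = {''u''}"
  "nwrites update_columns = {''j''}" "rwrites update_columns = {''v'', ''mv''}"
  "nwrites relax_columns = {''j'', ''wy''}" "rwrites relax_columns = {''t'', ''mv''}"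
  "nwrites augment = {''k'', ''q'', ''s''}" "rwrites augment = {}"
  by (auto simp: init_columns_def init_rows_def select_column_def update_rows_def update_columns_def
      relax_columns_def augment_def)

text \<open>One round of a phase: \<open>''s''\<close> is the column that enters the tree,
  \<open>''de''\<close> the dual adjustment, \<open>''h''\<close> the row matched to
  \<open>''s''\<close>, and \<open>''dn''\<close> records that a free column has been
  reached.\<close>

definition grow :: com where
  "grow = Seq select_column (Seq (RSet ''de'' (NConst 0) (RAt ''mv'' ''s'')) (Seq update_rows (Seq update_columns
     (Seq (NSet ''us'' (Var ''s'') (NAdd (Var ''k'') (NConst 1)))
        (Cond (IsZero (At ''q'' ''s'')) (NSet ''dn'' (NConst 0) (NConst 1))
           (Seq (Seq (NSet ''h'' (NConst 0) (At ''q'' ''s'')) (NSet ''ru'' (Var ''h'') (NConst 1))) relax_columns))))))"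

abbreviation tree_state :: "(nat \<Rightarrow> nat \<Rightarrow> real) \<Rightarrow> nat \<Rightarrow> nat \<Rightarrow> nat \<Rightarrow> store \<Rightarrow> bool" where
  "tree_state A m i k s \<equiv> tree_inv A m i k (rmem s ''u'') (rmem s ''v'') (nmem s ''q'') (nmem s ''us'')
     (nmem s ''wy'') (rmem s ''mv'') (nmem s ''ru'')"

abbreviation augment_state :: "(nat \<Rightarrow> nat \<Rightarrow> real) \<Rightarrow> nat \<Rightarrow> nat \<Rightarrow> store \<Rightarrow> bool" where
  "augment_state A m i s \<equiv> augment_inv A m i (nmem s ''s'' 0) (rmem s ''u'') (rmem s ''v'') (nmem s ''q'')
     (nmem s ''us'') (nmem s ''wy'')"

text \<open>A column of the assignment problem is an item, hence a row of \<open>W\<close>; its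
  costs are stored contiguously after the offset \<open>a c\<close>.\<close>

definition cost_state :: "(nat \<Rightarrow> nat \<Rightarrow> real) \<Rightarrow> nat \<Rightarrow> nat \<Rightarrow> store \<Rightarrow> bool" where
  "cost_state A m n s \<longleftrightarrow> nmem s ''m'' 0 = m \<and> nmem s ''n'' 0 = n \<and> 1 \<le> n \<and> n \<le> m \<and>
     (\<forall>c\<in>{1..m}. \<forall>r\<in>{1..n}. 0 \<le> A r c \<and> rmem s ''D'' (nmem s ''a'' c + r) = A r c)"

lemma cost_state_agree:
  assumes "cost_state A m n s" "agree c s s'" "{''m'', ''n'', ''a''} \<inter> nwrites c = {}" "''D'' \<notin> rwrites c"
  shows "cost_state A m n s'"
  using assms by (auto simp: cost_state_def agree_nmem agree_rmem)

text \<open>A round is a fixed number of scans over \<open>m\<close> columns or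
  \<open>n \<le> m\<close> rows, and \<open>1 \<le> m\<close> absorbs the additive constants. The
  entries of \<open>''ru''\<close> beyond \<open>n\<close> are tracked because
  \<open>tree_inv\<close> speaks of all rows above \<open>i\<close>, whereas
  \<open>init_rows\<close> clears only \<open>1..n\<close>.\<close>

lemma run_grow:
  assumes C: "cost_state A m n s" and k: "nmem s ''k'' 0 = k" "k \<le> n" and i: "i \<le> n"
    and dn: "nmem s ''dn'' 0 = 0" and T: "tree_state A m i k s"
  shows "run grow s (500 * m) (\<lambda>s'. (\<forall>r>n. nmem s' ''ru'' r = nmem s ''ru'' r) \<and>
     ((nmem s' ''dn'' 0 = 0 \<and> tree_state A m i (Suc k) s') \<or>
      (nmem s' ''dn'' 0 \<noteq> 0 \<and> augment_state A m i s' \<and> nmem s' ''us'' (nmem s' ''s'' 0) \<le> n + 1)))"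
proof -
  have mn: "nmem s ''m'' 0 = m" "nmem s ''n'' 0 = n" "1 \<le> n" "n \<le> m" using C by (auto simp: cost_state_def)
  obtain t1 s1 where e1: "exec select_column s t1 s1" "t1 \<le> 14 + m * (50 + 14)"
    and sel: "nmem s1 ''s'' 0 \<in> {1..m} \<and> nmem s ''us'' (nmem s1 ''s'' 0) = 0 \<and>
      (\<forall>c\<in>{1..m}. nmem s ''us'' c = 0 \<longrightarrow> rmem s ''mv'' (nmem s1 ''s'' 0) \<le> rmem s ''mv'' c)"
    and a1: "agree select_column s s1"
    by (rule runE[OF run_select_column[OF mn(1) tree_inv_unused(2)[OF T]]])
  define j where "j = nmem s1 ''s'' 0"
  have j: "j \<in> {1..m}" "nmem s ''us'' j = 0"
      "\<And>c. c \<in> {1..m} \<Longrightarrow> nmem s ''us'' c = 0 \<Longrightarrow> rmem s ''mv'' j \<le> rmem s ''mv'' c"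
    using sel unfolding j_def by blast+
  define s2 where "s2 = rupd ''de'' 0 (rmem s1 ''mv'' j) s1"
  have e2: "exec (RSet ''de'' (NConst 0) (RAt ''mv'' ''s'')) s1 5 s2"
    using exec.RSet[of "''de''" "NConst 0" "RAt ''mv'' ''s''" s1] by (simp add: s2_def j_def numeral_eq_Suc)
  have n2: "nmem s2 ''n'' 0 = n" using agree_nmem[OF a1] mn by (simp add: s2_def)
  obtain t3 s3 where e3: "exec update_rows s2 t3 s3" "t3 \<le> 11 + n * (50 + 14)"
    and u3: "rmem s3 ''u'' = (\<lambda>r. if r \<in> {1..n} \<and> nmem s2 ''ru'' r \<noteq> 0 then rmem s2 ''u'' r + rmem s2 ''de'' 0 else rmem s2 ''u'' r)"
    and a3: "agree update_rows s2 s3"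
    by (rule runE[OF run_update_rows[OF n2]])
  have m3: "nmem s3 ''m'' 0 = m" using agree_nmem[OF a1] agree_nmem[OF a3] mn by (simp add: s2_def)
  obtain t4 s4 where e4: "exec update_columns s3 t4 s4" "t4 \<le> 11 + m * (50 + 14)"
    and v4: "rmem s4 ''v'' = (\<lambda>c. if c \<in> {1..m} \<and> nmem s3 ''us'' c \<noteq> 0 then rmem s3 ''v'' c - rmem s3 ''de'' 0 else rmem s3 ''v'' c)"
      "rmem s4 ''mv'' = (\<lambda>c. if c \<in> {1..m} \<and> nmem s3 ''us'' c = 0 then rmem s3 ''mv'' c - rmem s3 ''de'' 0 else rmem s3 ''mv'' c)"
    and a4: "agree update_columns s3 s4"
    by (rule runE[OF run_update_columns[OF m3]]) (erule conjE)
  note fr = agree_nmem[OF a1] agree_rmem[OF a1] agree_nmem[OF a3] agree_rmem[OF a3] agree_nmem[OF a4] agree_rmem[OF a4]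
  have de: "rmem s2 ''de'' 0 = rmem s ''mv'' j" "rmem s3 ''de'' 0 = rmem s ''mv'' j"
    by (simp_all add: fr s2_def)
  have f4: "nmem s4 ''q'' = nmem s ''q''" "nmem s4 ''us'' = nmem s ''us''" "nmem s4 ''wy'' = nmem s ''wy''"
    "nmem s4 ''ru'' = nmem s ''ru''" "nmem s4 ''dn'' = nmem s ''dn''" "nmem s4 ''k'' = nmem s ''k''"
    "nmem s4 ''s'' 0 = j" "nmem s4 ''m'' 0 = m" "nmem s4 ''a'' = nmem s ''a''" "rmem s4 ''D'' = rmem s ''D''"
    by (simp_all add: fr s2_def j_def mn)
  have "tree_inv A m i k (rmem s4 ''u'') (rmem s4 ''v'') (nmem s ''q'') (nmem s ''us'')
     (nmem s ''wy'') (rmem s4 ''mv'') (nmem s ''ru'') \<and> rmem s4 ''mv'' j = 0"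
  proof (rule tree_inv_dual_step[OF T j])
    fix r :: nat assume "1 \<le> r"
    \<comment> \<open>The program adjusts rows up to \<open>n\<close> only; beyond that no row is
      marked, so no adjustment is due.\<close>
    moreover have "nmem s ''ru'' r = 0" if "\<not> r \<le> n"
      using tree_invD(15)[OF T, of r] i that by simp
    ultimately show "rmem s4 ''u'' r = (if nmem s ''ru'' r \<noteq> 0 then rmem s ''u'' r + rmem s ''mv'' j else rmem s ''u'' r)"
      using de by (auto simp: fr u3 s2_def)
  next
    fix c assume c: "c \<in> {1..m}"
    then show "rmem s4 ''v'' c = (if nmem s ''us'' c \<noteq> 0 then rmem s ''v'' c - rmem s ''mv'' j else rmem s ''v'' c)"
      using de by (simp add: v4 fr s2_def)
    show "rmem s4 ''mv'' c = rmem s ''mv'' c - rmem s ''mv'' j" if "nmem s ''us'' c = 0"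
      using de that c by (simp add: v4 fr s2_def)
  qed
  then have T4: "tree_inv A m i k (rmem s4 ''u'') (rmem s4 ''v'') (nmem s ''q'') (nmem s ''us'')
     (nmem s ''wy'') (rmem s4 ''mv'') (nmem s ''ru'')" and mvj: "rmem s4 ''mv'' j = 0" by blast+
  define s5 where "s5 = nupd ''us'' j (Suc k) s4"
  have e5: "exec (NSet ''us'' (Var ''s'') (NAdd (Var ''k'') (NConst 1))) s4 7 s5"
    using exec.NSet[of "''us''" "Var ''s''" "NAdd (Var ''k'') (NConst 1)" s4] by (simp add: s5_def f4 k numeral_eq_Suc)
  let ?Q = "\<lambda>s'. (\<forall>r>n. nmem s' ''ru'' r = nmem s ''ru'' r) \<and>
     ((nmem s' ''dn'' 0 = 0 \<and> tree_state A m i (Suc k) s') \<or>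
      (nmem s' ''dn'' 0 \<noteq> 0 \<and> augment_state A m i s' \<and> nmem s' ''us'' (nmem s' ''s'' 0) \<le> n + 1))"
  have "\<exists>t6 s6. exec (Cond (IsZero (At ''q'' ''s'')) (NSet ''dn'' (NConst 0) (NConst 1))
           (Seq (Seq (NSet ''h'' (NConst 0) (At ''q'' ''s'')) (NSet ''ru'' (Var ''h'') (NConst 1))) relax_columns)) s5 t6 s6
      \<and> t6 \<le> 40 + m * (100 + 14) \<and> ?Q s6"
  proof (cases "nmem s ''q'' j = 0")
    case True
    let ?s = "nupd ''dn'' 0 1 s5"
    have "exec (NSet ''dn'' (NConst 0) (NConst 1)) s5 3 ?s"
      using exec.NSet[of "''dn''" "NConst 0" "NConst 1" s5] by (simp add: numeral_eq_Suc)
    then have "exec (Cond (IsZero (At ''q'' ''s'')) (NSet ''dn'' (NConst 0) (NConst 1))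
           (Seq (Seq (NSet ''h'' (NConst 0) (At ''q'' ''s'')) (NSet ''ru'' (Var ''h'') (NConst 1))) relax_columns)) s5
         (1 + bcost (IsZero (At ''q'' ''s'')) + 3) ?s"
      using True by (intro exec.CondTrue) (simp_all add: s5_def f4)
    moreover have "augment_inv A m i j (rmem s4 ''u'') (rmem s4 ''v'') (nmem s ''q'')
      ((nmem s ''us'')(j := Suc k)) (nmem s ''wy'')"
      by (rule augment_inv_init[OF T4 j(1,2) mvj True])
    then have "?Q ?s" using k by (simp add: s5_def f4)
    ultimately show ?thesis by fastforce
  next
    case False
    let ?c = "Seq (NSet ''h'' (NConst 0) (At ''q'' ''s'')) (NSet ''ru'' (Var ''h'') (NConst 1))"
    define s6 where "s6 = nupd ''ru'' (nmem s ''q'' j) 1 (nupd ''h'' 0 (nmem s ''q'' j) s5)"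
    have "result ?c s5 = s6" by (simp add: s6_def s5_def f4)
    then have "run ?c s5 9 (\<lambda>s'. s' = s6)" by (intro run_loop_free) auto
    then obtain t6 where e6: "exec ?c s5 t6 s6" "t6 \<le> 9" unfolding run_def by blast
    have m6: "nmem s6 ''m'' 0 = m" by (simp add: s6_def s5_def f4)
    define tt where "tt c = rmem s6 ''D'' (nmem s6 ''a'' c + nmem s6 ''h'' 0) - rmem s6 ''u'' (nmem s6 ''h'' 0) - rmem s6 ''v'' c" for c
    obtain t7 s7 where e7: "exec relax_columns s6 t7 s7" "t7 \<le> 11 + m * (100 + 14)"
      and r7: "rmem s7 ''mv'' = (\<lambda>c. if c \<in> {1..m} \<and> nmem s6 ''us'' c = 0 \<and> tt c < rmem s6 ''mv'' c then tt c else rmem s6 ''mv'' c)"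
        "nmem s7 ''wy'' = (\<lambda>c. if c \<in> {1..m} \<and> nmem s6 ''us'' c = 0 \<and> tt c < rmem s6 ''mv'' c then nmem s6 ''s'' 0 else nmem s6 ''wy'' c)"
      and a7: "agree relax_columns s6 s7"
      by (rule runE[OF run_relax_columns[OF m6], folded tt_def]) (erule conjE)
    have qj: "nmem s ''q'' j \<in> {1..n}" using tree_invD(8)[OF T j(1)] False i by simp
    have tt: "tt c = A (nmem s ''q'' j) c - rmem s4 ''u'' (nmem s ''q'' j) - rmem s4 ''v'' c" if "c \<in> {1..m}" for c
      using C qj that unfolding tt_def cost_state_def by (simp add: s6_def s5_def f4)
    have "tree_inv A m i (Suc k) (rmem s4 ''u'') (rmem s4 ''v'') (nmem s ''q'') ((nmem s ''us'')(j := Suc k))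
       (nmem s7 ''wy'') (rmem s7 ''mv'') ((nmem s ''ru'')(nmem s ''q'' j := 1))"
      by (rule tree_inv_extend[OF T4 j(1,2) mvj False])
        (auto simp: r7 tt s6_def s5_def f4)
    moreover have "nmem s7 ''q'' = nmem s ''q''" "nmem s7 ''us'' = (nmem s ''us'')(j := Suc k)"
      "nmem s7 ''ru'' = (nmem s ''ru'')(nmem s ''q'' j := 1)" "rmem s7 ''u'' = rmem s4 ''u''"
      "rmem s7 ''v'' = rmem s4 ''v''" "nmem s7 ''dn'' 0 = 0"
      by (simp_all add: agree_nmem[OF a7] agree_rmem[OF a7] s6_def s5_def f4 dn)
    ultimately have "?Q s7" using qj by simp
    moreover have "exec (Cond (IsZero (At ''q'' ''s'')) (NSet ''dn'' (NConst 0) (NConst 1)) (Seq ?c relax_columns)) s5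
         (1 + bcost (IsZero (At ''q'' ''s'')) + (t6 + t7)) s7"
      using False by (intro exec.CondFalse exec.Seq[OF e6(1) e7(1)]) (simp add: s5_def f4)
    moreover have "1 + bcost (IsZero (At ''q'' ''s'')) + (t6 + t7) \<le> 40 + m * (100 + 14)"
      using e6(2) e7(2) by simp
    ultimately show ?thesis by blast
  qed
  then obtain t6 s6 where e6: "exec (Cond (IsZero (At ''q'' ''s'')) (NSet ''dn'' (NConst 0) (NConst 1))
           (Seq (Seq (NSet ''h'' (NConst 0) (At ''q'' ''s'')) (NSet ''ru'' (Var ''h'') (NConst 1))) relax_columns)) s5 t6 s6"
      "t6 \<le> 40 + m * (100 + 14)" "?Q s6" by blast
  have "exec grow s (t1 + (5 + (t3 + (t4 + (7 + t6))))) s6"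
    unfolding grow_def
    by (rule exec.Seq[OF e1(1) exec.Seq[OF e2 exec.Seq[OF e3(1) exec.Seq[OF e4(1) exec.Seq[OF e5 e6(1)]]]]])
  moreover have "t1 + (5 + (t3 + (t4 + (7 + t6)))) \<le> 500 * m"
    using e1(2) e3(2) e4(2) e6(2) mn(3,4) by simp
  ultimately show ?thesis using e6(3) unfolding run_def by blast
qed

lemma writes_grow [simp]:
  "nwrites grow = {''j'', ''s'', ''r'', ''us'', ''dn'', ''h'', ''ru'', ''wy''}" "rwrites grow = {''de'', ''u'', ''v'', ''mv'', ''t''}"
  by (auto simp: grow_def)

section \<open>Rounds, phases and the whole method\<close>

definition grow_loop :: com where
  "grow_loop = For ''k'' ''n'' (Cond (IsZero (Var ''dn'')) grow Skip)"

text \<open>The flag makes all rounds after success idle, so a counting loop can replace a search of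
  unknown length.\<close>

lemma run_grow_loop:
  assumes C: "cost_state A m n s" and i: "i \<le> n"
    and dn: "nmem s ''dn'' 0 = 0" and T: "tree_state A m i 1 s"
  shows "run grow_loop s (n * (600 * m)) (\<lambda>s'. (\<forall>r>n. nmem s' ''ru'' r = nmem s ''ru'' r) \<and>
     augment_state A m i s' \<and> nmem s' ''us'' (nmem s' ''s'' 0) \<le> n + 1)"
proof -
  have mn: "nmem s ''n'' 0 = n" "1 \<le> n" "n \<le> m" using C by (auto simp: cost_state_def)
  let ?c = "Cond (IsZero (Var ''dn'')) grow Skip"
  let ?Inv = "\<lambda>k s'. (\<forall>r>n. nmem s' ''ru'' r = nmem s ''ru'' r) \<and>
     ((nmem s' ''dn'' 0 = 0 \<and> tree_state A m i k s') \<or>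
      (nmem s' ''dn'' 0 \<noteq> 0 \<and> augment_state A m i s' \<and> nmem s' ''us'' (nmem s' ''s'' 0) \<le> n + 1))"
  have "run (For ''k'' ''n'' ?c) s (11 + n * ((1 + bcost (IsZero (Var ''dn'')) + 501 * m) + 14)) (?Inv (Suc n))"
  proof (rule run_For[OF mn(1)])
    fix k s' assume k: "1 \<le> k" "k \<le> n" "nmem s' ''k'' 0 = k" and a: "agree (For ''k'' ''n'' ?c) s s'"
      and Inv: "?Inv k s'"
    have C': "cost_state A m n s'" using cost_state_agree[OF C a] by simp
    show "run ?c s' (1 + bcost (IsZero (Var ''dn'')) + 501 * m) (\<lambda>s''. ?Inv (Suc k) (nupd ''k'' 0 (Suc k) s''))"
    proof (rule run_Cond)
      assume "bval (IsZero (Var ''dn'')) s'"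
      then have dn': "nmem s' ''dn'' 0 = 0" by simp
      then have "tree_state A m i k s'" using Inv by blast
      from run_grow[OF C' k(3,2) i dn' this] show "run grow s' (501 * m) (\<lambda>s''. ?Inv (Suc k) (nupd ''k'' 0 (Suc k) s''))"
        by (rule run_mono) (use Inv in auto)
    next
      assume "\<not> bval (IsZero (Var ''dn'')) s'"
      then show "run Skip s' (501 * m) (\<lambda>s''. ?Inv (Suc k) (nupd ''k'' 0 (Suc k) s''))"
        using Inv mn by (intro run_loop_free) auto
    qed
  qed (use dn T in auto)
  then show ?thesis
    unfolding grow_loop_def
  proof (rule run_mono)
    fix s' assume Inv: "?Inv (Suc n) s'"
    \<comment> \<open>Otherwise \<open>n\<close> columns of the tree would be matched to distinct
      rows below \<open>i \<le> n\<close>.\<close>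
    moreover have "\<not> tree_state A m i (Suc n) s'" using tree_inv_unused(1) i by fastforce
    ultimately show "(\<forall>r>n. nmem s' ''ru'' r = nmem s ''ru'' r) \<and>
      augment_state A m i s' \<and> nmem s' ''us'' (nmem s' ''s'' 0) \<le> n + 1" by blast
  next
    have "11 + n * ((1 + bcost (IsZero (Var ''dn'')) + 501 * m) + 14) \<le> n * (501 * m + 40)"
      using mn by (simp add: distrib_left)
    also have "\<dots> \<le> n * (600 * m)" using mn by (intro mult_le_mono2) simp
    finally show "11 + n * ((1 + bcost (IsZero (Var ''dn'')) + 501 * m) + 14) \<le> n * (600 * m)" .
  qed
qed

lemma writes_grow_loop [simp]:
  "nwrites grow_loop = {''k'', ''j'', ''s'', ''r'', ''us'', ''dn'', ''h'', ''ru'', ''wy''}"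
  "rwrites grow_loop = {''de'', ''u'', ''v'', ''mv'', ''t''}"
  by (auto simp: grow_loop_def)

definition phase :: com where
  "phase = Seq init_columns (Seq init_rows (Seq
     (Seq (NSet ''ru'' (Var ''i'') (NConst 1)) (Seq (NSet ''q'' (NConst 0) (Var ''i''))
        (Seq (NSet ''us'' (NConst 0) (NConst 1)) (NSet ''dn'' (NConst 0) (NConst 0)))))
     (Seq grow_loop augment)))"

abbreviation dual_state :: "(nat \<Rightarrow> nat \<Rightarrow> real) \<Rightarrow> nat \<Rightarrow> nat \<Rightarrow> store \<Rightarrow> bool" where
  "dual_state A m i s \<equiv> dual_inv A m i (rmem s ''u'') (rmem s ''v'') (nmem s ''q'')"

lemma run_phase:
  assumes C: "cost_state A m n s" and i: "nmem s ''i'' 0 = i" "1 \<le> i" "i \<le> n"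
    and ru: "\<forall>r>n. nmem s ''ru'' r = 0" and D: "dual_state A m (i - 1) s"
  shows "run phase s (n * (1000 * m)) (\<lambda>s'. (\<forall>r>n. nmem s' ''ru'' r = 0) \<and> dual_state A m i s')"
proof -
  have mn: "nmem s ''m'' 0 = m" "nmem s ''n'' 0 = n" "1 \<le> n" "n \<le> m" using C by (auto simp: cost_state_def)
  obtain t1 s1 where e1: "exec init_columns s t1 s1" "t1 \<le> 11 + m * (50 + 14)"
    and r1: "\<forall>c\<in>{1..m}. nmem s1 ''us'' c = 0 \<and> nmem s1 ''wy'' c = 0 \<and>
     rmem s1 ''mv'' c = rmem s ''D'' (nmem s ''a'' c + nmem s ''i'' 0) - rmem s ''v'' c"
    and a1: "agree init_columns s s1"
    by (rule runE[OF run_init_columns[OF mn(1)]])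
  have "nmem s1 ''n'' 0 = n" using agree_nmem[OF a1] mn by simp
  then obtain t2 s2 where e2: "exec init_rows s1 t2 s2" "t2 \<le> 11 + n * (50 + 14)"
    and r2: "nmem s2 ''ru'' = (\<lambda>r. if r \<in> {1..n} then 0 else nmem s1 ''ru'' r)"
    and a2: "agree init_rows s1 s2"
    by (rule runE[OF run_init_rows])
  let ?c = "Seq (NSet ''ru'' (Var ''i'') (NConst 1)) (Seq (NSet ''q'' (NConst 0) (Var ''i''))
        (Seq (NSet ''us'' (NConst 0) (NConst 1)) (NSet ''dn'' (NConst 0) (NConst 0))))"
  note fr = agree_nmem[OF a1] agree_rmem[OF a1] agree_nmem[OF a2] agree_rmem[OF a2]
  define s3 where "s3 = nupd ''dn'' 0 0 (nupd ''us'' 0 1 (nupd ''q'' 0 i (nupd ''ru'' i 1 s2)))"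
  have "result ?c s2 = s3" by (simp add: s3_def fr i)
  then have "run ?c s2 20 (\<lambda>s'. s' = s3)" by (intro run_loop_free) auto
  then obtain t3 where e3: "exec ?c s2 t3 s3" "t3 \<le> 20" unfolding run_def by blast
  have a3: "agree ?c s2 s3" by (rule exec_agree[OF e3(1)])
  have C3: "cost_state A m n s3"
    using C a1 a2 a3 by (auto intro!: cost_state_agree[OF _ a3] cost_state_agree[OF _ a2] cost_state_agree[OF _ a1])
  have T3: "tree_state A m i 1 s3"
  proof (rule tree_inv_init[OF _ i(2)])
    show "dual_inv A m (i - 1) (rmem s3 ''u'') (rmem s3 ''v'') (nmem s ''q'')"
      using D by (simp add: s3_def fr)
    show "i \<le> m" using i mn by simp
    fix c assume c: "c \<in> {1..m}"
    show "0 \<le> A i c" using C c i by (simp add: cost_state_def)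
    show "nmem s3 ''q'' c = nmem s ''q'' c" using c by (simp add: s3_def fr)
    show "nmem s3 ''us'' c = 0 \<and> nmem s3 ''wy'' c = 0 \<and> rmem s3 ''mv'' c = A i c - rmem s3 ''v'' c"
      using C c i r1 by (simp add: s3_def fr cost_state_def)
  next
    fix r :: nat assume "1 \<le> r" "r \<noteq> i"
    then show "nmem s3 ''ru'' r = 0" using ru by (simp add: s3_def r2 fr)
  qed (simp_all add: s3_def)
  have "nmem s3 ''dn'' 0 = 0" by (simp add: s3_def)
  then obtain t4 s4 where e4: "exec grow_loop s3 t4 s4" "t4 \<le> n * (600 * m)"
    and r4: "(\<forall>r>n. nmem s4 ''ru'' r = nmem s3 ''ru'' r) \<and>
      augment_state A m i s4 \<and> nmem s4 ''us'' (nmem s4 ''s'' 0) \<le> n + 1"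
    and a4: "agree grow_loop s3 s4"
    by (rule runE[OF run_grow_loop[OF C3 i(3) _ T3]])
  have "nmem s4 ''n'' 0 = n" using mn by (simp add: agree_nmem[OF a4] s3_def fr)
  with r4 obtain t5 s5 where e5: "exec augment s4 t5 s5" "t5 \<le> 11 + n * (50 + 14)"
    and r5: "dual_inv A m i (rmem s4 ''u'') (rmem s4 ''v'') (nmem s5 ''q'')"
    and a5: "agree augment s4 s5"
    by (metis (no_types, lifting) runE run_augment)
  have "exec phase s (t1 + (t2 + (t3 + (t4 + t5)))) s5"
    unfolding phase_def by (rule exec.Seq[OF e1(1) exec.Seq[OF e2(1) exec.Seq[OF e3(1) exec.Seq[OF e4(1) e5(1)]]]])
  moreover have "t1 + (t2 + (t3 + (t4 + t5))) \<le> n * (1000 * m)"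
  proof -
    define x where "x = n * m"
    have "1 * m \<le> x" unfolding x_def using mn by (intro mult_le_mono1) simp
    moreover have "n * (600 * m) = 600 * x" "n * (1000 * m) = 1000 * x" by (simp_all add: x_def)
    ultimately show ?thesis using e1(2) e2(2) e3(2) e4(2) e5(2) mn(3,4) by simp
  qed
  moreover have "dual_state A m i s5" using r5 by (simp add: agree_rmem[OF a5])
  moreover have "\<forall>r>n. nmem s5 ''ru'' r = 0"
    using r4 ru i by (simp add: agree_nmem[OF a5] s3_def r2 fr)
  ultimately show ?thesis unfolding run_def by blast
qed

lemma writes_phase [simp]:
  "nwrites phase = {''k'', ''j'', ''s'', ''r'', ''us'', ''dn'', ''h'', ''ru'', ''wy'', ''q''}"
  "rwrites phase = {''de'', ''u'', ''v'', ''mv'', ''t''}"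
  by (auto simp: phase_def)

definition hungarian :: com where
  "hungarian = For ''i'' ''n'' phase"

lemma run_hungarian:
  assumes C: "cost_state A m n s" and z: "nmem s ''ru'' = (\<lambda>_. 0)" "nmem s ''q'' = (\<lambda>_. 0)"
    "rmem s ''u'' = (\<lambda>_. 0)" "rmem s ''v'' = (\<lambda>_. 0)"
  shows "run hungarian s (n * (n * (1100 * m))) (\<lambda>s'. dual_state A m n s')"
proof -
  have mn: "nmem s ''n'' 0 = n" "1 \<le> n" "n \<le> m" using C by (auto simp: cost_state_def)
  let ?Inv = "\<lambda>k s'. (\<forall>r>n. nmem s' ''ru'' r = 0) \<and> dual_state A m (k - 1) s'"
  have "run hungarian s (11 + n * (n * (1000 * m) + 14)) (?Inv (Suc n))"
    unfolding hungarian_def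
  proof (rule run_For[OF mn(1)])
    \<comment> \<open>Before any row is inserted, zero potentials and the empty matching satisfy the
      invariant, and cleared memory represents them.\<close>
    show "?Inv 1 (nupd ''i'' 0 1 s)" using z by (simp add: dual_inv_def)
    fix k s' assume k: "1 \<le> k" "k \<le> n" "nmem s' ''i'' 0 = k" and a: "agree (For ''i'' ''n'' phase) s s'"
      and Inv: "?Inv k s'"
    have "cost_state A m n s'" using cost_state_agree[OF C a] by simp
    from run_phase[OF this k(3,1,2)] Inv
    have "run phase s' (n * (1000 * m)) (\<lambda>s'. (\<forall>r>n. nmem s' ''ru'' r = 0) \<and> dual_state A m k s')" by blast
    then show "run phase s' (n * (1000 * m)) (\<lambda>s''. ?Inv (Suc k) (nupd ''i'' 0 (Suc k) s''))"
      by (rule run_mono) auto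
  qed simp_all
  then show ?thesis
  proof (rule run_mono)
    have "11 + n * (n * (1000 * m) + 14) \<le> n * (n * (1000 * m) + 25)"
      using mn by (simp add: distrib_left)
    also have "\<dots> \<le> n * (n * (1100 * m))"
    proof (rule mult_le_mono2)
      have "1 * 1 \<le> n * m" using mn by (intro mult_le_mono) auto
      then show "n * (1000 * m) + 25 \<le> n * (1100 * m)" by simp
    qed
    finally show "11 + n * (n * (1000 * m) + 14) \<le> n * (n * (1100 * m))" .
  qed simp
qed

lemma writes_hungarian [simp]:
  "nwrites hungarian = {''i'', ''k'', ''j'', ''s'', ''r'', ''us'', ''dn'', ''h'', ''ru'', ''wy'', ''q''}"
  "rwrites hungarian = {''de'', ''u'', ''v'', ''mv'', ''t''}"
  by (auto simp: hungarian_def)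

section \<open>Preprocessing\<close>

text \<open>The machine cannot multiply, so the row offsets of the matrices are tabulated by
  repeated addition.\<close>

definition multiples :: "vname \<Rightarrow> vname \<Rightarrow> vname \<Rightarrow> vname \<Rightarrow> com" where
  "multiples x y a b = For x y (NSet a (Var x) (NAdd (NGet a (NSub (Var x) (NConst 1))) (Var b)))"

lemma run_multiples:
  assumes "nmem s y 0 = N" "x \<noteq> y" "a \<noteq> x" "a \<noteq> y" "a \<noteq> b" "b \<noteq> x" "nmem s a 0 = 0"
  shows "run (multiples x y a b) s (11 + N * (50 + 14)) (\<lambda>s'. \<forall>i\<le>N. nmem s' a i = i * nmem s b 0)"
proof -
  let ?Inv = "\<lambda>k s'. \<forall>i<k. nmem s' a i = i * nmem s b 0"
  have "run (multiples x y a b) s (11 + N * (50 + 14)) (?Inv (Suc N))"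
    unfolding multiples_def
  proof (rule run_For_body[OF assms(1)], goal_cases)
    case (7 k s')
    have "nmem s' b = nmem s b" using agree_nmem[OF 7(4), of b] assms by simp
    moreover have "nmem s' a (k - 1) = (k - 1) * nmem s b 0" using 7(1,5) by simp
    moreover have "(k - 1) * nmem s b 0 + nmem s b 0 = k * nmem s b 0"
      using 7(1) by (cases k) auto
    ultimately show ?case using 7 assms by (auto simp: less_Suc_eq)
  qed (use assms in auto)
  then show ?thesis by (simp add: less_Suc_eq_le)
qed

lemma writes_multiples [simp]: "nwrites (multiples x y a b) = {x, a}" "rwrites (multiples x y a b) = {}"
  by (auto simp: multiples_def)

text \<open>\<open>r\<close> counts ranks from 1, while the list begins at cell
  \<open>pstart l\<close> itself; hence the subtraction of 1.\<close>

definition list_class :: com where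
  "list_class = For ''r'' ''z'' (Seq (NSet ''g'' (NConst 0)
        (NGet ''pitems'' (NSub (NAdd (At ''pstart'' ''l'') (Var ''r'')) (NConst 1))))
     (Seq (NSet ''cl'' (Var ''g'') (Var ''l'')) (NSet ''rk'' (Var ''g'') (Var ''r''))))"

definition classify :: com where
  "classify = For ''l'' ''p'' (Seq
     (NSet ''z'' (NConst 0) (NSub (NGet ''pstart'' (NAdd (Var ''l'') (NConst 1))) (At ''pstart'' ''l''))) list_class)"

text \<open>The result \<open>1 + 2 * weight\<close> exceeds \<open>2 * weight\<close>, as the
  penalties require. Adding or subtracting \<open>t + t\<close> according to the sign of
  \<open>t\<close> doubles the absolute value without multiplication.\<close>

definition sum_weights :: com where
  "sum_weights = Seq (RSet ''N'' (NConst 0) (RConst 1)) (For ''i'' ''m'' (For ''j'' ''n''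
     (Seq (RSet ''t'' (NConst 0) (RGet ''W'' (NAdd (At ''a'' ''i'') (Var ''j''))))
        (Cond (RLess (RVar ''t'') (RConst 0))
           (RSet ''N'' (NConst 0) (RSub (RVar ''N'') (RAdd (RVar ''t'') (RVar ''t''))))
           (RSet ''N'' (NConst 0) (RAdd (RVar ''N'') (RAdd (RVar ''t'') (RVar ''t''))))))))"

text \<open>The items are visited in decreasing order, and \<open>''be''\<close> keeps the best item
  seen of each class, 0 for none. One pass of \<open>m\<close> rounds thus finds all best later
  items.\<close>

definition find_best_later :: com where
  "find_best_later = For ''k'' ''m'' (Seq
     (NSet ''i'' (NConst 0) (NSub (NAdd (Var ''m'') (NConst 1)) (Var ''k''))) (Seq
     (NSet ''l'' (NConst 0) (At ''cl'' ''i''))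
     (Cond (IsZero (Var ''l'')) (NSet ''ag'' (Var ''i'') (Var ''i'')) (Seq
        (Cond (BAnd (NonZero (At ''be'' ''l''))
                 (BNot (RLess (RGet ''W'' (NAdd (NGet ''a'' (At ''be'' ''l'')) (Var ''n'')))
                              (RGet ''W'' (NAdd (At ''a'' ''i'') (Var ''n''))))))
           Skip (NSet ''be'' (Var ''l'') (Var ''i'')))
        (NSet ''ag'' (Var ''i'') (At ''be'' ''l''))))))"

text \<open>\<open>''md''\<close> becomes nonzero if \<open>i\<close> is mandatory,
  \<open>''bd''\<close> if position \<open>j\<close> is forbidden for it.\<close>

definition check_bounds :: com where
  "check_bounds = For ''k'' ''n'' (Seq
     (Cond (NLess (NGet ''L'' (NAdd (At ''b'' ''k'') (Var ''l''))) (At ''rk'' ''i'')) Skip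
        (Seq (NSet ''md'' (NConst 0) (NConst 1))
           (Cond (NLess (Var ''k'') (Var ''j'')) (NSet ''bd'' (NConst 0) (NConst 1)) Skip)))
     (Cond (BAnd (NLess (NGet ''U'' (NAdd (At ''b'' ''k'') (Var ''l''))) (At ''rk'' ''i''))
                 (BNot (NLess (Var ''k'') (Var ''j''))))
        (NSet ''bd'' (NConst 0) (NConst 1)) Skip))"

text \<open>Inspecting up to \<open>n\<close> bounds for each of the \<open>n * m\<close> entries
  takes time of the order \<open>n * n * m\<close>, the same as the Hungarian method.\<close>

definition cost_entry :: com where
  "cost_entry = Seq (Seq (NSet ''md'' (NConst 0) (NConst 0)) (Seq (NSet ''bd'' (NConst 0) (NConst 0))
        (NSet ''l'' (NConst 0) (At ''cl'' ''i''))))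
     (Seq (Cond (NonZero (Var ''l'')) check_bounds Skip)
     (Seq (Cond (NLess (Var ''j'') (Var ''n''))
             (RSet ''t'' (NConst 0) (RGet ''W'' (NAdd (At ''a'' ''i'') (Var ''j''))))
             (RSet ''t'' (NConst 0) (RGet ''W'' (NAdd (NGet ''a'' (At ''ag'' ''i'')) (Var ''n'')))))
          (Cond (NonZero (Var ''bd''))
             (RSet ''D'' (NAdd (At ''a'' ''i'') (Var ''j'')) (RSub (RAdd (RVar ''N'') (RAdd (RVar ''N'') (RVar ''N''))) (RVar ''t'')))
             (Cond (NonZero (Var ''md''))
                (RSet ''D'' (NAdd (At ''a'' ''i'') (Var ''j'')) (RSub (RVar ''N'') (RVar ''t'')))
                (RSet ''D'' (NAdd (At ''a'' ''i'') (Var ''j'')) (RSub (RAdd (RVar ''N'') (RVar ''N'')) (RVar ''t'')))))))"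

definition cost_matrix :: com where
  "cost_matrix = For ''i'' ''m'' (For ''j'' ''n'' cost_entry)"

lemma writes_prep [simp]:
  "nwrites list_class = {''r'', ''g'', ''cl'', ''rk''}" "rwrites list_class = {}"
  "nwrites classify = {''l'', ''z'', ''r'', ''g'', ''cl'', ''rk''}" "rwrites classify = {}"
  "nwrites sum_weights = {''i'', ''j''}" "rwrites sum_weights = {''N'', ''t''}"
  "nwrites find_best_later = {''k'', ''i'', ''l'', ''ag'', ''be''}" "rwrites find_best_later = {}"
  "nwrites check_bounds = {''k'', ''md'', ''bd''}" "rwrites check_bounds = {}"
  "nwrites cost_entry = {''md'', ''bd'', ''l'', ''k''}" "rwrites cost_entry = {''t'', ''D''}"
  "nwrites cost_matrix = {''i'', ''j'', ''md'', ''bd'', ''l'', ''k''}" "rwrites cost_matrix = {''t'', ''D''}"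
  by (auto simp: list_class_def classify_def sum_weights_def find_best_later_def check_bounds_def
      cost_entry_def cost_matrix_def)

text \<open>Columns are numbered from 1, so row \<open>i\<close> occupies the cells
  \<open>i * n' + 1\<close> to \<open>(i + 1) * n'\<close>, and its last cell does not collide with
  the next row.\<close>

lemma index_inj:
  fixes i j i' j' n' :: nat
  assumes "j \<in> {1..n'}" "j' \<in> {1..n'}"
  shows "i * n' + j = i' * n' + j' \<longleftrightarrow> i = i' \<and> j = j'"
proof
  assume eq: "i * n' + j = i' * n' + j'"
  obtain k k' where k: "j = Suc k" "j' = Suc k'" "k < n'" "k' < n'"
    using assms by (cases j; cases j') auto
  have "(i * n' + k) div n' = i" "(i' * n' + k') div n' = i'" using k by simp_all
  with eq k have "i = i'" by simp
  with eq show "i = i' \<and> j = j'" by simp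
qed simp

section \<open>Correctness of the preprocessing\<close>

context lu_problem
begin

text \<open>\<open>encodes\<close> demands cleared working memory and is lost with the first write.
  This predicate and the next ones keep the facts that survive.\<close>

definition input_state :: "store \<Rightarrow> bool" where
  "input_state s \<longleftrightarrow> nmem s ''m'' 0 = m \<and> nmem s ''n'' 0 = n \<and> nmem s ''p'' 0 = p \<and>
     (\<forall>i\<in>{1..m}. \<forall>j\<in>{1..n}. rmem s ''W'' (i * n + j) = W i j) \<and>
     (\<forall>k\<in>{1..n}. \<forall>l\<in>{1..p}. nmem s ''L'' (k * p + l) = lower I k l \<and> nmem s ''U'' (k * p + l) = upper I k l)"

definition list_state :: "store \<Rightarrow> bool" where
  "list_state s \<longleftrightarrow> nmem s ''p'' 0 = p \<and> (\<forall>l\<in>{1..p + 1}. nmem s ''pstart'' l = pstart I l) \<and>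
     (\<forall>l\<in>{1..p}. \<forall>r<card (P l). nmem s ''pitems'' (pstart I l + r) = sorted_list_of_set (P l) ! r)"

definition offset_state :: "store \<Rightarrow> bool" where
  "offset_state s \<longleftrightarrow> (\<forall>i\<le>m. nmem s ''a'' i = i * n) \<and> (\<forall>k\<le>n. nmem s ''b'' k = k * p)"

definition class_state :: "store \<Rightarrow> bool" where
  "class_state s \<longleftrightarrow> (\<forall>i\<in>{1..m}. nmem s ''cl'' i = cls i \<and> (cls i \<noteq> 0 \<longrightarrow> nmem s ''rk'' i = rank i))"

lemma rank_range:
  assumes "l \<in> {1..p}" "i \<in> P l"
  shows "1 \<le> rank i" "rank i \<le> card (P l)" "sorted_list_of_set (P l) ! (rank i - 1) = i"
proof -
  have "i \<in> set (sorted_list_of_set (P l))" "length (sorted_list_of_set (P l)) = card (P l)"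
    using assms finite_P by auto
  then obtain k where k: "k < card (P l)" "sorted_list_of_set (P l) ! k = i"
    by (auto simp: in_set_conv_nth)
  then show "1 \<le> rank i" "rank i \<le> card (P l)" "sorted_list_of_set (P l) ! (rank i - 1) = i"
    using rank_nth(2)[OF assms(1) k(1)] by auto
qed

text \<open>Items of classes not listed so far must still have 0 in \<open>''cl''\<close>: class 0
  is never written, it is what remains of the cleared memory.\<close>

lemma run_list_class:
  assumes L: "list_state s" and l: "nmem s ''l'' 0 = l" "l \<in> {1..p}" and z: "nmem s ''z'' 0 = card (P l)"
    and c: "\<forall>i\<in>{1..m}. if 1 \<le> cls i \<and> cls i < l then nmem s ''cl'' i = cls i \<and> nmem s ''rk'' i = rank i
       else nmem s ''cl'' i = 0"
  shows "run list_class s (11 + card (P l) * (50 + 14)) (\<lambda>s'. \<forall>i\<in>{1..m}.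
     if 1 \<le> cls i \<and> cls i < Suc l then nmem s' ''cl'' i = cls i \<and> nmem s' ''rk'' i = rank i else nmem s' ''cl'' i = 0)"
proof -
  let ?Inv = "\<lambda>r s'. \<forall>i\<in>{1..m}. if (1 \<le> cls i \<and> cls i < l) \<or> (cls i = l \<and> rank i < r)
     then nmem s' ''cl'' i = cls i \<and> nmem s' ''rk'' i = rank i else nmem s' ''cl'' i = 0"
  have "run list_class s (11 + card (P l) * (50 + 14)) (?Inv (Suc (card (P l))))"
    unfolding list_class_def
  proof (rule run_For_body[OF z], goal_cases)
    case 6
    show ?case
    proof
      fix i assume i: "i \<in> {1..m}"
      have "\<not> (cls i = l \<and> rank i < 1)" using rank_range(1)[OF l(2), of i] cls_iff[OF l(2), of i] by auto
      then show "if (1 \<le> cls i \<and> cls i < l) \<or> (cls i = l \<and> rank i < 1)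
        then nmem (nupd ''r'' 0 1 s) ''cl'' i = cls i \<and> nmem (nupd ''r'' 0 1 s) ''rk'' i = rank i
        else nmem (nupd ''r'' 0 1 s) ''cl'' i = 0"
        using c i by auto
    qed
  next
    case (7 r s')
    let ?g = "sorted_list_of_set (P l) ! (r - 1)"
    have f: "nmem s' ''pitems'' = nmem s ''pitems''" "nmem s' ''pstart'' = nmem s ''pstart''" "nmem s' ''l'' 0 = l"
      using agree_nmem[OF 7(4)] l by simp_all
    have r: "r - 1 < card (P l)" "1 \<le> r" "nmem s' ''r'' 0 = r" using 7 by auto
    have "pstart I l + r - 1 = pstart I l + (r - 1)" using r by simp
    then have g: "nmem s ''pitems'' (nmem s ''pstart'' l + r - Suc 0) = ?g"
      using L l r(1) by (simp add: list_state_def)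
    have gr: "rank ?g = r" "cls ?g = l"
      using rank_nth[OF l(2) r(1)] r(2) cls_iff[OF l(2)] by auto
    show ?case
    proof
      fix i assume i: "i \<in> {1..m}"
      have eq: "i = ?g" if "cls i = l" "rank i = r"
        using rank_range(3)[OF l(2), of i] cls_iff[OF l(2), of i] that by simp
      have Inv: "if (1 \<le> cls i \<and> cls i < l) \<or> (cls i = l \<and> rank i < r)
         then nmem s' ''cl'' i = cls i \<and> nmem s' ''rk'' i = rank i else nmem s' ''cl'' i = 0"
        using 7(5) i by blast
      show "if (1 \<le> cls i \<and> cls i < l) \<or> (cls i = l \<and> rank i < Suc r)
         then nmem (nupd ''r'' 0 (Suc r) (result (Seq (NSet ''g'' (NConst 0)
        (NGet ''pitems'' (NSub (NAdd (At ''pstart'' ''l'') (Var ''r'')) (NConst 1))))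
     (Seq (NSet ''cl'' (Var ''g'') (Var ''l'')) (NSet ''rk'' (Var ''g'') (Var ''r'')))) s')) ''cl'' i = cls i \<and>
           nmem (nupd ''r'' 0 (Suc r) (result (Seq (NSet ''g'' (NConst 0)
        (NGet ''pitems'' (NSub (NAdd (At ''pstart'' ''l'') (Var ''r'')) (NConst 1))))
     (Seq (NSet ''cl'' (Var ''g'') (Var ''l'')) (NSet ''rk'' (Var ''g'') (Var ''r'')))) s')) ''rk'' i = rank i
         else nmem (nupd ''r'' 0 (Suc r) (result (Seq (NSet ''g'' (NConst 0)
        (NGet ''pitems'' (NSub (NAdd (At ''pstart'' ''l'') (Var ''r'')) (NConst 1))))
     (Seq (NSet ''cl'' (Var ''g'') (Var ''l'')) (NSet ''rk'' (Var ''g'') (Var ''r'')))) s')) ''cl'' i = 0"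
      proof (cases "i = ?g")
        case True
        then show ?thesis using gr by (simp add: f g r(3))
      next
        case False
        then have "\<not> (cls i = l \<and> rank i = r)" using eq by blast
        then show ?thesis using Inv False by (auto simp: f g r(3) less_Suc_eq split: if_splits)
      qed
    qed
  qed simp_all
  then show ?thesis
  proof (rule run_mono)
    fix s' :: store assume Inv: "?Inv (Suc (card (P l))) s'"
    show "\<forall>i\<in>{1..m}. if 1 \<le> cls i \<and> cls i < Suc l then nmem s' ''cl'' i = cls i \<and> nmem s' ''rk'' i = rank i
      else nmem s' ''cl'' i = 0"
    proof
      fix i assume i: "i \<in> {1..m}"
      have "(1 \<le> cls i \<and> cls i < l) \<or> (cls i = l \<and> rank i < Suc (card (P l))) \<longleftrightarrow> 1 \<le> cls i \<and> cls i < Suc l"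
        using rank_range(2)[OF l(2), of i] cls_iff[OF l(2), of i] l(2) by auto
      then show "if 1 \<le> cls i \<and> cls i < Suc l then nmem s' ''cl'' i = cls i \<and> nmem s' ''rk'' i = rank i
        else nmem s' ''cl'' i = 0"
        using Inv i by (metis (no_types, lifting))
    qed
  qed simp
qed

text \<open>Listing class \<open>l\<close> takes \<open>card (P l)\<close> rounds. The classes are
  disjoint, so the total is linear in \<open>m\<close> and \<open>p\<close>.\<close>

lemma run_classify:
  assumes L: "list_state s" and z: "nmem s ''cl'' = (\<lambda>_. 0)"
  shows "run classify s (11 + p * 40 + m * 64) class_state"
proof -
  have p: "nmem s ''p'' 0 = p" using L by (simp add: list_state_def)
  let ?c = "Seq (NSet ''z'' (NConst 0) (NSub (NGet ''pstart'' (NAdd (Var ''l'') (NConst 1))) (At ''pstart'' ''l''))) list_class"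
  let ?Inv = "\<lambda>l s'. \<forall>i\<in>{1..m}. if 1 \<le> cls i \<and> cls i < l then nmem s' ''cl'' i = cls i \<and> nmem s' ''rk'' i = rank i
       else nmem s' ''cl'' i = 0"
  have "run classify s (11 + (\<Sum>l = 1..p. (12 + (11 + card (P l) * (50 + 14))) + 14)) (?Inv (Suc p))"
    unfolding classify_def
  proof (rule run_For_sum[OF p], goal_cases)
    case (5 l s')
    let ?s = "nupd ''z'' 0 (card (P l)) s'"
    have l: "l \<in> {1..p}" using 5 by simp
    have L': "list_state s'" using L agree_nmem[OF 5(4)] by (simp add: list_state_def)
    have "pstart I (Suc l) = pstart I l + card (P l)" using l by (simp add: pstart_def)
    then have "nval (NSub (NGet ''pstart'' (NAdd (Var ''l'') (NConst 1))) (At ''pstart'' ''l'')) s' = card (P l)"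
      using L' l 5(3) by (simp add: list_state_def)
    then have "run (NSet ''z'' (NConst 0) (NSub (NGet ''pstart'' (NAdd (Var ''l'') (NConst 1))) (At ''pstart'' ''l''))) s' 12
        (\<lambda>s'. s' = ?s)"
      by (intro run_loop_free) simp_all
    then show ?case
    proof (rule run_Seq)
      fix s1 assume s1: "s1 = ?s"
      have "run list_class ?s (11 + card (P l) * (50 + 14)) (?Inv (Suc l))"
      proof (rule run_list_class)
        show "list_state ?s" using L' by (simp add: list_state_def)
      qed (use 5 l in simp_all)
      then show "run list_class s1 (11 + card (P l) * (50 + 14)) (\<lambda>s''. ?Inv (Suc l) (nupd ''l'' 0 (Suc l) s''))"
        unfolding s1 by (rule run_mono) simp_all
    qed
  qed (use z in auto)
  then show ?thesis
  proof (rule run_mono)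
    have "(\<Sum>l = 1..p. (12 + (11 + card (P l) * (50 + 14))) + 14) = p * 37 + 64 * (\<Sum>l = 1..p. card (P l))"
      by (simp add: sum.distrib sum_distrib_left mult.commute)
    then show "11 + (\<Sum>l = 1..p. (12 + (11 + card (P l) * (50 + 14))) + 14) \<le> 11 + p * 40 + m * 64"
      using sum_card_P by simp
  next
    fix s' :: store assume Inv: "?Inv (Suc p) s'"
    show "class_state s'"
      unfolding class_state_def
    proof
      fix i assume "i \<in> {1..m}"
      then show "nmem s' ''cl'' i = cls i \<and> (cls i \<noteq> 0 \<longrightarrow> nmem s' ''rk'' i = rank i)"
        using Inv cls_le[of i] by (cases "cls i = 0") auto
    qed
  qed
qed

lemma input_state_agree:
  assumes "input_state s" "agree c s s'" "{''m'', ''n'', ''p'', ''L'', ''U''} \<inter> nwrites c = {}" "''W'' \<notin> rwrites c"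
  shows "input_state s'"
  using assms by (simp add: input_state_def agree_nmem agree_rmem)

lemma offset_state_agree:
  assumes "offset_state s" "agree c s s'" "{''a'', ''b''} \<inter> nwrites c = {}"
  shows "offset_state s'"
  using assms by (simp add: offset_state_def agree_nmem)

lemma class_state_agree:
  assumes "class_state s" "agree c s s'" "{''cl'', ''rk''} \<inter> nwrites c = {}"
  shows "class_state s'"
  using assms by (simp add: class_state_def agree_nmem)

lemma W_at:
  assumes "input_state s" "offset_state s" "i \<in> {1..m}" "j \<in> {1..n}"
  shows "rmem s ''W'' (nmem s ''a'' i + j) = W i j"
  using assms by (simp add: input_state_def offset_state_def)

lemma L_at:
  assumes "input_state s" "offset_state s" "k \<in> {1..n}" "l \<in> {1..p}"
  shows "nmem s ''L'' (nmem s ''b'' k + l) = lower I k l" "nmem s ''U'' (nmem s ''b'' k + l) = upper I k l"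
  using assms by (simp_all add: input_state_def offset_state_def)

lemma run_sum_weights:
  assumes S: "input_state s" "offset_state s"
  shows "run sum_weights s (n * (200 * m)) (\<lambda>s'. rmem s' ''N'' 0 = 1 + 2 * weight)"
proof -
  let ?b = "Seq (RSet ''t'' (NConst 0) (RGet ''W'' (NAdd (At ''a'' ''i'') (Var ''j''))))
        (Cond (RLess (RVar ''t'') (RConst 0))
           (RSet ''N'' (NConst 0) (RSub (RVar ''N'') (RAdd (RVar ''t'') (RVar ''t''))))
           (RSet ''N'' (NConst 0) (RAdd (RVar ''N'') (RAdd (RVar ''t'') (RVar ''t'')))))"
  let ?s0 = "rupd ''N'' 0 1 s"
  let ?O = "\<lambda>i s'. rmem s' ''N'' 0 = 1 + 2 * (\<Sum>i = 1..<i. \<Sum>j = 1..n. \<bar>W i j\<bar>)"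
  have mn: "nmem s ''m'' 0 = m" "nmem s ''n'' 0 = n" using S by (simp_all add: input_state_def)
  have "run sum_weights s (5 + (11 + m * ((11 + n * (60 + 14)) + 14))) (?O (Suc m))"
    unfolding sum_weights_def
  proof (rule run_Seq)
    show "run (RSet ''N'' (NConst 0) (RConst 1)) s 5 (\<lambda>s'. s' = ?s0)"
      by (rule run_loop_free) auto
    fix s0 assume s0: "s0 = ?s0"
    have m0: "nmem s0 ''m'' 0 = m" using mn s0 by simp
    have S0: "input_state s0" "offset_state s0"
      using S by (simp_all add: s0 input_state_def offset_state_def)
    show "run (For ''i'' ''m'' (For ''j'' ''n'' ?b)) s0 (11 + m * ((11 + n * (60 + 14)) + 14)) (?O (Suc m))"
    proof (rule run_For[OF m0], goal_cases)
      case (5 i s1)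
      have S1: "input_state s1" "offset_state s1"
        using input_state_agree[OF S0(1) 5(4)] offset_state_agree[OF S0(2) 5(4)] by simp_all
      have n1: "nmem s1 ''n'' 0 = n" using S1 by (simp add: input_state_def)
      let ?J = "\<lambda>j s'. rmem s' ''N'' 0 = rmem s1 ''N'' 0 + 2 * (\<Sum>j = 1..<j. \<bar>W i j\<bar>)"
      have "run (For ''j'' ''n'' ?b) s1 (11 + n * (60 + 14)) (?J (Suc n))"
      proof (rule run_For_body[OF n1], goal_cases)
        case (7 j s2)
        have S2: "input_state s2" "offset_state s2"
          using input_state_agree[OF S1(1) 7(4)] offset_state_agree[OF S1(2) 7(4)] by simp_all
        have i2: "nmem s2 ''i'' 0 = i" using agree_nmem[OF 7(4)] 5(3) by simp
        have W: "rmem s2 ''W'' (nmem s2 ''a'' i + j) = W i j"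
          using W_at[OF S2] 5(1,2) 7(1,2) by simp
        have "(\<Sum>j = 1..<Suc j. \<bar>W i j\<bar>) = (\<Sum>j = 1..<j. \<bar>W i j\<bar>) + \<bar>W i j\<bar>" using 7(1) by simp
        then show ?case using 7(3,5) i2 W by simp
      qed auto
      then show ?case
      proof (rule run_mono)
        fix s2 :: store assume J: "?J (Suc n) s2"
        have "(\<Sum>i = 1..<Suc i. \<Sum>j = 1..n. \<bar>W i j\<bar>) = (\<Sum>i = 1..<i. \<Sum>j = 1..n. \<bar>W i j\<bar>) + (\<Sum>j = 1..n. \<bar>W i j\<bar>)"
          using 5(1) by simp
        then show "?O (Suc i) (nupd ''i'' 0 (Suc i) s2)"
          using J 5(5) by (simp add: atLeastLessThanSuc_atLeastAtMost)
      qed simp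
    qed (use s0 in auto)
  qed
  then show ?thesis
  proof (rule run_mono)
    fix s' :: store assume "?O (Suc m) s'"
    then show "rmem s' ''N'' 0 = 1 + 2 * weight"
      unfolding weight_def by (subst sum.swap) (simp add: atLeastLessThanSuc_atLeastAtMost)
  next
    define x where "x = n * m"
    have "1 * m \<le> x" unfolding x_def using sizes by (intro mult_le_mono1) simp
    moreover have "5 + (11 + m * ((11 + n * (60 + 14)) + 14)) = 16 + 25 * m + 74 * x" "n * (200 * m) = 200 * x"
      by (simp_all add: x_def algebra_simps)
    ultimately show "5 + (11 + m * ((11 + n * (60 + 14)) + 14)) \<le> n * (200 * m)"
      using sizes by linarith
  qed
qed

lemma run_find_best_later:
  assumes S: "input_state s" "offset_state s" "class_state s" and z: "nmem s ''be'' = (\<lambda>_. 0)"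
  shows "run find_best_later s (11 + m * (100 + 14)) (\<lambda>s'. best_later (nmem s' ''ag''))"
proof -
  \<comment> \<open>Round \<open>k\<close> visits item \<open>m + 1 - k\<close>, so
    \<open>m + 2 \<le> i + k\<close> says without truncated subtraction that item \<open>i\<close>
    was visited before round \<open>k\<close>.\<close>
  let ?A = "\<lambda>k s'. \<forall>i\<in>{1..m}. m + 2 \<le> i + k \<longrightarrow> nmem s' ''ag'' i \<in> {i..m} \<and> cls (nmem s' ''ag'' i) = cls i \<and>
     (cls i = 0 \<longrightarrow> nmem s' ''ag'' i = i) \<and>
     (\<forall>i'\<in>{i..m}. cls i' = cls i \<longrightarrow> cls i \<noteq> 0 \<longrightarrow> W i' n \<le> W (nmem s' ''ag'' i) n)"
  let ?B = "\<lambda>k s'. \<forall>l\<in>{1..p}. (nmem s' ''be'' l = 0 \<and> (\<forall>i\<in>{1..m}. m + 2 \<le> i + k \<longrightarrow> cls i \<noteq> l)) \<or>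
     (nmem s' ''be'' l \<in> {1..m} \<and> m + 2 \<le> nmem s' ''be'' l + k \<and> cls (nmem s' ''be'' l) = l \<and>
      (\<forall>i\<in>{1..m}. m + 2 \<le> i + k \<longrightarrow> cls i = l \<longrightarrow> W i n \<le> W (nmem s' ''be'' l) n))"
  have m: "nmem s ''m'' 0 = m" using S by (simp add: input_state_def)
  have "run find_best_later s (11 + m * (100 + 14)) (\<lambda>s'. ?A (Suc m) s' \<and> ?B (Suc m) s')"
    unfolding find_best_later_def
  proof (rule run_For_body[OF m, where Inv = "\<lambda>k s'. ?A k s' \<and> ?B k s'"], goal_cases)
    case 6
    have "?A 1 (nupd ''k'' 0 1 s)" by auto
    moreover have "?B 1 (nupd ''k'' 0 1 s)" using z by auto
    ultimately show ?case ..
  next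
    case (7 k s1)
    define i where "i = m + 1 - k"
    have i: "i \<in> {1..m}" "i + k = m + 1" using 7(1,2) by (auto simp: i_def)
    have ik: "m + 2 \<le> i' + Suc k \<longleftrightarrow> m + 2 \<le> i' + k \<or> i' = i" for i' using i by linarith
    have Sn: "nmem s1 ''n'' 0 = n" "nmem s1 ''m'' 0 = m" "nmem s1 ''cl'' = nmem s ''cl''"
      using agree_nmem[OF 7(4)] S(1) by (simp_all add: input_state_def)
    have S1: "input_state s1" "offset_state s1"
      using input_state_agree[OF S(1) 7(4)] offset_state_agree[OF S(2) 7(4)] by simp_all
    have cl: "nmem s1 ''cl'' i = cls i" using S(3) i Sn by (simp add: class_state_def)
    have Wn: "rmem s1 ''W'' (nmem s1 ''a'' c + n) = W c n" if "c \<in> {1..m}" for c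
      using W_at[OF S1 that] sizes by simp
    have A: "?A k s1" and B: "?B k s1" using 7(5) by blast+
    let ?l = "cls i"
    \<comment> \<open>The content of \<open>''be''\<close> for the class of \<open>i\<close> after
      this round, if that class is not 0; in a tie the item found before stays.\<close>
    define b where "b = (if nmem s1 ''be'' ?l \<noteq> 0 \<and> \<not> W (nmem s1 ''be'' ?l) n < W i n then nmem s1 ''be'' ?l else i)"
    define ag where "ag = (nmem s1 ''ag'')(i := if ?l = 0 then i else b)"
    define be where "be = (if ?l = 0 then nmem s1 ''be'' else (nmem s1 ''be'')(?l := b))"
    have bel: "nmem s1 ''be'' ?l \<noteq> 0 \<longrightarrow> nmem s1 ''be'' ?l \<in> {1..m}" if "?l \<noteq> 0"
      using B cls_le[of i] that by (metis One_nat_def Suc_leI atLeastAtMost_iff neq0_conv)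
    have b: "b \<in> {1..m}" "m + 2 \<le> b + Suc k" "cls b = ?l"
       "\<And>i'. i' \<in> {1..m} \<Longrightarrow> m + 2 \<le> i' + Suc k \<Longrightarrow> cls i' = ?l \<Longrightarrow> W i' n \<le> W b n" if l: "?l \<noteq> 0"
    proof -
      have "?l \<in> {1..p}" using l cls_le[of i] by simp
      from bspec[OF B this] consider "nmem s1 ''be'' ?l = 0" "\<forall>i'\<in>{1..m}. m + 2 \<le> i' + k \<longrightarrow> cls i' \<noteq> ?l" |
        "nmem s1 ''be'' ?l \<in> {1..m}" "m + 2 \<le> nmem s1 ''be'' ?l + k" "cls (nmem s1 ''be'' ?l) = ?l"
        "\<forall>i'\<in>{1..m}. m + 2 \<le> i' + k \<longrightarrow> cls i' = ?l \<longrightarrow> W i' n \<le> W (nmem s1 ''be'' ?l) n"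
        by (elim disjE conjE)
      then have "b \<in> {1..m} \<and> m + 2 \<le> b + Suc k \<and> cls b = ?l \<and>
        (\<forall>i'\<in>{1..m}. m + 2 \<le> i' + Suc k \<longrightarrow> cls i' = ?l \<longrightarrow> W i' n \<le> W b n)"
      proof cases
        case 1
        then have "b = i" by (simp add: b_def)
        then show ?thesis using 1(2) i unfolding ik by auto
      next
        case 2
        show ?thesis
        proof (cases "W (nmem s1 ''be'' ?l) n < W i n")
          case True
          then have "b = i" by (simp add: b_def)
          then show ?thesis using 2(4) True i unfolding ik by fastforce
        next
          case False
          then have "b = nmem s1 ''be'' ?l" using 2(1) by (simp add: b_def)
          then show ?thesis using 2 False unfolding ik by auto
        qed
      qed
      then show "b \<in> {1..m}" "m + 2 \<le> b + Suc k" "cls b = ?l"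
       "\<And>i'. i' \<in> {1..m} \<Longrightarrow> m + 2 \<le> i' + Suc k \<Longrightarrow> cls i' = ?l \<Longrightarrow> W i' n \<le> W b n"
        by blast+
    qed
    have A': "\<forall>i\<in>{1..m}. m + 2 \<le> i + Suc k \<longrightarrow> ag i \<in> {i..m} \<and> cls (ag i) = cls i \<and>
       (cls i = 0 \<longrightarrow> ag i = i) \<and> (\<forall>i'\<in>{i..m}. cls i' = cls i \<longrightarrow> cls i \<noteq> 0 \<longrightarrow> W i' n \<le> W (ag i) n)"
    proof (intro ballI impI)
      fix c assume c: "c \<in> {1..m}" "m + 2 \<le> c + Suc k"
      show "ag c \<in> {c..m} \<and> cls (ag c) = cls c \<and>
       (cls c = 0 \<longrightarrow> ag c = c) \<and> (\<forall>i'\<in>{c..m}. cls i' = cls c \<longrightarrow> cls c \<noteq> 0 \<longrightarrow> W i' n \<le> W (ag c) n)"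
      proof (cases "c = i")
        case False
        then have "m + 2 \<le> c + k" using c ik by blast
        then show ?thesis using A c False unfolding ag_def by simp
      next
        case True
        show ?thesis
        proof (cases "?l = 0")
          case True
          then show ?thesis using \<open>c = i\<close> i by (simp add: ag_def)
        next
          case False
          have "i \<le> b" using b(2)[OF False] i by linarith
          moreover have "W i' n \<le> W b n" if "i' \<in> {i..m}" "cls i' = ?l" for i'
            using b(4)[OF False, of i'] that i by auto
          ultimately show ?thesis using \<open>c = i\<close> False b(1,3)[OF False] by (simp add: ag_def)
        qed
      qed
    qed
    have B': "\<forall>l\<in>{1..p}. (be l = 0 \<and> (\<forall>i\<in>{1..m}. m + 2 \<le> i + Suc k \<longrightarrow> cls i \<noteq> l)) \<or>
     (be l \<in> {1..m} \<and> m + 2 \<le> be l + Suc k \<and> cls (be l) = l \<and>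
      (\<forall>i\<in>{1..m}. m + 2 \<le> i + Suc k \<longrightarrow> cls i = l \<longrightarrow> W i n \<le> W (be l) n))"
    proof
      fix l assume l: "l \<in> {1..p}"
      show "(be l = 0 \<and> (\<forall>i\<in>{1..m}. m + 2 \<le> i + Suc k \<longrightarrow> cls i \<noteq> l)) \<or>
     (be l \<in> {1..m} \<and> m + 2 \<le> be l + Suc k \<and> cls (be l) = l \<and>
      (\<forall>i\<in>{1..m}. m + 2 \<le> i + Suc k \<longrightarrow> cls i = l \<longrightarrow> W i n \<le> W (be l) n))"
      proof (cases "l = ?l")
        case True
        then have "?l \<noteq> 0" using l by auto
        then show ?thesis using b True by (simp add: be_def)
      next
        case False
        then have "be l = nmem s1 ''be'' l" by (simp add: be_def)
        moreover have "(nmem s1 ''be'' l = 0 \<and> (\<forall>i\<in>{1..m}. m + 2 \<le> i + k \<longrightarrow> cls i \<noteq> l)) \<or>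
          (nmem s1 ''be'' l \<in> {1..m} \<and> m + 2 \<le> nmem s1 ''be'' l + k \<and> cls (nmem s1 ''be'' l) = l \<and>
          (\<forall>i\<in>{1..m}. m + 2 \<le> i + k \<longrightarrow> cls i = l \<longrightarrow> W i n \<le> W (nmem s1 ''be'' l) n))"
          using B l by blast
        ultimately show ?thesis using False unfolding ik by auto
      qed
    qed
    define c where "c = Seq
     (NSet ''i'' (NConst 0) (NSub (NAdd (Var ''m'') (NConst 1)) (Var ''k''))) (Seq
     (NSet ''l'' (NConst 0) (At ''cl'' ''i''))
     (Cond (IsZero (Var ''l'')) (NSet ''ag'' (Var ''i'') (Var ''i'')) (Seq
        (Cond (BAnd (NonZero (At ''be'' ''l''))
                 (BNot (RLess (RGet ''W'' (NAdd (NGet ''a'' (At ''be'' ''l'')) (Var ''n'')))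
                              (RGet ''W'' (NAdd (At ''a'' ''i'') (Var ''n''))))))
           Skip (NSet ''be'' (Var ''l'') (Var ''i'')))
        (NSet ''ag'' (Var ''i'') (At ''be'' ''l'')))))"
    have i1: "Suc m - k = i" by (simp add: i_def)
    have "nmem (result c s1) ''ag'' = ag \<and> nmem (result c s1) ''be'' = be"
    proof (cases "?l = 0")
      case True
      then show ?thesis using 7(3) cl by (simp add: c_def ag_def be_def Sn(2) i1)
    next
      case False
      show ?thesis
      proof (cases "nmem s1 ''be'' ?l \<noteq> 0 \<and> \<not> W (nmem s1 ''be'' ?l) n < W i n")
        case True
        then have "nmem s1 ''be'' ?l \<in> {1..m}" using bel[OF False] by blast
        then show ?thesis
          using 7(3) cl True False Wn[OF i(1)] Wn[of "nmem s1 ''be'' ?l"]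
          by (simp add: c_def ag_def be_def b_def Sn(1,2) i1)
      next
        case False
        then have "nmem s1 ''be'' ?l = 0 \<or> (nmem s1 ''be'' ?l \<in> {1..m} \<and> W (nmem s1 ''be'' ?l) n < W i n)"
          using bel[OF \<open>?l \<noteq> 0\<close>] by blast
        then show ?thesis
          using 7(3) cl \<open>?l \<noteq> 0\<close> Wn[OF i(1)] Wn[of "nmem s1 ''be'' ?l"]
          by (elim disjE) (simp_all add: c_def ag_def be_def b_def Sn(1,2) i1)
      qed
    qed
    then show ?case unfolding c_def[symmetric] using A' B' by simp
  qed simp_all
  then show ?thesis
    by (rule run_mono) (auto simp: best_later_def)
qed

lemma run_check_bounds:
  assumes S: "input_state s" "offset_state s" "class_state s"
    and i: "nmem s ''i'' 0 = i" "i \<in> {1..m}" and l: "nmem s ''l'' 0 = cls i" "cls i \<noteq> 0" and j: "nmem s ''j'' 0 = j"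
    and z: "nmem s ''md'' 0 = 0" "nmem s ''bd'' 0 = 0"
  shows "run check_bounds s (11 + n * (100 + 14)) (\<lambda>s'. (nmem s' ''md'' 0 = 0 \<longleftrightarrow> \<not> mandatory i) \<and>
     (nmem s' ''bd'' 0 = 0 \<longleftrightarrow> allowed i j))"
proof -
  have n: "nmem s ''n'' 0 = n" using S by (simp add: input_state_def)
  have lp: "cls i \<in> {1..p}" using l cls_le[of i] by simp
  let ?Inv = "\<lambda>k s'. (nmem s' ''md'' 0 = 0 \<longleftrightarrow> (\<forall>k\<in>{1..<k}. lower I k (cls i) < rank i)) \<and>
     (nmem s' ''bd'' 0 = 0 \<longleftrightarrow>
       (\<forall>k\<in>{1..<k}. (j \<le> k \<longrightarrow> rank i \<le> upper I k (cls i)) \<and> (k < j \<longrightarrow> lower I k (cls i) < rank i)))"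
  have "run check_bounds s (11 + n * (100 + 14)) (?Inv (Suc n))"
    unfolding check_bounds_def
  proof (rule run_For_body[OF n], goal_cases)
    case (7 k s')
    have S': "input_state s'" "offset_state s'"
      using input_state_agree[OF S(1) 7(4)] offset_state_agree[OF S(2) 7(4)] by simp_all
    have f: "nmem s' ''i'' 0 = i" "nmem s' ''l'' 0 = cls i" "nmem s' ''j'' 0 = j" "nmem s' ''rk'' i = rank i"
      using agree_nmem[OF 7(4)] i l j S(3) by (simp_all add: class_state_def)
    have LU: "nmem s' ''L'' (nmem s' ''b'' k + cls i) = lower I k (cls i)"
        "nmem s' ''U'' (nmem s' ''b'' k + cls i) = upper I k (cls i)"
      using L_at[OF S' _ lp, of k] 7(1,2) by simp_all
    have "{1..<Suc k} = insert k {1..<k}" using 7(1) by auto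
    then show ?case
      using 7(3,5) f LU
      by (cases "lower I k (cls i) < rank i"; cases "upper I k (cls i) < rank i"; cases "k < j")
        (simp_all add: linorder_not_less)
  qed (use z in auto)
  then show ?thesis
  proof (rule run_mono)
    fix s' :: store assume "?Inv (Suc n) s'"
    then show "(nmem s' ''md'' 0 = 0 \<longleftrightarrow> \<not> mandatory i) \<and> (nmem s' ''bd'' 0 = 0 \<longleftrightarrow> allowed i j)"
      using l(2) unfolding mandatory_def allowed_def atLeastLessThanSuc_atLeastAtMost
      by (simp add: linorder_not_less) (meson not_le)
  qed simp
qed

lemma run_cost_entry:
  assumes S: "input_state s" "offset_state s" "class_state s" and ag: "best_later (nmem s ''ag'')"
    and i: "nmem s ''i'' 0 = i" "i \<in> {1..m}" and j: "nmem s ''j'' 0 = j" "j \<in> {1..n}"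
  shows "run cost_entry s (300 * n) (\<lambda>s'. rmem s' ''D'' =
     (rmem s ''D'')(i * n + j := cost (nmem s ''ag'') (rmem s ''N'' 0) j i))"
proof -
  let ?c1 = "Seq (NSet ''md'' (NConst 0) (NConst 0)) (Seq (NSet ''bd'' (NConst 0) (NConst 0))
        (NSet ''l'' (NConst 0) (At ''cl'' ''i'')))"
  define s1 where "s1 = nupd ''l'' 0 (cls i) (nupd ''bd'' 0 0 (nupd ''md'' 0 0 s))"
  have "result ?c1 s = s1" using S(3) i by (simp add: s1_def class_state_def)
  then have "run ?c1 s 20 (\<lambda>s'. s' = s1)" by (intro run_loop_free) auto
  then obtain t1 where e1: "exec ?c1 s t1 s1" "t1 \<le> 20" unfolding run_def by blast
  have a1: "agree ?c1 s s1" by (rule exec_agree[OF e1(1)])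
  have S1: "input_state s1" "offset_state s1" "class_state s1"
    using input_state_agree[OF S(1) a1] offset_state_agree[OF S(2) a1] class_state_agree[OF S(3) a1] by simp_all
  let ?Q = "\<lambda>s'. (nmem s' ''md'' 0 = 0 \<longleftrightarrow> \<not> mandatory i) \<and> (nmem s' ''bd'' 0 = 0 \<longleftrightarrow> allowed i j)"
  have "run (Cond (NonZero (Var ''l'')) check_bounds Skip) s1 (1 + bcost (NonZero (Var ''l'')) + (11 + n * (100 + 14))) ?Q"
  proof (rule run_Cond)
    assume "bval (NonZero (Var ''l'')) s1"
    then have "cls i \<noteq> 0" by (simp add: s1_def)
    then show "run check_bounds s1 (11 + n * (100 + 14)) ?Q"
      using i j by (intro run_check_bounds S1) (simp_all add: s1_def)
  next
    assume "\<not> bval (NonZero (Var ''l'')) s1"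
    then have "cls i = 0" by (simp add: s1_def)
    then show "run Skip s1 (11 + n * (100 + 14)) ?Q"
      by (intro run_loop_free) (simp_all add: s1_def mandatory_def allowed_def)
  qed
  then obtain t2 s2 where e2: "exec (Cond (NonZero (Var ''l'')) check_bounds Skip) s1 t2 s2"
    "t2 \<le> 1 + bcost (NonZero (Var ''l'')) + (11 + n * (100 + 14))" and Q: "?Q s2"
    and a2: "agree (Cond (NonZero (Var ''l'')) check_bounds Skip) s1 s2"
    by (rule runE)
  have f: "nmem s2 ''i'' 0 = i" "nmem s2 ''j'' 0 = j" "nmem s2 ''n'' 0 = n" "nmem s2 ''ag'' = nmem s ''ag''"
    "nmem s2 ''a'' i = i * n" "rmem s2 ''D'' = rmem s ''D''" "rmem s2 ''N'' = rmem s ''N''"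
    using i j S(1,2) by (simp_all add: agree_nmem[OF a2] agree_rmem[OF a2] s1_def input_state_def offset_state_def)
  have S2: "input_state s2" "offset_state s2"
    using input_state_agree[OF S1(1) a2] offset_state_agree[OF S1(2) a2] by simp_all
  let ?c3 = "Cond (NLess (Var ''j'') (Var ''n''))
             (RSet ''t'' (NConst 0) (RGet ''W'' (NAdd (At ''a'' ''i'') (Var ''j''))))
             (RSet ''t'' (NConst 0) (RGet ''W'' (NAdd (NGet ''a'' (At ''ag'' ''i'')) (Var ''n''))))"
  define s3 where "s3 = rupd ''t'' 0 (adj_val (nmem s ''ag'') j i) s2"
  have "nmem s ''ag'' i \<in> {1..m}" using best_laterD(1)[OF ag i(2)] .
  then have "rmem s2 ''W'' (nmem s2 ''a'' (nmem s ''ag'' i) + n) = W (nmem s ''ag'' i) n"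
    using W_at[OF S2] sizes by simp
  then have "result ?c3 s2 = s3"
    using W_at[OF S2 i(2) j(2)] j(2) by (cases "j = n") (simp_all add: f s3_def adj_val_def)
  then have "run ?c3 s2 40 (\<lambda>s'. s' = s3)" by (intro run_loop_free) auto
  then obtain t3 where e3: "exec ?c3 s2 t3 s3" "t3 \<le> 40" unfolding run_def by blast
  let ?c4 = "Cond (NonZero (Var ''bd''))
             (RSet ''D'' (NAdd (At ''a'' ''i'') (Var ''j'')) (RSub (RAdd (RVar ''N'') (RAdd (RVar ''N'') (RVar ''N''))) (RVar ''t'')))
             (Cond (NonZero (Var ''md''))
                (RSet ''D'' (NAdd (At ''a'' ''i'') (Var ''j'')) (RSub (RVar ''N'') (RVar ''t'')))
                (RSet ''D'' (NAdd (At ''a'' ''i'') (Var ''j'')) (RSub (RAdd (RVar ''N'') (RVar ''N'')) (RVar ''t''))))"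
  define s4 where "s4 = rupd ''D'' (i * n + j) (cost (nmem s ''ag'') (rmem s ''N'' 0) j i) s3"
  have "result ?c4 s3 = s4"
    using Q by (cases "allowed i j"; cases "mandatory i") (simp_all add: f s3_def s4_def cost_def penalty_def)
  then have "run ?c4 s3 90 (\<lambda>s'. s' = s4)" by (intro run_loop_free) auto
  then obtain t4 where e4: "exec ?c4 s3 t4 s4" "t4 \<le> 90" unfolding run_def by blast
  have "exec cost_entry s (t1 + (t2 + (t3 + t4))) s4"
    unfolding cost_entry_def by (rule exec.Seq[OF e1(1) exec.Seq[OF e2(1) exec.Seq[OF e3(1) e4(1)]]])
  moreover have "t1 + (t2 + (t3 + t4)) \<le> 300 * n"
    using e1(2) e2(2) e3(2) e4(2) sizes by simp
  moreover have "rmem s4 ''D'' = (rmem s ''D'')(i * n + j := cost (nmem s ''ag'') (rmem s ''N'' 0) j i)"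
    by (simp add: s4_def s3_def f)
  ultimately show ?thesis unfolding run_def by blast
qed

lemma run_cost_matrix:
  assumes S: "input_state s" "offset_state s" "class_state s" and ag: "best_later (nmem s ''ag'')"
  shows "run cost_matrix s (n * (n * (400 * m))) (\<lambda>s'. \<forall>i\<in>{1..m}. \<forall>j\<in>{1..n}.
     rmem s' ''D'' (i * n + j) = cost (nmem s ''ag'') (rmem s ''N'' 0) j i)"
proof -
  let ?f = "cost (nmem s ''ag'') (rmem s ''N'' 0)"
  let ?O = "\<lambda>i s'. \<forall>i'\<in>{1..<i}. \<forall>j\<in>{1..n}. rmem s' ''D'' (i' * n + j) = ?f j i'"
  have m: "nmem s ''m'' 0 = m" using S by (simp add: input_state_def)
  have "run cost_matrix s (11 + m * ((11 + n * (300 * n + 14)) + 14)) (?O (Suc m))"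
    unfolding cost_matrix_def
  proof (rule run_For[OF m], goal_cases)
    case (5 i s1)
    have S1: "input_state s1" "offset_state s1" "class_state s1"
      using input_state_agree[OF S(1) 5(4)] offset_state_agree[OF S(2) 5(4)] class_state_agree[OF S(3) 5(4)]
      by simp_all
    have f1: "nmem s1 ''ag'' = nmem s ''ag''" "rmem s1 ''N'' = rmem s ''N''"
      using agree_nmem[OF 5(4)] agree_rmem[OF 5(4)] by simp_all
    have n1: "nmem s1 ''n'' 0 = n" using S1 by (simp add: input_state_def)
    have i: "i \<in> {1..m}" using 5 by simp
    let ?J = "\<lambda>j s'. ?O i s' \<and> (\<forall>j'\<in>{1..<j}. rmem s' ''D'' (i * n + j') = ?f j' i)"
    have "run (For ''j'' ''n'' cost_entry) s1 (11 + n * (300 * n + 14)) (?J (Suc n))"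
    proof (rule run_For[OF n1], goal_cases)
      case (5 j s2)
      have S2: "input_state s2" "offset_state s2" "class_state s2"
        using input_state_agree[OF S1(1) 5(4)] offset_state_agree[OF S1(2) 5(4)] class_state_agree[OF S1(3) 5(4)]
        by simp_all
      have f2: "nmem s2 ''ag'' = nmem s ''ag''" "rmem s2 ''N'' = rmem s ''N''" "nmem s2 ''i'' 0 = i"
        using agree_nmem[OF 5(4)] agree_rmem[OF 5(4)] f1 \<open>nmem s1 ''i'' 0 = i\<close> by simp_all
      have j: "j \<in> {1..n}" using 5 by simp
      have "run cost_entry s2 (300 * n) (\<lambda>s'. rmem s' ''D'' = (rmem s2 ''D'')(i * n + j := ?f j i))"
        using run_cost_entry[OF S2 _ f2(3) i 5(3) j] ag f2 by simp
      then show ?case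
      proof (rule run_mono)
        fix s3 :: store assume D: "rmem s3 ''D'' = (rmem s2 ''D'')(i * n + j := ?f j i)"
        have J: "?J j s2" by (rule 5(5))
        have "rmem s3 ''D'' (i' * n + j') = ?f j' i'" if "i' \<in> {1..<i}" "j' \<in> {1..n}" for i' j'
          using D J that index_inj[OF j that(2), of i i'] by auto
        moreover have "rmem s3 ''D'' (i * n + j') = ?f j' i" if "j' \<in> {1..<Suc j}" for j'
          using D J that by (cases "j' = j") auto
        ultimately show "?J (Suc j) (nupd ''j'' 0 (Suc j) s3)" by simp
      qed simp
    qed (use 5 in auto)
    then show ?case
    proof (rule run_mono)
      fix s2 :: store assume "?J (Suc n) s2"
      then show "?O (Suc i) (nupd ''i'' 0 (Suc i) s2)"
        by (auto simp: less_Suc_eq atLeastLessThanSuc_atLeastAtMost)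
    qed simp
  qed auto
  then show ?thesis
  proof (rule run_mono)
    define x where "x = n * (n * m)"
    have "1 * (1 * m) \<le> x" "1 * (n * m) \<le> x" unfolding x_def using sizes by (intro mult_le_mono; simp)+
    moreover have "11 + m * ((11 + n * (300 * n + 14)) + 14) = 11 + 25 * m + 300 * x + 14 * (n * m)"
       "n * (n * (400 * m)) = 400 * x"
      by (simp_all add: x_def algebra_simps)
    ultimately show "11 + m * ((11 + n * (300 * n + 14)) + 14) \<le> n * (n * (400 * m))"
      using sizes by linarith
  qed (simp add: atLeastLessThanSuc_atLeastAtMost)
qed

end

section \<open>Output\<close>

text \<open>Equality is tested by two comparisons. The order of the writes matters: if
  \<open>ag c = c\<close>, the second one leaves position \<open>n\<close> in place.\<close>

definition swap_last_item :: com where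
  "swap_last_item = Seq
     (For ''i'' ''m'' (Cond (BAnd (BNot (NLess (At ''q'' ''i'') (Var ''n''))) (BNot (NLess (Var ''n'') (At ''q'' ''i''))))
        (NSet ''c'' (NConst 0) (Var ''i'')) Skip))
     (Seq (NSet ''g'' (NConst 0) (NGet ''q'' (At ''ag'' ''c'')))
     (Seq (NSet ''q'' (Var ''c'') (Var ''g'')) (NSet ''q'' (At ''ag'' ''c'') (Var ''n''))))"

text \<open>\<open>''x''\<close> is zero initially, so only the ones are written.
  \<open>''ip''\<close> inverts the matching, so that the verification can walk through the
  positions.\<close>

definition write_ranking :: com where
  "write_ranking = For ''i'' ''m'' (Cond (NonZero (At ''q'' ''i''))
     (Seq (NSet ''x'' (NAdd (At ''a'' ''i'') (At ''q'' ''i'')) (NConst 1)) (NSet ''ip'' (At ''q'' ''i'') (Var ''i''))) Skip)"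

definition verify_position :: com where
  "verify_position = For ''l'' ''p''
     (Cond (BAnd (BNot (NLess (At ''ct'' ''l'') (NGet ''L'' (NAdd (At ''b'' ''k'') (Var ''l'')))))
                 (BNot (NLess (NGet ''U'' (NAdd (At ''b'' ''k'') (Var ''l''))) (At ''ct'' ''l''))))
        Skip (NSet ''feasible'' (NConst 0) (NConst 0)))"

text \<open>Counts are kept incrementally, one item per position, which leaves \<open>p\<close>
  checks for each of the \<open>n\<close> positions. Cell 0 of \<open>''ct''\<close> collects the
  items of class 0, which have no bounds.\<close>

definition verify :: com where
  "verify = Seq (NSet ''feasible'' (NConst 0) (NConst 1)) (For ''k'' ''n'' (Seq
     (Seq (NSet ''g'' (NConst 0) (NGet ''cl'' (At ''ip'' ''k'')))
        (NSet ''ct'' (Var ''g'') (NAdd (At ''ct'' ''g'') (NConst 1)))) verify_position))"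

lemma writes_output [simp]:
  "nwrites swap_last_item = {''i'', ''c'', ''g'', ''q''}" "rwrites swap_last_item = {}"
  "nwrites write_ranking = {''i'', ''x'', ''ip''}" "rwrites write_ranking = {}"
  "nwrites verify_position = {''l'', ''feasible''}" "rwrites verify_position = {}"
  "nwrites verify = {''k'', ''g'', ''ct'', ''l'', ''feasible''}" "rwrites verify = {}"
  by (auto simp: swap_last_item_def write_ranking_def verify_position_def verify_def)

section \<open>Correctness of the output\<close>

context lu_problem
begin

lemma run_swap_last_item:
  assumes mn: "nmem s ''m'' 0 = m" "nmem s ''n'' 0 = n" and q: "matching n m (nmem s ''q'')"
  shows "run swap_last_item s (40 + m * (60 + 14)) (\<lambda>s'. \<exists>c\<in>{1..m}. nmem s ''q'' c = n \<and>
     nmem s' ''q'' = (nmem s ''q'')(c := nmem s ''q'' (nmem s ''ag'' c), nmem s ''ag'' c := n))"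
proof -
  let ?Inv = "\<lambda>k s'. (\<exists>i\<in>{1..<k}. nmem s ''q'' i = n) \<longrightarrow> nmem s' ''c'' 0 \<in> {1..m} \<and> nmem s ''q'' (nmem s' ''c'' 0) = n"
  let ?f = "For ''i'' ''m'' (Cond (BAnd (BNot (NLess (At ''q'' ''i'') (Var ''n''))) (BNot (NLess (Var ''n'') (At ''q'' ''i''))))
        (NSet ''c'' (NConst 0) (Var ''i'')) Skip)"
  have "run ?f s (11 + m * (60 + 14)) (?Inv (Suc m))"
  proof (rule run_For_body[OF mn(1)], goal_cases)
    case (7 k s')
    have "nmem s' ''q'' = nmem s ''q''" "nmem s' ''n'' 0 = n" using agree_nmem[OF 7(4)] mn by simp_all
    then show ?case using 7(1,2,3,5) by (cases "nmem s ''q'' k = n") (auto simp: less_Suc_eq)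
  qed auto
  then obtain t1 s1 where e1: "exec ?f s t1 s1" "t1 \<le> 11 + m * (60 + 14)" and I: "?Inv (Suc m) s1" and a1: "agree ?f s s1"
    by (rule runE)
  have "\<exists>!c. c \<in> {1..m} \<and> nmem s ''q'' c = n" using q sizes unfolding matching_def by simp
  then obtain c' where "c' \<in> {1..m}" "nmem s ''q'' c' = n" by blast
  then have c: "nmem s1 ''c'' 0 \<in> {1..m}" "nmem s ''q'' (nmem s1 ''c'' 0) = n"
    using I by (auto simp: atLeastLessThanSuc_atLeastAtMost)
  have f: "nmem s1 ''q'' = nmem s ''q''" "nmem s1 ''ag'' = nmem s ''ag''" "nmem s1 ''n'' 0 = n"
    using agree_nmem[OF a1] mn by simp_all
  let ?c = "Seq (NSet ''g'' (NConst 0) (NGet ''q'' (At ''ag'' ''c'')))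
     (Seq (NSet ''q'' (Var ''c'') (Var ''g'')) (NSet ''q'' (At ''ag'' ''c'') (Var ''n'')))"
  have "run ?c s1 25 (\<lambda>s'. s' = result ?c s1)" by (rule run_loop_free) auto
  then obtain t2 where e2: "exec ?c s1 t2 (result ?c s1)" "t2 \<le> 25" unfolding run_def by blast
  have "nmem (result ?c s1) ''q'' = (nmem s ''q'')(nmem s1 ''c'' 0 := nmem s ''q'' (nmem s ''ag'' (nmem s1 ''c'' 0)),
     nmem s ''ag'' (nmem s1 ''c'' 0) := n)"
    by (simp add: f)
  moreover have "exec swap_last_item s (t1 + t2) (result ?c s1)"
    unfolding swap_last_item_def by (rule exec.Seq[OF e1(1) e2(1)])
  moreover have "t1 + t2 \<le> 40 + m * (60 + 14)" using e1(2) e2(2) by simp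
  ultimately show ?thesis unfolding run_def using c by blast
qed

lemma run_write_ranking:
  assumes mn: "nmem s ''m'' 0 = m" and o: "offset_state s" and q: "matching n m (nmem s ''q'')"
    and z: "nmem s ''x'' = (\<lambda>_. 0)"
  shows "run write_ranking s (11 + m * (60 + 14)) (\<lambda>s'.
     (\<forall>i\<in>{1..m}. \<forall>j\<in>{1..n}. nmem s' ''x'' (i * n + j) = (if nmem s ''q'' i = j then 1 else 0)) \<and>
     (\<forall>i\<in>{1..m}. nmem s ''q'' i \<noteq> 0 \<longrightarrow> nmem s' ''ip'' (nmem s ''q'' i) = i))"
proof -
  let ?q = "nmem s ''q''"
  let ?X = "\<lambda>k s'. \<forall>i\<in>{1..m}. \<forall>j\<in>{1..n}. nmem s' ''x'' (i * n + j) = (if i < k \<and> ?q i = j then 1 else 0)"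
  let ?Y = "\<lambda>k s'. \<forall>i\<in>{1..m}. i < k \<longrightarrow> ?q i \<noteq> 0 \<longrightarrow> nmem s' ''ip'' (?q i) = i"
  have qn: "?q i \<le> n" if "i \<in> {1..m}" for i using q that unfolding matching_def by blast
  have "run write_ranking s (11 + m * (60 + 14)) (\<lambda>s'. ?X (Suc m) s' \<and> ?Y (Suc m) s')"
    unfolding write_ranking_def
  proof (rule run_For_body[OF mn, where Inv = "\<lambda>k s'. ?X k s' \<and> ?Y k s'"], goal_cases)
    case (7 k s')
    define c where "c = Cond (NonZero (At ''q'' ''i''))
     (Seq (NSet ''x'' (NAdd (At ''a'' ''i'') (At ''q'' ''i'')) (NConst 1)) (NSet ''ip'' (At ''q'' ''i'') (Var ''i''))) Skip"
    have k: "k \<in> {1..m}" using 7 by simp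
    have f: "nmem s' ''q'' = ?q" "nmem s' ''a'' k = k * n"
      using agree_nmem[OF 7(4)] o k by (simp_all add: offset_state_def)
    have X: "?X k s'" and Y: "?Y k s'" using 7(5) by blast+
    show ?case
    proof (cases "?q k = 0")
      case True
      then have "result c s' = s'" using 7(3) f by (simp add: c_def)
      moreover have "?X (Suc k) s'"
      proof (intro ballI)
        fix i j assume ij: "i \<in> {1..m}" "j \<in> {1..n}"
        then show "nmem s' ''x'' (i * n + j) = (if i < Suc k \<and> ?q i = j then 1 else 0)"
          using X True by (cases "i = k") auto
      qed
      moreover have "?Y (Suc k) s'" using Y True by (auto simp: less_Suc_eq)
      ultimately show ?thesis unfolding c_def[symmetric] by simp
    next
      case False
      then have r: "nmem (result c s') ''x'' = (nmem s' ''x'')(k * n + ?q k := 1)"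
        "nmem (result c s') ''ip'' = (nmem s' ''ip'')(?q k := k)"
        using 7(3) f by (simp_all add: c_def)
      have qk: "?q k \<in> {1..n}" using qn[OF k] False by simp
      have "?X (Suc k) (result c s')"
      proof (intro ballI)
        fix i j assume ij: "i \<in> {1..m}" "j \<in> {1..n}"
        then show "nmem (result c s') ''x'' (i * n + j) = (if i < Suc k \<and> ?q i = j then 1 else 0)"
          using X index_inj[OF ij(2) qk, of i k] by (auto simp: r less_Suc_eq)
      qed
      moreover have "?Y (Suc k) (result c s')"
      proof (intro ballI impI)
        fix i assume i: "i \<in> {1..m}" "i < Suc k" "?q i \<noteq> 0"
        have "?q i = ?q k \<Longrightarrow> i = k"
          using inj_onD[OF bij_betw_imp_inj_on[OF matching_bij[OF q]], of i k] i k False by simp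
        then show "nmem (result c s') ''ip'' (?q i) = i"
          using Y i by (cases "i = k") (auto simp: r)
      qed
      ultimately show ?thesis unfolding c_def[symmetric] by simp
    qed
  qed (use z in auto)
  then show ?thesis by (rule run_mono) auto
qed

text \<open>Exactly one item sits at position \<open>k\<close>, so at most one class count changes
  there.\<close>

lemma count_Suc:
  assumes q: "matching n m q" and c: "c \<in> {1..m}" "q c = k" and k: "1 \<le> k" "k \<le> n"
  shows "count q l k = count q l (k - 1) + (if cls c = l then 1 else 0)"
proof -
  have "\<exists>!c. c \<in> {1..m} \<and> q c = k" using q k unfolding matching_def by simp
  then have u: "i = c" if "i \<in> {1..m}" "q i = k" for i using that c by blast
  show ?thesis
  proof (cases "cls c = l")
    case True
    have "{i \<in> {1..m}. cls i = l \<and> q i \<in> {1..k}} = insert c {i \<in> {1..m}. cls i = l \<and> q i \<in> {1..k - 1}}"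
    proof (intro equalityI subsetI)
      fix i assume "i \<in> {i \<in> {1..m}. cls i = l \<and> q i \<in> {1..k}}"
      then show "i \<in> insert c {i \<in> {1..m}. cls i = l \<and> q i \<in> {1..k - 1}}"
        using u[of i] by (cases "q i = k") auto
    next
      fix i assume "i \<in> insert c {i \<in> {1..m}. cls i = l \<and> q i \<in> {1..k - 1}}"
      then show "i \<in> {i \<in> {1..m}. cls i = l \<and> q i \<in> {1..k}}"
        using c k True by auto
    qed
    moreover have "c \<notin> {i \<in> {1..m}. cls i = l \<and> q i \<in> {1..k - 1}}" using c k by auto
    ultimately show ?thesis using True by (simp add: count_def)
  next
    case False
    have "{i \<in> {1..m}. cls i = l \<and> q i \<in> {1..k}} = {i \<in> {1..m}. cls i = l \<and> q i \<in> {1..k - 1}}"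
    proof (intro equalityI subsetI)
      fix i assume "i \<in> {i \<in> {1..m}. cls i = l \<and> q i \<in> {1..k}}"
      then show "i \<in> {i \<in> {1..m}. cls i = l \<and> q i \<in> {1..k - 1}}"
        using u[of i] False by (cases "q i = k") auto
    qed auto
    then show ?thesis using False by (simp add: count_def)
  qed
qed

lemma run_verify_position:
  assumes S: "input_state s" "offset_state s" and k: "nmem s ''k'' 0 = k" "k \<in> {1..n}"
    and ct: "\<forall>l\<in>{1..p}. nmem s ''ct'' l = count q l k"
  shows "run verify_position s (11 + p * (60 + 14)) (\<lambda>s'. nmem s' ''feasible'' 0 =
     (if \<forall>l\<in>{1..p}. lower I k l \<le> count q l k \<and> count q l k \<le> upper I k l then nmem s ''feasible'' 0 else 0))"
proof -
  have p: "nmem s ''p'' 0 = p" using S by (simp add: input_state_def)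
  let ?Inv = "\<lambda>l s'. nmem s' ''feasible'' 0 =
     (if \<forall>l\<in>{1..<l}. lower I k l \<le> count q l k \<and> count q l k \<le> upper I k l then nmem s ''feasible'' 0 else 0)"
  have "run verify_position s (11 + p * (60 + 14)) (?Inv (Suc p))"
    unfolding verify_position_def
  proof (rule run_For_body[OF p], goal_cases)
    case (7 l s')
    have S': "input_state s'" "offset_state s'"
      using input_state_agree[OF S(1) 7(4)] offset_state_agree[OF S(2) 7(4)] by simp_all
    have l: "l \<in> {1..p}" using 7 by simp
    have f: "nmem s' ''k'' 0 = k" "nmem s' ''ct'' l = count q l k"
      using agree_nmem[OF 7(4)] k ct l by simp_all
    have "{1..<Suc l} = insert l {1..<l}" using 7(1) by auto
    then show ?case
      using 7(3,5) f L_at[OF S' k(2) l]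
      by (cases "lower I k l \<le> count q l k \<and> count q l k \<le> upper I k l") (auto simp: linorder_not_less)
  qed auto
  then show ?thesis by (simp add: atLeastLessThanSuc_atLeastAtMost)
qed

lemma run_verify:
  assumes S: "input_state s" "offset_state s" "class_state s" and q: "matching n m q"
    and ip: "\<forall>i\<in>{1..m}. q i \<noteq> 0 \<longrightarrow> nmem s ''ip'' (q i) = i" and z: "nmem s ''ct'' = (\<lambda>_. 0)"
  shows "run verify s (n * (100 + 100 * p)) (\<lambda>s'. nmem s' ''feasible'' 0 = (if count_ok q then 1 else 0))"
proof -
  let ?s0 = "nupd ''feasible'' 0 1 s"
  let ?c = "Seq (NSet ''g'' (NConst 0) (NGet ''cl'' (At ''ip'' ''k'')))
        (NSet ''ct'' (Var ''g'') (NAdd (At ''ct'' ''g'') (NConst 1)))"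
  define ok where "ok k \<longleftrightarrow> (\<forall>l\<in>{1..p}. lower I k l \<le> count q l k \<and> count q l k \<le> upper I k l)" for k
  let ?Inv = "\<lambda>k s'. (\<forall>l\<in>{1..p}. nmem s' ''ct'' l = count q l (k - 1)) \<and>
     nmem s' ''feasible'' 0 = (if \<forall>k\<in>{1..<k}. ok k then 1 else 0)"
  have "run verify s (3 + (11 + n * ((20 + (11 + p * (60 + 14))) + 14))) (?Inv (Suc n))"
    unfolding verify_def
  proof (rule run_Seq)
    show "run (NSet ''feasible'' (NConst 0) (NConst 1)) s 3 (\<lambda>s'. s' = ?s0)"
      by (rule run_loop_free) auto
    fix s0 assume s0: "s0 = ?s0"
    have S0: "input_state s0" "offset_state s0" "class_state s0"
      using S by (simp_all add: s0 input_state_def offset_state_def class_state_def)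
    have n0: "nmem s0 ''n'' 0 = n" using S0 by (simp add: input_state_def)
    show "run (For ''k'' ''n'' (Seq ?c verify_position)) s0 (11 + n * ((20 + (11 + p * (60 + 14))) + 14)) (?Inv (Suc n))"
    proof (rule run_For[OF n0], goal_cases)
      case 4
      then show ?case by (auto simp: s0 z count_def)
    next
      case (5 k s1)
      have S1: "input_state s1" "offset_state s1" "class_state s1"
        using input_state_agree[OF S0(1) 5(4)] offset_state_agree[OF S0(2) 5(4)] class_state_agree[OF S0(3) 5(4)]
        by simp_all
      have k: "k \<in> {1..n}" using 5 by simp
      then obtain c where c: "c \<in> {1..m}" "q c = k" using q unfolding matching_def by blast
      have "q c \<noteq> 0" using c k by simp
      then have "nmem s ''ip'' k = c" using bspec[OF ip c(1)] c(2) by simp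
      then have "nmem s1 ''ip'' k = c" using agree_nmem[OF 5(4), of "''ip''"] by (simp add: s0)
      then have g: "nmem s1 ''cl'' (nmem s1 ''ip'' k) = cls c" using S1(3) c by (simp add: class_state_def)
      define s2 where "s2 = nupd ''ct'' (cls c) (nmem s1 ''ct'' (cls c) + 1) (nupd ''g'' 0 (cls c) s1)"
      have "result ?c s1 = s2" using 5(3) g by (simp add: s2_def)
      then have "run ?c s1 20 (\<lambda>s'. s' = s2)" by (intro run_loop_free) auto
      then show ?case
      proof (rule run_Seq)
        fix s' assume s': "s' = s2" and a2: "agree ?c s1 s'"
        have S2: "input_state s2" "offset_state s2"
          using input_state_agree[OF S1(1) a2] offset_state_agree[OF S1(2) a2] s' by simp_all
        have ct: "\<forall>l\<in>{1..p}. nmem s2 ''ct'' l = count q l k"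
          using 5(5) count_Suc[OF q c 5(1,2)] by (simp add: s2_def)
        have k2: "nmem s2 ''k'' 0 = k" using 5(3) by (simp add: s2_def)
        show "run verify_position s' (11 + p * (60 + 14)) (\<lambda>s''. ?Inv (Suc k) (nupd ''k'' 0 (Suc k) s''))"
          unfolding s' using run_verify_position[OF S2 k2 k ct, folded ok_def]
        proof (rule run_mono)
          fix s3 assume s3: "nmem s3 ''feasible'' 0 = (if ok k then nmem s2 ''feasible'' 0 else 0)"
            and a3: "agree verify_position s2 s3"
          have "{1..<Suc k} = insert k {1..<k}" using 5(1) by auto
          moreover have "nmem s2 ''feasible'' 0 = (if \<forall>k\<in>{1..<k}. ok k then 1 else 0)"
            using 5(5) by (simp add: s2_def)
          moreover have "nmem s3 ''ct'' = nmem s2 ''ct''" using agree_nmem[OF a3] by simp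
          ultimately show "?Inv (Suc k) (nupd ''k'' 0 (Suc k) s3)" using ct s3 by auto
        qed simp
      qed
    qed auto
  qed
  then show ?thesis
  proof (rule run_mono)
    fix s' :: store assume "?Inv (Suc n) s'"
    then show "nmem s' ''feasible'' 0 = (if count_ok q then 1 else 0)"
      unfolding atLeastLessThanSuc_atLeastAtMost count_ok_def ok_def by auto
  next
    have "3 + (11 + n * ((20 + (11 + p * (60 + 14))) + 14)) \<le> n * (60 + 74 * p)"
      using sizes by (simp add: distrib_left)
    also have "\<dots> \<le> n * (100 + 100 * p)" by (rule mult_le_mono2) simp
    finally show "3 + (11 + n * ((20 + (11 + p * (60 + 14))) + 14)) \<le> n * (100 + 100 * p)" .
  qed
qed

end

section \<open>The whole program and its time bound\<close>

definition ranking_program :: com where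
  "ranking_program = Seq (multiples ''i'' ''m'' ''a'' ''n'') (Seq (multiples ''k'' ''n'' ''b'' ''p'') (Seq classify
     (Seq sum_weights (Seq find_best_later (Seq cost_matrix (Seq hungarian
     (Seq swap_last_item (Seq write_ranking verify))))))))"

text \<open>The terms with \<open>p\<close> stem from walking through the property lists and from
  the final check of all bounds. They are the only ones that \<open>n * n * m\<close> does not
  dominate by itself.\<close>

lemma (in lu_problem) run_ranking_program:
  assumes E: "encodes s I"
  shows "run ranking_program s (200 + 400 * m + 200 * n + 40 * p + 200 * (n * m) + 1500 * (n * (n * m)) + 100 * (n * p))
    (\<lambda>s'. correct_output s' I)"
proof -
  have in0: "input_state s" and list0: "list_state s"
    using E by (simp_all add: encodes_def input_state_def list_state_def)
  have mn: "nmem s ''m'' 0 = m" "nmem s ''n'' 0 = n" "nmem s ''p'' 0 = p" using in0 by (simp_all add: input_state_def)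
  have "\<forall>a. a \<notin> {''m'', ''n'', ''p'', ''L'', ''U'', ''pstart'', ''pitems''} \<longrightarrow> nmem s a = (\<lambda>_. 0)"
    using E unfolding encodes_def by (elim conjE)
  then have zn: "nmem s a = (\<lambda>_. 0)" if "a \<notin> {''m'', ''n'', ''p'', ''L'', ''U'', ''pstart'', ''pitems''}" for a
    using that by (elim allE[where x = a] impE)
  have zr: "rmem s a = (\<lambda>_. 0)" if "a \<noteq> ''W''" for a
    using E that unfolding encodes_def by (elim conjE) simp
  obtain t1 s1 where e1: "exec (multiples ''i'' ''m'' ''a'' ''n'') s t1 s1" "t1 \<le> 11 + m * (50 + 14)"
    and r1: "\<forall>i\<le>m. nmem s1 ''a'' i = i * nmem s ''n'' 0" and a1: "agree (multiples ''i'' ''m'' ''a'' ''n'') s s1"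
    by (rule runE[OF run_multiples[OF mn(1), of "''i''" "''a''" "''n''"]]) (simp_all add: zn)
  note f1 = agree_nmem[OF a1] agree_rmem[OF a1]
  have n1: "nmem s1 ''n'' 0 = n" using mn by (simp add: f1)
  obtain t2 s2 where e2: "exec (multiples ''k'' ''n'' ''b'' ''p'') s1 t2 s2" "t2 \<le> 11 + n * (50 + 14)"
    and r2: "\<forall>k\<le>n. nmem s2 ''b'' k = k * nmem s1 ''p'' 0" and a2: "agree (multiples ''k'' ''n'' ''b'' ''p'') s1 s2"
    by (rule runE[OF run_multiples[OF n1, of "''k''" "''b''" "''p''"]]) (simp_all add: zn f1)
  note f2 = agree_nmem[OF a2] agree_rmem[OF a2]
  have in1: "input_state s1" using input_state_agree[OF in0 a1] by simp
  have in2: "input_state s2" using input_state_agree[OF in1 a2] by simp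
  have "nmem s2 ''a'' = nmem s1 ''a''" "nmem s1 ''p'' 0 = p" using mn by (simp_all add: f1 f2)
  then have off2: "offset_state s2" using r1 r2 unfolding offset_state_def mn(2) by simp
  have "nmem s2 a = nmem s a" if "a \<in> {''p'', ''pstart'', ''pitems''}" for a
    using that by (auto simp: f1 f2)
  then have list2: "list_state s2" using list0 unfolding list_state_def by simp
  have "nmem s2 ''cl'' = (\<lambda>_. 0)" by (simp add: f1 f2 zn)
  from runE[OF run_classify[OF list2 this]] obtain t3 s3 where
    e3: "exec classify s2 t3 s3" "t3 \<le> 11 + p * 40 + m * 64" and cl3: "class_state s3" and a3: "agree classify s2 s3" .
  note f3 = agree_nmem[OF a3] agree_rmem[OF a3]
  have S3: "input_state s3" "offset_state s3"
    using input_state_agree[OF in2 a3] offset_state_agree[OF off2 a3] by simp_all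
  from runE[OF run_sum_weights[OF S3]] obtain t4 s4 where
    e4: "exec sum_weights s3 t4 s4" "t4 \<le> n * (200 * m)" and N4: "rmem s4 ''N'' 0 = 1 + 2 * weight"
    and a4: "agree sum_weights s3 s4" .
  note f4 = agree_nmem[OF a4] agree_rmem[OF a4]
  have S4: "input_state s4" "offset_state s4" "class_state s4"
    using input_state_agree[OF S3(1) a4] offset_state_agree[OF S3(2) a4] class_state_agree[OF cl3 a4] by simp_all
  have "nmem s4 ''be'' = (\<lambda>_. 0)" by (simp add: f1 f2 f3 f4 zn)
  from runE[OF run_find_best_later[OF S4 this]] obtain t5 s5 where
    e5: "exec find_best_later s4 t5 s5" "t5 \<le> 11 + m * (100 + 14)" and ag: "best_later (nmem s5 ''ag'')"
    and a5: "agree find_best_later s4 s5" .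
  note f5 = agree_nmem[OF a5] agree_rmem[OF a5]
  define g N where "g = nmem s5 ''ag''" and "N = rmem s5 ''N'' 0"
  have N: "N = 1 + 2 * weight" using N4 by (simp add: N_def f5)
  have w0: "0 \<le> weight" unfolding weight_def by (intro sum_nonneg) simp
  have S5: "input_state s5" "offset_state s5" "class_state s5"
    using input_state_agree[OF S4(1) a5] offset_state_agree[OF S4(2) a5] class_state_agree[OF S4(3) a5] by simp_all
  from runE[OF run_cost_matrix[OF S5 ag, folded g_def N_def]] obtain t6 s6 where
    e6: "exec cost_matrix s5 t6 s6" "t6 \<le> n * (n * (400 * m))"
    and D6: "\<forall>i\<in>{1..m}. \<forall>j\<in>{1..n}. rmem s6 ''D'' (i * n + j) = cost g N j i"
    and a6: "agree cost_matrix s5 s6" .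
  note f6 = agree_nmem[OF a6] agree_rmem[OF a6]
  have S6: "input_state s6" "offset_state s6" "class_state s6"
    using input_state_agree[OF S5(1) a6] offset_state_agree[OF S5(2) a6] class_state_agree[OF S5(3) a6] by simp_all
  have ag': "best_later g" using ag by (simp add: g_def)
  have C6: "cost_state (cost g N) m n s6"
    unfolding cost_state_def
  proof (intro conjI ballI)
    fix i j assume ij: "i \<in> {1..m}" "j \<in> {1..n}"
    show "0 \<le> cost g N j i" using cost_nonneg[OF ag' ij] N w0 by simp
    show "rmem s6 ''D'' (nmem s6 ''a'' i + j) = cost g N j i"
      using D6 ij S6(2) by (simp add: offset_state_def)
  qed (use S6 sizes in \<open>simp_all add: input_state_def\<close>)
  have z6: "nmem s6 ''ru'' = (\<lambda>_. 0)" "nmem s6 ''q'' = (\<lambda>_. 0)" "rmem s6 ''u'' = (\<lambda>_. 0)" "rmem s6 ''v'' = (\<lambda>_. 0)"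
    by (simp_all add: f1 f2 f3 f4 f5 f6 zn zr)
  from runE[OF run_hungarian[OF C6 z6]] obtain t7 s7 where
    e7: "exec hungarian s6 t7 s7" "t7 \<le> n * (n * (1100 * m))" and d7: "dual_state (cost g N) m n s7"
    and a7: "agree hungarian s6 s7" .
  note f7 = agree_nmem[OF a7] agree_rmem[OF a7]
  have S7: "input_state s7" "offset_state s7" "class_state s7"
    using input_state_agree[OF S6(1) a7] offset_state_agree[OF S6(2) a7] class_state_agree[OF S6(3) a7] by simp_all
  define q where "q = nmem s7 ''q''"
  have q: "matching n m q" using dual_inv_matching[OF d7] by (simp add: q_def)
  have opt: "assign_sum (cost g N) m q \<le> assign_sum (cost g N) m q'" if "matching n m q'" for q'
    using dual_inv_optimal[OF d7 that] by (simp add: q_def)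
  have g7: "nmem s7 ''ag'' = g" by (simp add: g_def f6 f7)
  have mn7: "nmem s7 ''m'' 0 = m" "nmem s7 ''n'' 0 = n" using S7 by (simp_all add: input_state_def)
  from runE[OF run_swap_last_item[OF mn7 q[unfolded q_def]]] obtain t8 s8 where
    e8: "exec swap_last_item s7 t8 s8" "t8 \<le> 40 + m * (60 + 14)"
    and r8: "\<exists>c\<in>{1..m}. nmem s7 ''q'' c = n \<and>
      nmem s8 ''q'' = (nmem s7 ''q'')(c := nmem s7 ''q'' (nmem s7 ''ag'' c), nmem s7 ''ag'' c := n)"
    and a8: "agree swap_last_item s7 s8" .
  note f8 = agree_nmem[OF a8] agree_rmem[OF a8]
  define q2 where "q2 = nmem s8 ''q''"
  from r8 obtain c where c: "c \<in> {1..m}" "q c = n" and q2: "q2 = q(c := q (g c), g c := q c)"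
    by (auto simp: q2_def q_def g7)
  have mq2: "matching n m q2" unfolding q2 by (rule swap_last(1)[OF ag' q c])
  have S8: "input_state s8" "offset_state s8" "class_state s8"
    using input_state_agree[OF S7(1) a8] offset_state_agree[OF S7(2) a8] class_state_agree[OF S7(3) a8] by simp_all
  have m8: "nmem s8 ''m'' 0 = m" using S8 by (simp add: input_state_def)
  have "nmem s8 ''x'' = (\<lambda>_. 0)" by (simp add: f1 f2 f3 f4 f5 f6 f7 f8 zn)
  from runE[OF run_write_ranking[OF m8 S8(2) mq2[unfolded q2_def] this], folded q2_def] obtain t9 s9 where
    e9: "exec write_ranking s8 t9 s9" "t9 \<le> 11 + m * (60 + 14)"
    and r9: "(\<forall>i\<in>{1..m}. \<forall>j\<in>{1..n}. nmem s9 ''x'' (i * n + j) = (if q2 i = j then 1 else 0)) \<and>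
      (\<forall>i\<in>{1..m}. q2 i \<noteq> 0 \<longrightarrow> nmem s9 ''ip'' (q2 i) = i)"
    and a9: "agree write_ranking s8 s9" .
  note f9 = agree_nmem[OF a9] agree_rmem[OF a9]
  have S9: "input_state s9" "offset_state s9" "class_state s9"
    using input_state_agree[OF S8(1) a9] offset_state_agree[OF S8(2) a9] class_state_agree[OF S8(3) a9] by simp_all
  have "nmem s9 ''ct'' = (\<lambda>_. 0)" by (simp add: f1 f2 f3 f4 f5 f6 f7 f8 f9 zn)
  from runE[OF run_verify[OF S9 mq2 conjunct2[OF r9] this]] obtain t10 s10 where
    e10: "exec verify s9 t10 s10" "t10 \<le> n * (100 + 100 * p)"
    and r10: "nmem s10 ''feasible'' 0 = (if count_ok q2 then 1 else 0)"
    and a10: "agree verify s9 s10" .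
  have x: "output_ranking s10 I i j = (if q2 i = j then 1 else 0)" if "i \<in> {1..m}" "j \<in> {1..n}" for i j
    using r9 that agree_nmem[OF a10] by (simp add: output_ranking_def)
  have "2 * weight < N" using N by simp
  note fin = assignment_optimal[OF ag' this q opt c q2 x]
  have "correct_output s10 I"
    unfolding correct_output_def using fin r10 by simp
  moreover have "exec ranking_program s (t1 + (t2 + (t3 + (t4 + (t5 + (t6 + (t7 + (t8 + (t9 + t10))))))))) s10"
    unfolding ranking_program_def
    by (rule exec.Seq[OF e1(1) exec.Seq[OF e2(1) exec.Seq[OF e3(1) exec.Seq[OF e4(1) exec.Seq[OF e5(1)
          exec.Seq[OF e6(1) exec.Seq[OF e7(1) exec.Seq[OF e8(1) exec.Seq[OF e9(1) e10(1)]]]]]]]]])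
  moreover have "t1 + (t2 + (t3 + (t4 + (t5 + (t6 + (t7 + (t8 + (t9 + t10))))))))
      \<le> 200 + 400 * m + 200 * n + 40 * p + 200 * (n * m) + 1500 * (n * (n * m)) + 100 * (n * p)"
  proof -
    define x y z where "x = n * m" and "y = n * (n * m)" and "z = n * p"
    have "t4 \<le> 200 * x" "t6 \<le> 400 * y" "t7 \<le> 1100 * y" "t10 \<le> 100 * n + 100 * z"
      using e4(2) e6(2) e7(2) e10(2) by (simp_all add: x_def y_def z_def algebra_simps)
    then show ?thesis
      using e1(2) e2(2) e3(2) e5(2) e8(2) e9(2) unfolding y_def[symmetric]
      unfolding x_def[symmetric] z_def[symmetric] by simp
  qed
  ultimately show ?thesis unfolding run_def by blast
qed

theorem theorem2:
  "\<exists>(prog :: com) (C :: real) (d :: nat).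
     \<forall>(I :: lu_instance) (s :: store).
       valid_instance I \<and> Delta I \<le> 1 \<and> monotone_Monge I \<and> encodes s I \<longrightarrow>
       (\<exists>t s'. exec prog s t s' \<and> correct_output s' I \<and>
          (num_props I \<le> num_positions I * num_items I \<longrightarrow>
             real t \<le> soft_O_bound C d (real (num_positions I ^ 2 * num_items I))))"
\<comment> \<open>The coefficients of the time bound add up to 2640, and each of its products is at
  most \<open>n * n * m\<close> once \<open>p \<le> n * m\<close>. So 3000 is enough, with exponent
  0 for the logarithm.\<close>
proof (rule exI[of _ ranking_program], rule exI[of _ 3000], rule exI[of _ 0], intro allI impI)
  fix I :: lu_instance and s :: store
  assume *: "valid_instance I \<and> Delta I \<le> 1 \<and> monotone_Monge I \<and> encodes s I"
  then interpret lu_problem I by unfold_locales auto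
  obtain t s' where t: "exec ranking_program s t s'" "correct_output s' I"
    "t \<le> 200 + 400 * m + 200 * n + 40 * p + 200 * (n * m) + 1500 * (n * (n * m)) + 100 * (n * p)"
    using run_ranking_program * unfolding run_def by blast
  have "real t \<le> soft_O_bound 3000 0 (real (n ^ 2 * m))" if p: "p \<le> n * m"
  proof -
    define x where "x = n * (n * m)"
    have "1 * (1 * m) \<le> x" "1 * (n * m) \<le> x" unfolding x_def using sizes by (intro mult_le_mono; simp)+
    moreover have "n * p \<le> x" unfolding x_def using p by (rule mult_le_mono2)
    ultimately have "t \<le> 3000 * x" using t(3) p sizes unfolding x_def[symmetric] by linarith
    then have "real t \<le> real (3000 * x)" by (rule of_nat_mono)
    also have "x = n ^ 2 * m" by (simp add: x_def power2_eq_square)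
    finally show ?thesis by (simp add: soft_O_bound_def)
  qed
  with t show "\<exists>t s'. exec ranking_program s t s' \<and> correct_output s' I \<and>
    (p \<le> n * m \<longrightarrow> real t \<le> soft_O_bound 3000 0 (real (n ^ 2 * m)))" by blast
qed

end
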